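(* Let $\gamma_0$ be an initial $\ell$-convex Legendre curve with $\ell(\theta,0)=1$ and algebraic length $L_0$. For $\lambda(t)=\frac{L}{2\pi}$, the flow $$\frac{\partial\gamma}{\partial t}=\frac{\ell(\beta-\lambda(t))'}{\ell^2+\beta^2}\,\mu+(\beta-\lambda(t))\,\nu,\qquad \frac{\partial\nu}{\partial t}=-\frac{\beta(\beta-\lambda(t))'}{\ell^2+\beta^2}\,\mu$$ starting from $\gamma_0$ exists in the time interval $[0,+\infty)$. Meanwhile, the evolving curve is still $\ell$-convex, preserves the algebraic length and converges to a circle of radius $\frac{L_0}{2\pi}$. In particular, if $L_0=0$, then it converges to a point.
   Context: A prime denotes the derivative with respect to the curve parameter $\theta\in\mathbb{S}^1=\mathbb{R}/2\pi\mathbb{Z}$. A (closed) Legendre curve is a map $\gamma:\mathbb{S}^1\to\mathbb{R}^2$ for which there is a smooth unit vector field $\nu:\mathbb{S}^1\to\mathbb{S}^1\subset\mathbb{R}^2$ with $\langle\gamma'(\theta),\nu(\theta)\rangle=0$ for all $\theta$; $\gamma$ may have singular points. Put $\mu=J(\nu)$, where $J$ is the counterclockwise rotation by $\pi/2$. The functions $\ell$ and $\beta$ are defined by $\ell=\langle\nu',\mu\rangle$ and $\gamma'=\beta\mu$. The curve is $\ell$-convex if $\ell>0$. An $\ell$-convex Legendre curve can be reparametrized so that $\ell=1$, and for simplicity attention is restricted to curves with $\ell=1$. For such a curve, $\nu=(\cos\theta,\sin\theta)$ and $\gamma(\theta)=p(\theta)(\cos\theta,\sin\theta)+p'(\theta)(-\sin\theta,\cos\theta)$,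 where $p$ is called the support function. Then $\beta=p+p''$, and the algebraic length is $L=\int_{\mathbb{S}^1}(p+p'')\,d\theta=\int_{\mathbb{S}^1}p\,d\theta$. Replacing $p$ by $-p$ changes the sign of $L$, and attention is restricted to curves with $L\ge 0$. In the flow, which evolves the pair $(\gamma,\nu)$, the quantities $\ell,\beta,\mu,\nu,L$ are those of the evolving curve $\gamma(\cdot,t)$.
   Formalization: The flow's right-hand side is evaluated at each time in the ℓ=1 parametrization of the evolving curve (speed β/ℓ−λ in a general parameter); with a fixed parameter θ the algebraic length is not preserved, e.g. for p=1+ε cos 2θ. *)

theory Defs
  imports "HOL-Analysis.Analysis"
begin

text \<open>
  The plane is \<^typ>\<open>complex\<close> with its real inner product, and functions on the circle
  \<open>\<real>/2\<pi>\<int>\<close> are \<open>2\<pi>\<close>-periodic functions on the reals.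
\<close>

definition periodic :: "(real \<Rightarrow> 'a) \<Rightarrow> bool" where
  "periodic f \<longleftrightarrow> (\<forall>\<theta>. f (\<theta> + 2 * pi) = f \<theta>)"

definition vderiv :: "(real \<Rightarrow> 'a::real_normed_vector) \<Rightarrow> real \<Rightarrow> 'a" where
  "vderiv f \<theta> = vector_derivative f (at \<theta>)"

definition smooth :: "(real \<Rightarrow> 'a::real_normed_vector) \<Rightarrow> bool" where
  "smooth f \<longleftrightarrow> (\<forall>k \<theta>. (vderiv ^^ k) f differentiable (at \<theta>))"

definition rot :: "complex \<Rightarrow> complex" where
  "rot v = \<i> * v"

definition legendre_curve :: "(real \<Rightarrow> complex) \<Rightarrow> (real \<Rightarrow> complex) \<Rightarrow> bool" where
  "legendre_curve \<gamma> \<nu> \<longleftrightarrow>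
     periodic \<gamma> \<and> smooth \<gamma> \<and> periodic \<nu> \<and> smooth \<nu> \<and>
     (\<forall>\<theta>. norm (\<nu> \<theta>) = 1) \<and> (\<forall>\<theta>. vderiv \<gamma> \<theta> \<bullet> \<nu> \<theta> = 0)"

definition ell :: "(real \<Rightarrow> complex) \<Rightarrow> real \<Rightarrow> real" where
  "ell \<nu> \<theta> = vderiv \<nu> \<theta> \<bullet> rot (\<nu> \<theta>)"

text \<open>For a Legendre curve this is the function determined by \<open>\<gamma>' = \<beta>\<mu>\<close>, as \<open>\<nu>, \<mu>\<close> is an
  orthonormal frame.\<close>

definition beta :: "(real \<Rightarrow> complex) \<Rightarrow> (real \<Rightarrow> complex) \<Rightarrow> real \<Rightarrow> real" where
  "beta \<gamma> \<nu> \<theta> = vderiv \<gamma> \<theta> \<bullet> rot (\<nu> \<theta>)"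

definition ell_convex :: "(real \<Rightarrow> complex) \<Rightarrow> (real \<Rightarrow> complex) \<Rightarrow> bool" where
  "ell_convex \<gamma> \<nu> \<longleftrightarrow> legendre_curve \<gamma> \<nu> \<and> (\<forall>\<theta>. ell \<nu> \<theta> > 0)"

definition algebraic_length :: "(real \<Rightarrow> complex) \<Rightarrow> (real \<Rightarrow> complex) \<Rightarrow> real" where
  "algebraic_length \<gamma> \<nu> = integral {0..2 * pi} (beta \<gamma> \<nu>)"

definition velocity_curve ::
    "real \<Rightarrow> (real \<Rightarrow> complex) \<Rightarrow> (real \<Rightarrow> complex) \<Rightarrow> real \<Rightarrow> complex" where
  "velocity_curve lam \<gamma> \<nu> \<theta> =
     (ell \<nu> \<theta> * deriv (\<lambda>x. beta \<gamma> \<nu> x - lam) \<theta> / ((ell \<nu> \<theta>)\<^sup>2 + (beta \<gamma> \<nu> \<theta>)\<^sup>2))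
        *\<^sub>R rot (\<nu> \<theta>)
     + (beta \<gamma> \<nu> \<theta> - lam) *\<^sub>R \<nu> \<theta>"

definition velocity_normal ::
    "real \<Rightarrow> (real \<Rightarrow> complex) \<Rightarrow> (real \<Rightarrow> complex) \<Rightarrow> real \<Rightarrow> complex" where
  "velocity_normal lam \<gamma> \<nu> \<theta> =
     - ((beta \<gamma> \<nu> \<theta> * deriv (\<lambda>x. beta \<gamma> \<nu> x - lam) \<theta> / ((ell \<nu> \<theta>)\<^sup>2 + (beta \<gamma> \<nu> \<theta>)\<^sup>2))
        *\<^sub>R rot (\<nu> \<theta>))"

text \<open>Orientation-preserving diffeomorphisms of the circle, lifted to the line.\<close>

definition circle_reparam :: "(real \<Rightarrow> real) \<Rightarrow> bool" where
  "circle_reparam \<sigma> \<longleftrightarrow>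
     smooth \<sigma> \<and> (\<forall>\<theta>. deriv \<sigma> \<theta> > 0) \<and> (\<forall>\<theta>. \<sigma> (\<theta> + 2 * pi) = \<sigma> \<theta> + 2 * pi)"

text \<open>
  \<open>C_upto k f\<close>: the function \<open>(t, \<theta>) \<mapsto> f t \<theta>\<close> is of class \<open>C\<^sup>k\<close> on \<open>[0, \<infinity>) \<times> \<real>\<close>, with
  one-sided time derivatives at \<open>t = 0\<close>.
\<close>

primrec C_upto :: "nat \<Rightarrow> (real \<Rightarrow> real \<Rightarrow> 'a::real_normed_vector) \<Rightarrow> bool" where
  "C_upto 0 f \<longleftrightarrow> continuous_on ({0..} \<times> UNIV) (\<lambda>(t, \<theta>). f t \<theta>)"
| "C_upto (Suc k) f \<longleftrightarrow>
     continuous_on ({0..} \<times> UNIV) (\<lambda>(t, \<theta>). f t \<theta>) \<and>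
     (\<exists>f\<^sub>t f\<^sub>\<theta>.
        (\<forall>t\<ge>0. \<forall>\<theta>. ((\<lambda>s. f s \<theta>) has_vector_derivative f\<^sub>t t \<theta>) (at t within {0..})) \<and>
        (\<forall>t\<ge>0. \<forall>\<theta>. (f t has_vector_derivative f\<^sub>\<theta> t \<theta>) (at \<theta>)) \<and>
        C_upto k f\<^sub>t \<and> C_upto k f\<^sub>\<theta>)"

definition smooth_family :: "(real \<Rightarrow> real \<Rightarrow> complex) \<Rightarrow> bool" where
  "smooth_family f \<longleftrightarrow> (\<forall>k. C_upto k f) \<and> (\<forall>t\<ge>0. periodic (f t))"

text \<open>
  Global solutions of the flow, with \<open>\<lambda>(t) = L/(2\<pi>)\<close>.  The speed \<open>\<beta> - \<lambda>\<close> depends on the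
  parametrization, and all curves are considered in a parametrization with \<open>\<ell> = 1\<close>.  However, the
  points that move with the flow do not keep a constant parameter with respect to it.  Hence, at
  every time \<open>t\<close>, the right-hand sides (\<open>\<ell>\<close>, \<open>\<beta>\<close>, \<open>\<mu>\<close>, \<open>\<nu>\<close> and the prime) are those of
  the evolving curve in its parametrization \<open>\<gamma> t \<circ> \<sigma>\<close>, \<open>\<nu> t \<circ> \<sigma>\<close> with \<open>\<ell> = 1\<close>, and they
  prescribe the velocity of the moving point with label \<open>\<sigma> \<theta>\<close>.  The diffeomorphism \<open>\<sigma>\<close> is unique
  up to a translation of \<open>\<theta>\<close>, which does not affect the condition.

  With \<open>\<ell>\<close>, \<open>\<beta>\<close> and the prime taken with respect to the labels instead,
  \<open>dL/dt = \<integral> \<beta>\<ell> d\<theta> - L\<close>; if \<open>\<ell> = 1\<close> initially, then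
  \<open>d\<^sup>2L/dt\<^sup>2 = \<integral> \<beta>\<beta>'\<^sup>2/(1+\<beta>\<^sup>2) d\<theta>\<close> at \<open>t = 0\<close>, so the algebraic length would not be
  preserved.
\<close>

definition flow_solution ::
    "(real \<Rightarrow> complex) \<Rightarrow> (real \<Rightarrow> complex) \<Rightarrow>
     (real \<Rightarrow> real \<Rightarrow> complex) \<Rightarrow> (real \<Rightarrow> real \<Rightarrow> complex) \<Rightarrow> bool" where
  "flow_solution \<gamma>\<^sub>0 \<nu>\<^sub>0 \<gamma> \<nu> \<longleftrightarrow>
     smooth_family \<gamma> \<and> smooth_family \<nu> \<and> \<gamma> 0 = \<gamma>\<^sub>0 \<and> \<nu> 0 = \<nu>\<^sub>0 \<and>
     (\<forall>t\<ge>0. \<exists>\<sigma>. circle_reparam \<sigma> \<and> (\<forall>\<theta>. ell (\<nu> t \<circ> \<sigma>) \<theta> = 1) \<and>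
        (let lam = algebraic_length (\<gamma> t) (\<nu> t) / (2 * pi) in
          (\<forall>\<theta>. ((\<lambda>s. \<gamma> s (\<sigma> \<theta>)) has_vector_derivative
                  velocity_curve lam (\<gamma> t \<circ> \<sigma>) (\<nu> t \<circ> \<sigma>) \<theta>) (at t within {0..})) \<and>
          (\<forall>\<theta>. ((\<lambda>s. \<nu> s (\<sigma> \<theta>)) has_vector_derivative
                  velocity_normal lam (\<gamma> t \<circ> \<sigma>) (\<nu> t \<circ> \<sigma>) \<theta>) (at t within {0..}))))"

text \<open>
  Smooth convergence, with the curves in the parametrization by the normal angle
  (\<open>\<ell> = 1\<close>, \<open>\<nu> = (cos \<theta>, sin \<theta>)\<close>).
\<close>

definition converges_to_circle ::
    "(real \<Rightarrow> real \<Rightarrow> complex) \<Rightarrow> (real \<Rightarrow> real \<Rightarrow> complex) \<Rightarrow> complex \<Rightarrow> real \<Rightarrow> bool" where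
  "converges_to_circle \<gamma> \<nu> c r \<longleftrightarrow>
     (\<exists>\<sigma>. (\<forall>t\<ge>0. circle_reparam (\<sigma> t) \<and> (\<forall>\<theta>. \<nu> t (\<sigma> t \<theta>) = cis \<theta>)) \<and>
          (\<forall>k. uniform_limit UNIV (\<lambda>t. (vderiv ^^ k) (\<gamma> t \<circ> \<sigma> t))
                 ((vderiv ^^ k) (\<lambda>\<theta>. c + r *\<^sub>R cis \<theta>)) at_top))"

end

theory Submission
  imports Defs
begin

text \<open>
  In the parametrization by the normal angle \<open>\<theta>\<close>, where \<open>\<nu> = (cos \<theta>, sin \<theta>)\<close>, the flow becomes linear:
  the support function satisfies \<open>p\<^sub>t = p'' + p - \<lambda>\<close>.  Hence the \<open>n\<close>-th Fourier coefficient of \<open>p\<close> evolves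
  by the factor \<open>exp (-(n\<^sup>2 - 1) t)\<close> for \<open>n \<ge> 1\<close>, the mean is preserved since it is \<open>\<lambda>\<close>, and in the limit
  only the modes \<open>n \<le> 1\<close> remain: a circle of radius \<open>L\<^sub>0/(2\<pi>)\<close>, with centre given by the mode \<open>n = 1\<close>.

  For existence, \<open>p\<close> is the sum of its Fourier series, and the normal angle \<open>\<phi>(t, u)\<close> of the point with
  label \<open>u\<close> solves the ordinary differential equation \<open>\<phi>\<^sub>t = -\<beta>\<beta>'/(1 + \<beta>\<^sup>2)\<close>.  For an arbitrary solution,
  \<open>|\<nu>|\<close> and \<open>\<langle>\<gamma>', \<nu>\<rangle>\<close> are constant in time, so all curves are Legendre curves, and the Fourier coefficients
  of \<open>p\<close> are differentiated under the integral over the labels, which are fixed in time.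
\<close>

section \<open>Smooth families of functions\<close>

text \<open>The linear equation appears because, in the normal angle, only the
  \<open>\<nu>\<close>-component \<open>\<beta> - \<lambda>\<close> of the velocity changes
  \<open>p\<close>; the tangential component and the turning of the normal merely transport labels
  along the curve. Their coefficients are matched so that this transport is compatible with the
  Legendre condition. The obstacle for an arbitrary solution is that \<open>flow_solution\<close>
  offers, at every time separately, some parametrization with \<open>\<ell> = 1\<close>, and says
  nothing about its dependence on time. The support function in the normal angle therefore cannot be
  differentiated in \<open>t\<close> directly. Integrals over labels can, and a change of variables
  at one fixed time evaluates the result: the transport contributes an exact derivative, which
  integrates to zero over a period. All conclusions are thus reached for each solution by itself,
  without a uniqueness theorem for the flow. Existence is global because the vector field that moves
  the normal angles is bounded, together with its space derivative, uniformly for all times.\<close>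

abbreviation continuous_family :: "(real \<Rightarrow> real \<Rightarrow> 'a::topological_space) \<Rightarrow> bool" where
  "continuous_family f \<equiv> continuous_on ({0..} \<times> UNIV) (\<lambda>(t, x). f t x)"

declare C_upto.simps(2) [simp del]

text \<open>One unfolding of \<open>C_upto (Suc k)\<close> with the partials as arguments, so that
  each rule of calculus is stated once and reused at every order \<open>k\<close>.\<close>

definition has_partials ::
    "(real \<Rightarrow> real \<Rightarrow> 'a::real_normed_vector) \<Rightarrow> (real \<Rightarrow> real \<Rightarrow> 'a) \<Rightarrow> (real \<Rightarrow> real \<Rightarrow> 'a) \<Rightarrow> bool" where
  "has_partials f ft fx \<longleftrightarrow>
     continuous_family f \<and>
     (\<forall>t\<ge>0. \<forall>x. ((\<lambda>s. f s x) has_vector_derivative ft t x) (at t within {0..})) \<and>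
     (\<forall>t\<ge>0. \<forall>x. (f t has_vector_derivative fx t x) (at x))"

lemma has_partialsD:
  assumes "has_partials f ft fx"
  shows "continuous_family f"
    and "t \<ge> 0 \<Longrightarrow> ((\<lambda>s. f s x) has_vector_derivative ft t x) (at t within {0..})"
    and "t \<ge> 0 \<Longrightarrow> (f t has_vector_derivative fx t x) (at x)"
  using assms by (auto simp: has_partials_def)

lemma C_upto_Suc_partials:
  "C_upto (Suc k) f \<longleftrightarrow> (\<exists>ft fx. has_partials f ft fx \<and> C_upto k ft \<and> C_upto k fx)"
  unfolding C_upto.simps(2) has_partials_def by blast

lemma C_upto_continuous: "C_upto k f \<Longrightarrow> continuous_family f"
  by (cases k) (auto simp: C_upto_Suc_partials dest: has_partialsD)

lemma continuous_on_halfplane_compose: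
  assumes "continuous_family f"
    and "continuous_on A a" "continuous_on A b" "\<And>x. x \<in> A \<Longrightarrow> a x \<ge> (0::real)"
  shows "continuous_on A (\<lambda>x. f (a x) (b x))"
  using continuous_on_compose2[OF assms(1) continuous_on_Pair[OF assms(2,3)]] assms(4)
  by auto

lemma C_upto_SucD: "C_upto (Suc k) f \<Longrightarrow> C_upto k f"
proof (induction k arbitrary: f)
  case 0
  then show ?case using C_upto_continuous[of "Suc 0" f] by simp
next
  case (Suc k)
  then show ?case unfolding C_upto_Suc_partials[of "Suc k"] C_upto_Suc_partials[of k] by blast
qed

text \<open>Nontriviality of this filter makes one-sided time derivatives unique, also at the
  endpoint \<open>t = 0\<close>; the computations of \<open>dt\<close> rest on it.\<close>

lemma at_within_atLeast_neq_bot: "(0::real) \<le> t \<Longrightarrow> at t within {0..} \<noteq> bot"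
proof -
  assume "0 \<le> t"
  then have "at t within {t..t+1} \<le> at t within {0..}"
    by (intro at_le) auto
  moreover have "at t within {t..t+1} \<noteq> bot"
    by (simp add: at_within_Icc_at_right)
  ultimately show ?thesis by (metis bot.extremum_uniqueI)
qed

lemma has_partials_cong:
  assumes "has_partials f ft fx" and "\<And>t x. t \<ge> 0 \<Longrightarrow> g t x = f t x"
    and "\<And>t x. t \<ge> 0 \<Longrightarrow> gt t x = ft t x" and "\<And>t x. t \<ge> 0 \<Longrightarrow> gx t x = fx t x"
  shows "has_partials g gt gx"
  unfolding has_partials_def
proof (intro conjI allI impI)
  show "continuous_family g"
    using has_partialsD(1)[OF assms(1)]
    by (rule continuous_on_eq) (auto simp: assms(2))
  fix t x :: real assume t: "0 \<le> t"
  show "((\<lambda>s. g s x) has_vector_derivative gt t x) (at t within {0..})"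
    unfolding assms(3)[OF t]
    by (rule has_vector_derivative_transform[OF _ _ has_partialsD(2)[OF assms(1) t]])
      (use t assms(2) in auto)
  have "g t = f t" using assms(2)[OF t] by blast
  then show "(g t has_vector_derivative gx t x) (at x)"
    using has_partialsD(3)[OF assms(1) t] assms(4)[OF t] by simp
qed

lemma C_upto_cong:
  assumes "C_upto k f" and "\<And>t x. t \<ge> 0 \<Longrightarrow> g t x = f t x"
  shows "C_upto k g"
proof (cases k)
  case 0
  have "continuous_family g"
    using C_upto_continuous[OF assms(1)] by (rule continuous_on_eq) (auto simp: assms(2))
  then show ?thesis by (simp add: 0)
next
  case (Suc j)
  from assms(1) obtain ft fx where "has_partials f ft fx" "C_upto j ft" "C_upto j fx"
    unfolding Suc C_upto_Suc_partials by blast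
  moreover from this(1) have "has_partials g ft fx"
    by (rule has_partials_cong) (auto simp: assms(2))
  ultimately show ?thesis unfolding Suc C_upto_Suc_partials by blast
qed

text \<open>Canonical partials. The witnesses in \<open>C_upto (Suc k)\<close> may depend on
  \<open>k\<close>; fixing them as functions of \<open>f\<close> is what allows \<open>C_inf\<close>
  to pass to partial derivatives. For \<open>t < 0\<close> the value of \<open>dt\<close> is
  arbitrary, so equalities between families are only asked for on \<open>t \<ge> 0\<close>.\<close>

definition dt :: "(real \<Rightarrow> real \<Rightarrow> 'a::real_normed_vector) \<Rightarrow> real \<Rightarrow> real \<Rightarrow> 'a" where
  "dt f t x = vector_derivative (\<lambda>s. f s x) (at t within {0..})"

definition dx :: "(real \<Rightarrow> real \<Rightarrow> 'a::real_normed_vector) \<Rightarrow> real \<Rightarrow> real \<Rightarrow> 'a" where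
  "dx f t x = vderiv (f t) x"

lemma has_partials_dt_dx:
  assumes "has_partials f ft fx" "t \<ge> 0"
  shows "dt f t x = ft t x" "dx f t x = fx t x"
  unfolding dt_def dx_def vderiv_def
  using vector_derivative_within[OF at_within_atLeast_neq_bot has_partialsD(2)[OF assms], OF assms(2)]
    vector_derivative_at[OF has_partialsD(3)[OF assms]] by auto

lemma C_upto_Suc_dt_dx:
  "C_upto (Suc k) f \<longleftrightarrow> has_partials f (dt f) (dx f) \<and> C_upto k (dt f) \<and> C_upto k (dx f)"
proof
  assume "C_upto (Suc k) f"
  then obtain ft fx where *: "has_partials f ft fx" "C_upto k ft" "C_upto k fx"
    unfolding C_upto_Suc_partials by blast
  show "has_partials f (dt f) (dx f) \<and> C_upto k (dt f) \<and> C_upto k (dx f)"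
    using C_upto_cong[OF *(2), of "dt f"] C_upto_cong[OF *(3), of "dx f"]
      has_partials_cong[OF *(1), of f "dt f" "dx f"] has_partials_dt_dx[OF *(1)]
    by auto
qed (auto simp: C_upto_Suc_partials)

definition C_inf :: "(real \<Rightarrow> real \<Rightarrow> 'a::real_normed_vector) \<Rightarrow> bool" where
  "C_inf f \<longleftrightarrow> (\<forall>k. C_upto k f)"

lemma C_infD: "C_inf f \<Longrightarrow> C_upto k f"
  by (simp add: C_inf_def)

lemma C_inf_dt_dx:
  assumes "C_inf f"
  shows "has_partials f (dt f) (dx f)" "C_inf (dt f)" "C_inf (dx f)"
proof -
  have *: "C_upto (Suc k) f" for k using assms by (simp add: C_inf_def)
  show "has_partials f (dt f) (dx f)" using *[of 0] unfolding C_upto_Suc_dt_dx by blast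
  show "C_inf (dt f)" "C_inf (dx f)"
    using * unfolding C_inf_def C_upto_Suc_dt_dx by blast+
qed

lemma C_inf_cong: "C_inf f \<Longrightarrow> (\<And>t x. t \<ge> 0 \<Longrightarrow> g t x = f t x) \<Longrightarrow> C_inf g"
  unfolding C_inf_def using C_upto_cong by blast

text \<open>\<open>C_inf\<close> contains every class of continuous families that is closed under
  some choice of partials. For explicit families such as multiples of \<open>cis\<close> or heat
  series this replaces an induction on the order.\<close>

lemma C_inf_coinduct:
  assumes "X f" and step: "\<And>f. X f \<Longrightarrow> \<exists>ft fx. has_partials f ft fx \<and> X ft \<and> X fx"
  shows "C_inf f"
proof -
  have "C_upto k f" if "X f" for k f
    using that
  proof (induction k arbitrary: f)
    case 0
    then show ?case using step[OF 0] by (auto simp: has_partials_def)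
  next
    case (Suc k)
    then show ?case using step[OF Suc.prems] unfolding C_upto_Suc_partials by blast
  qed
  then show ?thesis using assms(1) by (simp add: C_inf_def)
qed

section \<open>Closure of smooth families under algebraic operations and composition\<close>

lemma has_partials_const: "has_partials (\<lambda>t x. c) (\<lambda>t x. 0) (\<lambda>t x. 0)"
  by (auto simp: has_partials_def case_prod_unfold)

lemma C_inf_const: "C_inf (\<lambda>t x. c)"
proof (rule C_inf_coinduct[where X = "\<lambda>f. \<exists>c. f = (\<lambda>t x. c)"])
  fix f :: "real \<Rightarrow> real \<Rightarrow> 'a"
  assume "\<exists>c. f = (\<lambda>t x. c)"
  then obtain c where "f = (\<lambda>t x. c)" by blast
  then have "has_partials f (\<lambda>t x. 0) (\<lambda>t x. 0)" by (simp add: has_partials_const)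
  then show "\<exists>ft fx. has_partials f ft fx \<and> (\<exists>c. ft = (\<lambda>t x. c)) \<and> (\<exists>c. fx = (\<lambda>t x. c))"
    by blast
qed blast

lemma has_partials_add:
  "has_partials f ft fx \<Longrightarrow> has_partials g gt gx \<Longrightarrow>
   has_partials (\<lambda>t x. f t x + g t x) (\<lambda>t x. ft t x + gt t x) (\<lambda>t x. fx t x + gx t x)"
  unfolding has_partials_def case_prod_unfold
  by (intro conjI allI impI continuous_on_add has_vector_derivative_add) blast+

lemma C_upto_add: "C_upto k f \<Longrightarrow> C_upto k g \<Longrightarrow> C_upto k (\<lambda>t x. f t x + g t x)"
proof (induction k arbitrary: f g)
  case 0
  then show ?case by (auto simp: case_prod_unfold intro!: continuous_intros)
next
  case (Suc k)
  then show ?case unfolding C_upto_Suc_partials using has_partials_add by blast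
qed

context bounded_bilinear
begin

lemma has_partials:
  "has_partials f ft fx \<Longrightarrow> has_partials g gt gx \<Longrightarrow>
   has_partials (\<lambda>t x. prod (f t x) (g t x)) (\<lambda>t x. prod (f t x) (gt t x) + prod (ft t x) (g t x))
      (\<lambda>t x. prod (f t x) (gx t x) + prod (fx t x) (g t x))"
  unfolding has_partials_def case_prod_unfold
  by (intro conjI allI impI continuous_on has_vector_derivative) blast+

lemma C_upto: "C_upto k f \<Longrightarrow> C_upto k g \<Longrightarrow> C_upto k (\<lambda>t x. prod (f t x) (g t x))"
proof (induction k arbitrary: f g)
  case 0
  then show ?case by (auto simp: case_prod_unfold intro!: continuous_on)
next
  case (Suc k)
  from Suc.prems obtain ft fx gt gx where
    *: "has_partials f ft fx" "C_upto k ft" "C_upto k fx"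
       "has_partials g gt gx" "C_upto k gt" "C_upto k gx"
    unfolding C_upto_Suc_partials by blast
  have "C_upto k f" "C_upto k g" using Suc.prems by (auto intro: C_upto_SucD)
  then show ?case unfolding C_upto_Suc_partials
    using has_partials[OF *(1,4)] *
    by (intro exI conjI) (assumption | rule C_upto_add Suc.IH)+
qed

lemma C_inf: "C_inf f \<Longrightarrow> C_inf g \<Longrightarrow> C_inf (\<lambda>t x. prod (f t x) (g t x))"
  unfolding C_inf_def by (blast intro: C_upto)

end

lemmas C_upto_mult = bounded_bilinear.C_upto[OF bounded_bilinear_mult]
lemmas C_upto_scaleR = bounded_bilinear.C_upto[OF bounded_bilinear_scaleR]
lemmas C_inf_mult = bounded_bilinear.C_inf[OF bounded_bilinear_mult]
lemmas C_inf_scaleR = bounded_bilinear.C_inf[OF bounded_bilinear_scaleR]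
lemmas C_inf_inner = bounded_bilinear.C_inf[OF bounded_bilinear_inner]

lemma C_inf_add: "C_inf f \<Longrightarrow> C_inf g \<Longrightarrow> C_inf (\<lambda>t x. f t x + g t x)"
  unfolding C_inf_def by (blast intro: C_upto_add)

lemma C_inf_uminus:
  fixes f :: "real \<Rightarrow> real \<Rightarrow> 'a::real_normed_vector"
  shows "C_inf f \<Longrightarrow> C_inf (\<lambda>t x. - f t x)"
  using C_inf_scaleR[OF C_inf_const[of "-1"], of f] by simp

lemma C_inf_of_real:
  fixes f :: "real \<Rightarrow> real \<Rightarrow> real"
  shows "C_inf f \<Longrightarrow> C_inf (\<lambda>t x. of_real (f t x) :: 'a::real_normed_algebra_1)"
  using C_inf_scaleR[OF _ C_inf_const[of 1], of f] by (simp add: of_real_def)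

text \<open>Chain rule when time enters both directly and through the curve. On the closed
  half-plane, joint differentiability follows from the existence of both partials and the continuity
  of the spatial one.\<close>

lemma has_vector_derivative_along_curve:
  assumes F: "has_partials F Ft Fx" and cont: "continuous_family Fx"
    and t: "t \<ge> 0" and c: "(c has_vector_derivative c') (at t within {0..})"
  shows "((\<lambda>s. F s (c s)) has_vector_derivative Ft t (c t) + c' *\<^sub>R Fx t (c t)) (at t within {0..})"
proof -
  have *: "((\<lambda>(t, y). F t y) has_derivative
      (\<lambda>(ta, ya). ta *\<^sub>R Ft t (c t) + blinfun_apply (blinfun_scaleR_left (Fx t (c t))) ya))
      (at (t, c t) within {0..} \<times> UNIV)"
  proof (rule has_derivative_partialsI)
    show "((\<lambda>s. F s (c t)) has_derivative (\<lambda>s. s *\<^sub>R Ft t (c t))) (at t within {0..})"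
      using has_partialsD(2)[OF F t] by (simp add: has_vector_derivative_def)
    show "(F s has_derivative blinfun_apply (blinfun_scaleR_left (Fx s y))) (at y within UNIV)"
      if "s \<in> {0..}" for s y
      using has_partialsD(3)[OF F, of s y] that by (simp add: has_vector_derivative_def)
    have "continuous_family (\<lambda>t x. blinfun_scaleR_left (Fx t x))"
      using cont unfolding case_prod_unfold
      by (intro continuous_intros)
    then show "continuous (at (t, c t) within {0..} \<times> UNIV) (\<lambda>(t, x). blinfun_scaleR_left (Fx t x))"
      using t by (auto simp: continuous_on_eq_continuous_within)
  qed (use t in auto)
  have "((\<lambda>s. (s, c s)) has_derivative (\<lambda>h. (h, h *\<^sub>R c'))) (at t within {0..})"
    using c unfolding has_vector_derivative_def by (auto intro!: derivative_eq_intros)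
  from has_derivative_in_compose[OF this has_derivative_subset[OF *]]
  show ?thesis
    by (auto simp: has_vector_derivative_def algebra_simps image_subset_iff)
qed

lemma has_partials_compose:
  fixes F :: "real \<Rightarrow> real \<Rightarrow> 'a::real_normed_vector"
  assumes F: "has_partials F Ft Fx" and cont: "continuous_family Fx"
    and g: "has_partials g gt gx"
  shows "has_partials (\<lambda>t u. F t (g t u)) (\<lambda>t u. Ft t (g t u) + gt t u *\<^sub>R Fx t (g t u))
           (\<lambda>t u. gx t u *\<^sub>R Fx t (g t u))"
  unfolding has_partials_def
proof (intro conjI allI impI)
  show "continuous_family (\<lambda>t u. F t (g t u))"
    using has_partialsD(1)[OF g] unfolding case_prod_unfold
    by (intro continuous_on_halfplane_compose[OF has_partialsD(1)[OF F]] continuous_intros) auto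
  fix t u :: real assume t: "0 \<le> t"
  show "((\<lambda>s. F s (g s u)) has_vector_derivative Ft t (g t u) + gt t u *\<^sub>R Fx t (g t u)) (at t within {0..})"
    by (rule has_vector_derivative_along_curve[OF F cont t has_partialsD(2)[OF g t]])
  show "((\<lambda>u. F t (g t u)) has_vector_derivative gx t u *\<^sub>R Fx t (g t u)) (at u)"
    using vector_diff_chain_at[OF has_partialsD(3)[OF g t] has_partialsD(3)[OF F t]]
    by (simp add: o_def)
qed

lemma C_upto_compose:
  assumes "C_upto k F" "C_upto k g"
  shows "C_upto k (\<lambda>t u. F t (g t u))"
  using assms
proof (induction k arbitrary: F g)
  case 0
  then have "continuous_on ({0..} \<times> UNIV) (\<lambda>x. F (fst x) (g (fst x) (snd x)))"
    by (intro continuous_on_halfplane_compose[of F]) (auto simp: case_prod_unfold intro!: continuous_intros)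
  then show ?case by (simp add: case_prod_unfold)
next
  case (Suc k)
  from Suc.prems obtain Ft Fx gt gx where
    *: "has_partials F Ft Fx" "C_upto k Ft" "C_upto k Fx"
       "has_partials g gt gx" "C_upto k gt" "C_upto k gx"
    unfolding C_upto_Suc_partials by blast
  have "C_upto k g" using Suc.prems by (auto intro: C_upto_SucD)
  then have "C_upto k (\<lambda>t u. Ft t (g t u) + gt t u *\<^sub>R Fx t (g t u))"
    "C_upto k (\<lambda>t u. gx t u *\<^sub>R Fx t (g t u))"
    using C_upto_add[OF Suc.IH[OF *(2)] C_upto_scaleR[OF *(5) Suc.IH[OF *(3)]]]
      C_upto_scaleR[OF *(6) Suc.IH[OF *(3)]] by blast+
  then show ?case unfolding C_upto_Suc_partials
    using has_partials_compose[OF *(1) C_upto_continuous[OF *(3)] *(4)] by blast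
qed

lemma C_inf_compose: "C_inf F \<Longrightarrow> C_inf g \<Longrightarrow> C_inf (\<lambda>t u. F t (g t u))"
  unfolding C_inf_def by (blast intro: C_upto_compose)

text \<open>The inverse \<open>g\<close> of \<open>f\<close> satisfies \<open>g' = - g f' g\<close>
  in either variable, so order \<open>k\<close> for \<open>g\<close> together with all orders for
  \<open>f\<close> gives order \<open>Suc k\<close> for \<open>g\<close>.\<close>

lemma C_inf_inverse:
  fixes f :: "real \<Rightarrow> real \<Rightarrow> 'a::real_normed_field"
  assumes "C_inf f" and nz: "\<And>t x. t \<ge> 0 \<Longrightarrow> f t x \<noteq> 0"
  shows "C_inf (\<lambda>t x. inverse (f t x))"
  unfolding C_inf_def
proof
  fix k
  show "C_upto k (\<lambda>t x. inverse (f t x))"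
  proof (induction k)
    case 0
    show ?case using C_upto_continuous[OF C_infD[OF assms(1)]] nz
      by (auto simp: case_prod_unfold intro!: continuous_intros)
  next
    case (Suc k)
    let ?g = "\<lambda>t x. inverse (f t x)"
    note f = C_inf_dt_dx[OF assms(1)]
    have d: "((\<lambda>s. inverse (h s)) has_vector_derivative - (inverse (h t) * h' * inverse (h t))) (at t within S)"
      if "(h has_vector_derivative h') (at t within S)" "h t \<noteq> 0"
      for h :: "real \<Rightarrow> 'a" and h' t S
    proof -
      have "((\<lambda>s. inverse (h s)) has_derivative (\<lambda>x. - (inverse (h t) * (x *\<^sub>R h') * inverse (h t)))) (at t within S)"
        by (rule Deriv.has_derivative_inverse[OF that(2) that(1)[unfolded has_vector_derivative_def]])
      then show ?thesis by (simp add: has_vector_derivative_def)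
    qed
    have "has_partials ?g (\<lambda>t x. - (?g t x * dt f t x * ?g t x)) (\<lambda>t x. - (?g t x * dx f t x * ?g t x))"
      unfolding has_partials_def
    proof (intro conjI allI impI)
      show "continuous_family (\<lambda>t x. ?g t x)"
        using C_upto_continuous[OF Suc.IH] .
    qed (auto intro!: d has_partialsD[OF f(1)] nz)
    moreover have "C_upto k (\<lambda>t x. (- 1) *\<^sub>R (?g t x * dt f t x * ?g t x))"
      "C_upto k (\<lambda>t x. (- 1) *\<^sub>R (?g t x * dx f t x * ?g t x))"
      by (intro C_upto_scaleR C_upto_mult C_infD C_inf_const f Suc.IH)+
    ultimately show ?case unfolding C_upto_Suc_partials scaleR_minus1_left by blast
  qed
qed

lemma C_inf_cis: "C_inf (\<lambda>t. cis)"
proof -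
  \<comment> \<open>The coinductive class must contain both partials. All complex multiples of
    \<open>cis\<close> form such a class: the space derivative multiplies by \<open>\<i>\<close>,
    the time derivative is the multiple by 0.\<close>
  have "C_inf (\<lambda>t x. 1 * cis x)"
  proof (rule C_inf_coinduct[where X = "\<lambda>f. \<exists>a. f = (\<lambda>t x. a * cis x)"])
    fix f :: "real \<Rightarrow> real \<Rightarrow> complex"
    assume "\<exists>a. f = (\<lambda>t x. a * cis x)"
    then obtain a where f: "f = (\<lambda>t x. a * cis x)" by blast
    have "(cis has_vector_derivative \<i> * cis x) (at x)" for x
      unfolding has_vector_derivative_def by (auto intro!: derivative_eq_intros)
    then have "has_partials f (\<lambda>t x. 0 * cis x) (\<lambda>t x. (a * \<i>) * cis x)"
      unfolding has_partials_def f case_prod_unfold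
      by (auto intro!: continuous_intros derivative_eq_intros simp: mult.assoc)
    then show "\<exists>ft fx. has_partials f ft fx \<and> (\<exists>a. ft = (\<lambda>t x. a * cis x)) \<and> (\<exists>a. fx = (\<lambda>t x. a * cis x))"
      by blast
  qed blast
  then show ?thesis by simp
qed

lemma C_inf_exp: "C_inf (\<lambda>t. exp :: real \<Rightarrow> real)"
proof -
  have "C_inf (\<lambda>t x. 1 * exp x :: real)"
  proof (rule C_inf_coinduct[where X = "\<lambda>f. \<exists>a. f = (\<lambda>t x. a * exp x)"])
    fix f :: "real \<Rightarrow> real \<Rightarrow> real"
    assume "\<exists>a. f = (\<lambda>t x. a * exp x)"
    then obtain a where f: "f = (\<lambda>t x. a * exp x)" by blast
    have "has_partials f (\<lambda>t x. 0 * exp x) (\<lambda>t x. a * exp x)"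
      unfolding has_partials_def f case_prod_unfold
      by (auto intro!: continuous_intros derivative_eq_intros
          simp flip: has_real_derivative_iff_has_vector_derivative)
    then show "\<exists>ft fx. has_partials f ft fx \<and> (\<exists>a. ft = (\<lambda>t x. a * exp x)) \<and> (\<exists>a. fx = (\<lambda>t x. a * exp x))"
      by blast
  qed blast
  then show ?thesis by simp
qed

lemma C_inf_snd: "C_inf (\<lambda>t x. x)"
  unfolding C_inf_def
proof
  fix k
  have "has_partials (\<lambda>t x. x) (\<lambda>t x. 0) (\<lambda>t x. 1)"
    unfolding has_partials_def case_prod_unfold
    by (intro conjI allI impI continuous_on_snd continuous_on_id has_vector_derivative_const
        has_vector_derivative_id)
  then show "C_upto k (\<lambda>t x. x)"
    using C_infD[OF C_inf_const[of "0::real"], of k] C_infD[OF C_inf_const[of "1::real"], of k]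
    by (intro C_upto_SucD[of k "\<lambda>t x. x"]) (unfold C_upto_Suc_partials, blast)
qed

text \<open>Functions of one variable are treated as families that do not depend on \<open>t\<close>.\<close>

lemma smooth_imp_differentiable: "smooth f \<Longrightarrow> (f has_vector_derivative vderiv f x) (at x)"
  unfolding smooth_def vderiv_def by (metis funpow_0 vector_derivative_works)

lemma smooth_vderiv: "smooth f \<Longrightarrow> smooth (vderiv f)"
  unfolding smooth_def by (metis funpow_Suc_right o_apply)

lemma smooth_imp_continuous: "smooth f \<Longrightarrow> continuous_on S f"
  by (meson continuous_at_imp_continuous_on has_vector_derivative_continuous smooth_imp_differentiable)

lemma vderiv_zero: "vderiv (\<lambda>x. c) = (\<lambda>x. 0)"
  unfolding vderiv_def by (auto intro: vector_derivative_at)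

lemma vderiv_eqI: "(\<And>x. (f has_vector_derivative g x) (at x)) \<Longrightarrow> vderiv f = g"
  unfolding vderiv_def by (auto intro: vector_derivative_at)

lemma smooth_iff_C_inf:
  fixes f :: "real \<Rightarrow> 'a::real_normed_vector"
  shows "smooth f \<longleftrightarrow> C_inf (\<lambda>_. f)"
proof
  assume "smooth f"
  then show "C_inf (\<lambda>_. f)"
  proof (intro C_inf_coinduct[where X = "\<lambda>g. \<exists>h. smooth h \<and> g = (\<lambda>_. h)"], goal_cases)
    case 1 then show ?case by blast
  next
    case (2 g)
    then obtain h where h: "smooth h" "g = (\<lambda>_. h)" by blast
    have z: "smooth (\<lambda>_. 0 :: 'a)"
    proof -
      have "(vderiv ^^ k) (\<lambda>_. 0 :: 'a) = (\<lambda>_. 0)" for k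
        by (induction k) (auto simp: vderiv_zero)
      then show ?thesis by (simp add: smooth_def)
    qed
    have "has_partials g (\<lambda>_ _. 0) (\<lambda>_. vderiv h)"
      unfolding has_partials_def h case_prod_unfold
      using smooth_imp_differentiable[OF h(1)]
      by (auto intro!: continuous_on_compose2[OF smooth_imp_continuous[OF h(1)]] continuous_intros)
    then show ?case using z smooth_vderiv[OF h(1)] by blast
  qed
next
  assume f: "C_inf (\<lambda>_. f)"
  have "C_inf (\<lambda>_. (vderiv ^^ k) f)" for k
  proof (induction k)
    case (Suc k)
    from C_inf_dt_dx(3)[OF this] show ?case by (simp add: dx_def [abs_def])
  qed (simp add: f)
  from has_partialsD(3)[OF C_inf_dt_dx(1)[OF this], of 0]
  show "smooth f" unfolding smooth_def by (meson differentiableI_vector order_refl)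
qed

lemma C_inf_slice: "C_inf f \<Longrightarrow> t \<ge> 0 \<Longrightarrow> smooth (f t)"
  unfolding smooth_iff_C_inf
proof (rule C_inf_coinduct[where X = "\<lambda>g. \<exists>f. C_inf f \<and> g = (\<lambda>_. f t)"], goal_cases)
  case 1 then show ?case by blast
next
  case (2 g)
  then obtain f where f: "C_inf f" "g = (\<lambda>_. f t)" by blast
  have "continuous_on UNIV (f t)"
    using has_partialsD(3)[OF C_inf_dt_dx(1)[OF f(1)] 2(2)]
    by (meson continuous_at_imp_continuous_on has_vector_derivative_continuous)
  then have "has_partials g (\<lambda>_ _. 0) (\<lambda>_. dx f t)"
    using has_partialsD(3)[OF C_inf_dt_dx(1)[OF f(1)] 2(2)] unfolding has_partials_def f case_prod_unfold
    by (auto intro!: continuous_on_compose2[of UNIV "f t"] continuous_intros)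
  then show ?case using C_inf_dt_dx(3)[OF f(1)] C_inf_const[of "0::'a"]
    by (intro exI[of _ "\<lambda>_ _. 0"] exI[of _ "\<lambda>_. dx f t"]) blast
qed

section \<open>Integrals with variable upper limit, and symmetry of mixed derivatives\<close>

lemma integral_scaled:
  fixes f :: "real \<Rightarrow> 'a::banach"
  assumes "t \<ge> 0" "continuous_on {0..} f"
  shows "integral {0..t} f = t *\<^sub>R integral {0..1} (\<lambda>r. f (t * r))"
proof (cases "t = 0")
  case False
  have "(f has_integral integral {0..t} f) {0..t}"
    by (intro integrable_integral integrable_continuous_real continuous_on_subset[OF assms(2)]) auto
  from has_integral_stretch_real[OF this, of t] False assms(1)
  have "((\<lambda>x. f (t * x)) has_integral (1 / t) *\<^sub>R integral {0..t} f) {0..1}"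
    by (simp add: image_divide_atLeastAtMost abs_if divide_inverse_commute del: has_integral_stretch_real)
  then show ?thesis using False by (simp add: integral_unique)
qed auto

text \<open>The substitution \<open>s = t * r\<close> moves the variable limit into the integrand,
  where continuity of a parameter integral over the fixed interval \<open>{0..1}\<close>
  applies.\<close>

lemma continuous_on_time_integral:
  fixes f :: "real \<Rightarrow> real \<Rightarrow> 'a::banach"
  assumes "continuous_family f"
  shows "continuous_family (\<lambda>t u. integral {0..t} (\<lambda>s. f s u))"
proof -
  have "continuous_on ({0..} \<times> UNIV) (\<lambda>x. fst x *\<^sub>R integral (cbox 0 1) (\<lambda>r. f (fst x * r) (snd x)))"
  proof (intro continuous_intros integral_continuous_on_param)
    show "continuous_on (({0..} \<times> UNIV) \<times> cbox (0::real) 1) (\<lambda>(x, r). f (fst x * r) (snd x))"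
      unfolding case_prod_unfold
      by (intro continuous_on_halfplane_compose[OF assms] continuous_intros) auto
  qed
  then show ?thesis
  proof (rule continuous_on_eq)
    fix x :: "real \<times> real" assume x: "x \<in> {0..} \<times> UNIV"
    have "continuous_on {0..} (\<lambda>s. f s (snd x))"
      by (intro continuous_on_halfplane_compose[OF assms] continuous_intros) auto
    from integral_scaled[OF _ this, of "fst x"] x
    show "fst x *\<^sub>R integral (cbox 0 1) (\<lambda>r. f (fst x * r) (snd x)) = (\<lambda>(t, u). integral {0..t} (\<lambda>s. f s u)) x"
      by (auto simp: case_prod_unfold)
  qed
qed

lemma continuous_on_slice1:
  fixes f :: "real \<Rightarrow> real \<Rightarrow> 'a::topological_space"
  assumes "continuous_family f"
  shows "continuous_on {0..} (\<lambda>s. f s u)"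
  by (intro continuous_on_halfplane_compose[OF assms] continuous_intros) auto

lemma has_vector_derivative_time_integral:
  fixes f :: "real \<Rightarrow> 'a::banach"
  assumes "continuous_on {0..} f" "t \<ge> 0"
  shows "((\<lambda>t. integral {0..t} f) has_vector_derivative f t) (at t within {0..})"
proof -
  have "((\<lambda>t. integral {0..t} f) has_vector_derivative f t) (at t within {0..t+1})"
    by (rule integral_has_vector_derivative[OF continuous_on_subset[OF assms(1)]]) (use assms in auto)
  moreover have "at t within {0..t+1} = at t within {0..}"
    by (rule at_within_nhd[of _ "{..<t+1}"]) auto
  ultimately show ?thesis by simp
qed

lemma has_partials_time_integral:
  fixes f :: "real \<Rightarrow> real \<Rightarrow> 'a::banach"
  assumes f: "has_partials f ft fx" and fx: "continuous_family fx"
  shows "has_partials (\<lambda>t u. integral {0..t} (\<lambda>s. f s u)) f (\<lambda>t u. integral {0..t} (\<lambda>s. fx s u))"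
  unfolding has_partials_def
proof (intro conjI allI impI)
  note c = has_partialsD(1)[OF f]
  show "continuous_family (\<lambda>t u. integral {0..t} (\<lambda>s. f s u))"
    by (rule continuous_on_time_integral[OF c])
  fix t u :: real assume t: "0 \<le> t"
  show "((\<lambda>t. integral {0..t} (\<lambda>s. f s u)) has_vector_derivative f t u) (at t within {0..})"
    by (rule has_vector_derivative_time_integral[OF continuous_on_slice1[OF c] t])
  have "((\<lambda>u. integral (cbox 0 t) (\<lambda>s. f s u)) has_vector_derivative integral (cbox 0 t) (\<lambda>s. fx s u)) (at u within UNIV)"
  proof (rule leibniz_rule_vector_derivative)
    show "((\<lambda>u. f s u) has_vector_derivative fx s u) (at u within UNIV)" if "s \<in> cbox 0 t" for u s
      using has_partialsD(3)[OF f, of s u] that by auto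
    show "(\<lambda>s. f s u) integrable_on cbox 0 t" for u
      using continuous_on_subset[OF continuous_on_slice1[OF c], of "cbox 0 t"]
      by (intro integrable_continuous) auto
    show "continuous_on (UNIV \<times> cbox 0 t) (\<lambda>(u, s). fx s u)"
      unfolding case_prod_unfold
      by (intro continuous_on_halfplane_compose[OF fx] continuous_intros) auto
  qed auto
  then show "((\<lambda>u. integral {0..t} (\<lambda>s. f s u)) has_vector_derivative integral {0..t} (\<lambda>s. fx s u)) (at u)"
    by simp
qed

lemma C_upto_time_integral:
  fixes f :: "real \<Rightarrow> real \<Rightarrow> 'a::banach"
  assumes "C_upto k f"
  shows "C_upto k (\<lambda>t u. integral {0..t} (\<lambda>s. f s u))"
  using assms
proof (induction k arbitrary: f)
  case 0
  then show ?case using continuous_on_time_integral[of f] by (simp add: case_prod_unfold)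
next
  case (Suc k)
  then have "has_partials f (dt f) (dx f)" "C_upto k (dx f)" "C_upto k f"
    using C_upto_SucD[OF Suc.prems] by (auto simp: C_upto_Suc_dt_dx)
  then show ?case
    using has_partials_time_integral[of f "dt f" "dx f"] C_upto_continuous[of k "dx f"] Suc.IH[of "dx f"]
    unfolding C_upto_Suc_partials by blast
qed

lemma time_integral_dt:
  fixes f :: "real \<Rightarrow> real \<Rightarrow> 'a::banach"
  assumes "has_partials f ft fx" "t \<ge> 0"
  shows "integral {0..t} (\<lambda>s. ft s u) = f t u - f 0 u"
proof (rule integral_unique, rule fundamental_theorem_of_calculus)
  fix s assume "s \<in> {0..t}"
  then show "((\<lambda>s. f s u) has_vector_derivative ft s u) (at s within {0..t})"
    using has_vector_derivative_within_subset[OF has_partialsD(2)[OF assms(1), of s u], of "{0..t}"] by auto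
qed (rule assms)

text \<open>Write \<open>f t\<close> as \<open>f 0\<close> plus the time integral of
  \<open>dt f\<close>, differentiate in space under the integral, and then differentiate in time by
  the fundamental theorem. This also covers the one-sided derivative at
  \<open>t = 0\<close>.\<close>

lemma dt_dx_commute:
  fixes f :: "real \<Rightarrow> real \<Rightarrow> 'a::banach"
  assumes "C_inf f" "t \<ge> 0"
  shows "dt (dx f) t u = dx (dt f) t u"
proof -
  note f = C_inf_dt_dx[OF assms(1)]
  note ft = C_inf_dt_dx[OF f(2)]
  note c = C_upto_continuous[OF C_infD[OF ft(3)]]
  have dxf: "dx f t u = integral {0..t} (\<lambda>s. dx (dt f) s u) + dx f 0 u" if "t \<ge> 0" for t
  proof -
    have "((\<lambda>u. integral {0..t} (\<lambda>s. dt f s u) + f 0 u) has_vector_derivative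
        integral {0..t} (\<lambda>s. dx (dt f) s u) + dx f 0 u) (at u)"
      by (intro has_vector_derivative_add has_partialsD(3)[OF f(1)] that order_refl
          has_partialsD(3)[OF has_partials_time_integral[OF ft(1) c]])
    moreover have "(\<lambda>u. integral {0..t} (\<lambda>s. dt f s u) + f 0 u) = f t"
      using time_integral_dt[OF f(1) that] by auto
    ultimately show ?thesis using has_partialsD(3)[OF f(1) that, of u] vector_derivative_unique_at by metis
  qed
  have "((\<lambda>t. integral {0..t} (\<lambda>s. dx (dt f) s u)) has_vector_derivative dx (dt f) t u) (at t within {0..})"
    by (rule has_vector_derivative_time_integral[where f = "\<lambda>s. dx (dt f) s u", OF continuous_on_slice1[OF c] assms(2)])
  then have "((\<lambda>t. integral {0..t} (\<lambda>s. dx (dt f) s u) + dx f 0 u) has_vector_derivative dx (dt f) t u) (at t within {0..})"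
    by (rule has_vector_derivative_add_const[THEN iffD2])
  then have "((\<lambda>t. dx f t u) has_vector_derivative dx (dt f) t u) (at t within {0..})"
    by (rule has_vector_derivative_transform[rotated 2]) (use assms(2) in simp, rule dxf, simp)
  then show ?thesis
    unfolding dt_def using assms(2) by (intro vector_derivative_within at_within_atLeast_neq_bot)
qed

section \<open>Fourier series of smooth periodic functions\<close>

lemma periodic_int:
  assumes "periodic f"
  shows "f (x + 2 * pi * of_int k) = f x"
proof -
  have nat: "f (x + 2 * pi * of_nat n) = f x" for n x
  proof (induction n)
    case (Suc n)
    have "f (x + 2 * pi * of_nat (Suc n)) = f ((x + 2 * pi * of_nat n) + 2 * pi)"
      by (simp add: algebra_simps)
    then show ?case using assms Suc by (simp add: periodic_def)
  qed simp
  show ?thesis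
  proof (cases "k \<ge> 0")
    case True
    then show ?thesis using nat[of x "nat k"] by simp
  next
    case False
    then show ?thesis using nat[of "x + 2 * pi * of_int k" "nat (- k)"] by simp
  qed
qed

lemma has_vector_derivative_at_shift_iff:
  fixes f :: "real \<Rightarrow> 'a::real_normed_vector"
  shows "((\<lambda>x. f (x + a)) has_vector_derivative d) (at x) \<longleftrightarrow> (f has_vector_derivative d) (at (x + a))"
proof -
  have *: "((\<lambda>x. g (x + b)) has_vector_derivative d) (at y)"
    if "(g has_vector_derivative d) (at (y + b))" for g :: "real \<Rightarrow> 'a" and b y
  proof -
    have "((\<lambda>x. x + b) has_vector_derivative 1) (at y)"
      unfolding has_vector_derivative_def by (auto intro!: derivative_eq_intros)
    from vector_diff_chain_at[OF this that] show ?thesis by (simp add: o_def)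
  qed
  show ?thesis
    using *[of f x a] *[of "\<lambda>x. f (x + a)" "x + a" "- a"] by auto
qed

lemma has_vector_derivative_imp_quotient:
  fixes f :: "real \<Rightarrow> 'a::real_normed_vector"
  assumes "(f has_vector_derivative d) (at x)"
  shows "((\<lambda>y. (f y - f x) /\<^sub>R (y - x)) \<longlongrightarrow> d) (at x)"
proof -
  have "((\<lambda>y. norm (f y - f x - (y - x) *\<^sub>R d) / norm (y - x)) \<longlongrightarrow> 0) (at x)"
    using assms by (simp add: has_vector_derivative_def has_derivative_iff_norm)
  moreover have "eventually (\<lambda>y. norm (f y - f x - (y - x) *\<^sub>R d) / norm (y - x)
      = norm ((f y - f x) /\<^sub>R (y - x) - d)) (at x)"
  proof (rule eventually_at_topological[THEN iffD2], intro exI[of _ UNIV] conjI ballI impI)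
    fix y assume "y \<noteq> x"
    then have "(f y - f x) /\<^sub>R (y - x) - d = (f y - f x - (y - x) *\<^sub>R d) /\<^sub>R (y - x)"
      by (simp add: scaleR_diff_right)
    then show "norm (f y - f x - (y - x) *\<^sub>R d) / norm (y - x) = norm ((f y - f x) /\<^sub>R (y - x) - d)"
      by (simp add: divide_inverse_commute)
  qed auto
  ultimately have "((\<lambda>y. norm ((f y - f x) /\<^sub>R (y - x) - d)) \<longlongrightarrow> 0) (at x)"
    by (rule Lim_transform_eventually)
  then show ?thesis by (simp add: Lim_null[of _ d] tendsto_norm_zero_iff)
qed

lemma periodic_vderiv:
  assumes "periodic f" "\<And>x. (f has_vector_derivative g x) (at x)"
  shows "periodic g"
  unfolding periodic_def
proof
  fix x
  have "((\<lambda>x. f (x + 2 * pi)) has_vector_derivative g (x + 2 * pi)) (at x)"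
    by (simp add: has_vector_derivative_at_shift_iff assms(2))
  moreover have "(\<lambda>x. f (x + 2 * pi)) = f" using assms(1) by (auto simp: periodic_def)
  ultimately show "g (x + 2 * pi) = g x" using assms(2) vector_derivative_unique_at by metis
qed

text \<open>A primitive of a periodic function grows by the same amount over every interval of length
  \<open>2\<pi>\<close>.\<close>

lemma integral_periodic_reparam:
  fixes h :: "real \<Rightarrow> 'a::banach"
  assumes h: "continuous_on UNIV h" "periodic h"
    and s: "\<And>\<theta>. \<theta> \<in> {0..2*pi} \<Longrightarrow> (\<sigma> has_vector_derivative \<sigma>' \<theta>) (at \<theta> within {0..2*pi})"
    and s2: "\<sigma> (2 * pi) = \<sigma> 0 + 2 * pi"
  shows "((\<lambda>\<theta>. \<sigma>' \<theta> *\<^sub>R h (\<sigma> \<theta>)) has_integral integral {0..2*pi} h) {0..2*pi}"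
proof -
  have "continuous_on {0..2*pi} \<sigma>"
    unfolding continuous_on_eq_continuous_within using s by (blast intro: has_vector_derivative_continuous)
  then have "bounded (\<sigma> ` {0..2*pi})"
    by (intro compact_imp_bounded compact_continuous_image) auto
  then obtain M where M: "\<And>\<theta>. \<theta> \<in> {0..2*pi} \<Longrightarrow> \<bar>\<sigma> \<theta>\<bar> \<le> M"
    unfolding bounded_real by blast
  have M0: "0 \<le> M" using M[of 0] by auto
  \<comment> \<open>Large enough for the range of \<open>\<sigma>\<close>, for
    \<open>{0..2*pi}\<close>, and for the translates by \<open>2 * pi\<close> of points of
    \<open>{- M..M}\<close>, so that one primitive \<open>G\<close> serves all comparisons.\<close>
  define A where "A = {- M .. M + 2 * pi}"
  obtain G where G: "\<And>x. x \<in> A \<Longrightarrow> (G has_vector_derivative h x) (at x within A)"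
    using antiderivative_continuous[of "- M" "M + 2 * pi" h] continuous_on_subset[OF h(1)]
    unfolding A_def by blast
  have sub: "{- M..M} \<subseteq> A" "{0..2*pi} \<subseteq> A"
    using M0 by (auto simp: A_def)
  have sub3: "\<sigma> ` {0..2*pi} \<subseteq> A"
  proof
    fix y assume "y \<in> \<sigma> ` {0..2*pi}"
    then obtain \<theta> where "\<theta> \<in> {0..2*pi}" "y = \<sigma> \<theta>" by blast
    with M[of \<theta>] show "y \<in> A" unfolding A_def using pi_ge_zero by (simp add: abs_le_iff)
  qed
  have I1: "((\<lambda>\<theta>. \<sigma>' \<theta> *\<^sub>R h (\<sigma> \<theta>)) has_integral G (\<sigma> (2*pi)) - G (\<sigma> 0)) {0..2*pi}"
  proof (rule fundamental_theorem_of_calculus)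
    fix \<theta> assume t: "\<theta> \<in> {0..2*pi}"
    have "(G has_vector_derivative h (\<sigma> \<theta>)) (at (\<sigma> \<theta>) within \<sigma> ` {0..2*pi})"
      using has_vector_derivative_within_subset[OF G sub3] sub3 t by blast
    from vector_diff_chain_within[OF s[OF t] this]
    show "((\<lambda>\<theta>. G (\<sigma> \<theta>)) has_vector_derivative \<sigma>' \<theta> *\<^sub>R h (\<sigma> \<theta>)) (at \<theta> within {0..2*pi})"
      by (simp add: o_def)
  qed simp
  have I2: "(h has_integral G (2 * pi) - G 0) {0..2*pi}"
    by (rule fundamental_theorem_of_calculus)
      (use has_vector_derivative_within_subset[OF G sub(2)] sub(2) in auto)
  have "\<exists>c. \<forall>x\<in>{- M..M}. G (x + 2 * pi) - G x = c"
  proof (rule has_vector_derivative_zero_constant)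
    fix x assume x: "x \<in> {- M..M}"
    have "((\<lambda>x. G (x + 2 * pi)) has_vector_derivative 1 *\<^sub>R h (x + 2 * pi)) (at x within {- M..M})"
    proof -
      have "y + 2 * pi \<in> A" if "y \<in> {- M..M}" for y
        using that pi_ge_zero unfolding A_def atLeastAtMost_iff by linarith
      then have "x + 2 * pi \<in> A" "(\<lambda>x. x + 2 * pi) ` {- M..M} \<subseteq> A"
        using x by blast+
      from has_vector_derivative_within_subset[OF G[OF this(1)] this(2)]
      have "(G has_vector_derivative h (x + 2 * pi)) (at (x + 2 * pi) within (\<lambda>x. x + 2 * pi) ` {- M..M})" .
      moreover have "((\<lambda>x. x + 2 * pi) has_vector_derivative 1) (at x within {- M..M})"
        unfolding has_vector_derivative_def by (auto intro!: derivative_eq_intros)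
      ultimately show ?thesis
        using vector_diff_chain_within[of "\<lambda>x. x + 2 * pi" 1 x "{- M..M}" G] by (simp add: o_def)
    qed
    moreover have "(G has_vector_derivative h x) (at x within {- M..M})"
      using has_vector_derivative_within_subset[OF G sub(1)] x sub(1) by blast
    ultimately have "((\<lambda>x. G (x + 2 * pi) - G x) has_vector_derivative 1 *\<^sub>R h (x + 2 * pi) - h x) (at x within {- M..M})"
      by (rule has_vector_derivative_diff)
    then show "((\<lambda>x. G (x + 2 * pi) - G x) has_vector_derivative 0) (at x within {- M..M})"
      using h(2) by (simp add: periodic_def)
  qed auto
  then obtain c where c: "\<And>x. x \<in> {- M..M} \<Longrightarrow> G (x + 2 * pi) - G x = c" by blast
  have "G (\<sigma> (2 * pi)) - G (\<sigma> 0) = c" using c[of "\<sigma> 0"] M[of 0] s2 by (auto simp: abs_le_iff)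
  moreover have "G (2 * pi) - G 0 = c" using c[of 0] M0 by auto
  ultimately show ?thesis using I1 I2 by (metis integral_unique)
qed

lemma integral_periodic_shift:
  fixes h :: "real \<Rightarrow> 'a::banach"
  assumes "continuous_on UNIV h" "periodic h"
  shows "integral {0..2*pi} (\<lambda>x. h (x + a)) = integral {0..2*pi} h"
proof -
  have "((\<lambda>\<theta>. \<theta> + a) has_vector_derivative 1) (at \<theta> within {0..2*pi})" for \<theta>
    unfolding has_vector_derivative_def by (auto intro!: derivative_eq_intros)
  from integral_periodic_reparam[OF assms this] show ?thesis by (simp add: integral_unique)
qed

lemma integral_deriv_periodic:
  fixes f :: "real \<Rightarrow> 'a::banach"
  assumes "\<And>x. (f has_vector_derivative f' x) (at x)" "periodic f"
  shows "(f' has_integral 0) {0..2*pi}"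
proof -
  have "(f' has_integral f (2*pi) - f 0) {0..2*pi}"
    by (rule fundamental_theorem_of_calculus) (auto intro: has_vector_derivative_at_within assms(1))
  moreover have "f (2 * pi) = f 0" using assms(2) unfolding periodic_def by (metis add_0)
  ultimately show ?thesis by simp
qed

definition fourier_coeff :: "(real \<Rightarrow> complex) \<Rightarrow> int \<Rightarrow> complex" where
  "fourier_coeff f n = integral {0..2*pi} (\<lambda>x. f x * cis (- (of_int n * x))) / (2 * pi)"

lemma periodic_cis_int: "periodic (\<lambda>x. cis (of_int n * x))"
proof -
  have "cis (of_int n * (x + 2 * pi)) = cis (of_int n * x) * cis (2 * pi * of_int n)" for x
    by (simp add: cis_mult algebra_simps)
  then show ?thesis by (simp add: periodic_def cis_multiple_2pi)
qed

lemma cis_has_vector_derivative: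
  "((\<lambda>x. cis (a * x)) has_vector_derivative \<i> * of_real a * cis (a * x)) (at x within S)"
  unfolding has_vector_derivative_def
  by (auto intro!: derivative_eq_intros simp: scaleR_conv_of_real mult_ac)

lemma fourier_coeff_norm_le:
  assumes "continuous_on {0..2*pi} f" "\<And>x. x \<in> {0..2*pi} \<Longrightarrow> norm (f x) \<le> B"
  shows "norm (fourier_coeff f n) \<le> B"
proof -
  have "norm (integral {0..2*pi} (\<lambda>x. f x * cis (- (of_int n * x)))) \<le> B * (2 * pi - 0)"
    by (rule integral_bound) (use assms in \<open>auto intro!: continuous_intros simp: norm_mult\<close>)
  then show ?thesis by (simp add: fourier_coeff_def norm_divide field_simps)
qed

lemma fourier_coeff_deriv:
  assumes "\<And>x. (f has_vector_derivative f' x) (at x)" "continuous_on UNIV f'" "periodic f"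
  shows "fourier_coeff f' n = \<i> * of_int n * fourier_coeff f n"
proof -
  have cf: "continuous_on UNIV f"
    using assms(1) by (meson continuous_at_imp_continuous_on has_vector_derivative_continuous)
  let ?e = "\<lambda>x. cis (- (of_int n * x))"
  have p: "periodic (\<lambda>x. f x * ?e x)"
    using assms(3) periodic_cis_int[of "- n"] by (simp add: periodic_def)
  have "((\<lambda>x. f x * ?e x) has_vector_derivative f x * (\<i> * of_real (- of_int n) * ?e x) + f' x * ?e x) (at x)" for x
    using has_vector_derivative_mult[OF assms(1) cis_has_vector_derivative[of "- of_int n"]] by simp
  from integral_deriv_periodic[OF this p]
  have 1: "((\<lambda>x. f x * (\<i> * of_real (- of_int n) * ?e x) + f' x * ?e x) has_integral 0) {0..2*pi}" .
  have 2: "((\<lambda>x. (\<i> * of_int n) * (f x * ?e x)) has_integral (\<i> * of_int n) * integral {0..2*pi} (\<lambda>x. f x * ?e x)) {0..2*pi}"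
    by (intro has_integral_mult_right integrable_integral integrable_continuous_real)
      (auto intro!: continuous_intros continuous_on_subset[OF cf])
  have "integral {0..2*pi} (\<lambda>x. f' x * ?e x) = 0 + \<i> * of_int n * integral {0..2*pi} (\<lambda>x. f x * ?e x)"
    using has_integral_add[OF 1 2] by (intro integral_unique) (simp add: algebra_simps)
  then show ?thesis by (simp add: fourier_coeff_def)
qed

text \<open>Translation by \<open>\<pi>/n\<close> changes the sign of \<open>e\<^sup>-\<^sup>i\<^sup>n\<^sup>x\<close>.\<close>

lemma riemann_lebesgue:
  assumes g: "continuous_on UNIV g" "periodic g" and "e > 0"
  shows "\<exists>N. \<forall>n. \<bar>n\<bar> \<ge> N \<longrightarrow> norm (fourier_coeff g n) < e"
proof -
  have "uniformly_continuous_on {- (2*pi)..4*pi} g"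
    by (intro compact_uniformly_continuous continuous_on_subset[OF g(1)]) auto
  then obtain d where d: "d > 0" and
    ucd: "\<And>x y. x \<in> {- (2*pi)..4*pi} \<Longrightarrow> y \<in> {- (2*pi)..4*pi} \<Longrightarrow> dist y x < d \<Longrightarrow> dist (g y) (g x) < e"
    using \<open>e > 0\<close> unfolding uniformly_continuous_on_def by metis
  \<comment> \<open>This choice forces \<open>n \<noteq> 0\<close> and makes the translation by
    \<open>pi / n\<close> shorter than the modulus of continuity \<open>d\<close>.\<close>
  define N where "N = max 1 (\<lceil>pi / d\<rceil> + 1)"
  have "norm (fourier_coeff g n) < e" if n: "\<bar>n\<bar> \<ge> N" for n
  proof -
    have n0: "n \<noteq> 0" "\<bar>of_int n\<bar> \<ge> (1::real)" using n by (auto simp: N_def)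
    have "pi / d < \<bar>of_int n\<bar>" using n unfolding N_def by linarith
    then have small: "\<bar>pi / of_int n\<bar> < d" using d n0 by (simp add: field_simps abs_div_pos)
    have pin: "\<bar>pi / of_int n\<bar> \<le> pi" using n0 by (simp add: field_simps)
    let ?e = "\<lambda>x. cis (- (of_int n * x))"
    have p: "periodic (\<lambda>x. g x * ?e x)"
      using g(2) periodic_cis_int[of "- n"] by (simp add: periodic_def)
    have "- (of_int n * (x + pi / of_int n)) = - (of_int n * x) + (- pi)" for x
      using n0 by (simp add: algebra_simps)
    then have sh: "?e (x + pi / of_int n) = - ?e x" for x
      by (simp only: cis_mult[symmetric]) (simp add: complex_eq_iff)
    have "integral {0..2*pi} (\<lambda>x. g x * ?e x) = - integral {0..2*pi} (\<lambda>x. g (x + pi / of_int n) * ?e x)"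
      using integral_periodic_shift[OF _ p, of "pi / of_int n"] continuous_on_mult[OF g(1), of ?e]
      unfolding sh by (simp add: continuous_intros)
    \<comment> \<open>Consequently twice the coefficient of \<open>g\<close> is the coefficient of
      \<open>g\<close> minus its translate, which is at most \<open>e\<close> in norm by uniform
      continuity.\<close>
    then have "fourier_coeff g n = - fourier_coeff (\<lambda>x. g (x + pi / of_int n)) n"
      unfolding fourier_coeff_def by (simp only: minus_divide_left)
    moreover have "fourier_coeff (\<lambda>x. g x - g (x + pi / of_int n)) n
        = fourier_coeff g n - fourier_coeff (\<lambda>x. g (x + pi / of_int n)) n"
      unfolding fourier_coeff_def diff_divide_distrib[symmetric] left_diff_distrib
      by (subst integral_diff)
        (auto intro!: integrable_continuous_real continuous_intros continuous_on_compose2[OF g(1)])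
    moreover have "norm (fourier_coeff (\<lambda>x. g x - g (x + pi / of_int n)) n) \<le> e"
    proof (rule fourier_coeff_norm_le)
      fix x :: real assume "x \<in> {0..2*pi}"
      have "dist (g x) (g (x + pi / of_int n)) < e"
      proof (intro ucd)
        show "x + pi / of_int n \<in> {- (2 * pi)..4 * pi}" "x \<in> {- (2 * pi)..4 * pi}"
          using pin \<open>x \<in> {0..2*pi}\<close> unfolding abs_le_iff atLeastAtMost_iff by linarith+
      qed (use small in \<open>simp add: dist_real_def\<close>)
      then show "norm (g x - g (x + pi / of_int n)) \<le> e" by (simp add: dist_norm)
    qed (auto intro!: continuous_intros continuous_on_compose2[OF g(1)])
    ultimately have "norm (2 * fourier_coeff g n) \<le> e" by simp
    then have "2 * norm (fourier_coeff g n) \<le> e" by (simp add: norm_mult)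
    then show ?thesis using \<open>e > 0\<close> by linarith
  qed
  then show ?thesis by blast
qed

text \<open>If \<open>f\<close> vanishes at \<open>0\<close>, then \<open>f x = (e\<^sup>i\<^sup>x - 1) g x\<close> with \<open>g\<close> continuous, so the sum of the Fourier
  coefficients of \<open>f\<close> telescopes.\<close>

lemma sum_fourier_coeff_tendsto_0:
  assumes f: "continuous_on UNIV f" "periodic f" "f 0 = 0" "(f has_vector_derivative d) (at 0)"
  shows "(\<lambda>N. \<Sum>n = - int N..int N. fourier_coeff f n) \<longlonglongrightarrow> 0"
proof -
  \<comment> \<open>At the zeros of \<open>cis x - 1\<close> the quotient extends continuously by
    \<open>d / \<i>\<close>, the ratio of the derivatives of \<open>f\<close> and \<open>cis\<close>
    at 0. This is the only place where differentiability of \<open>f\<close> is used.\<close>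
  define g where "g x = (if cis x = 1 then d / \<i> else f x / (cis x - 1))" for x
  have cis_per: "cis (x + 2 * pi) = cis x" for x by (simp flip: cis_mult)
  have pg: "periodic g" unfolding periodic_def g_def using f(2) cis_per by (simp add: periodic_def)
  have isCf: "isCont f x" for x using f(1) by (simp add: continuous_on_eq_continuous_at)
  have g0: "isCont g 0"
  proof -
    have 1: "((\<lambda>x. f x /\<^sub>R x) \<longlongrightarrow> d) (at 0)"
      using has_vector_derivative_imp_quotient[OF f(4)] f(3) by simp
    have 2: "((\<lambda>x. (cis x - 1) /\<^sub>R x) \<longlongrightarrow> \<i>) (at 0)"
      using has_vector_derivative_imp_quotient[OF cis_has_vector_derivative[of 1 0 UNIV]] by simp
    have "((\<lambda>x. (f x /\<^sub>R x) / ((cis x - 1) /\<^sub>R x)) \<longlongrightarrow> d / \<i>) (at 0)"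
      by (intro tendsto_divide 1 2) simp
    moreover have "eventually (\<lambda>x. (f x /\<^sub>R x) / ((cis x - 1) /\<^sub>R x) = g x) (at 0)"
      using tendsto_imp_eventually_ne[OF 2, of 0]
      by (auto elim!: eventually_mono simp: g_def scaleR_conv_of_real field_simps)
    moreover have "g 0 = d / \<i>" by (simp add: g_def)
    ultimately show ?thesis unfolding isCont_def using Lim_transform_eventually[of _ "d / \<i>" "at 0" g] by simp
  qed
  have "isCont g x" for x
  proof (cases "cis x = 1")
    case True
    then have "cos x = 1" by (simp add: complex_eq_iff)
    then obtain k :: int where k: "x = of_int k * (2 * pi)" using cos_one_2pi_int[of x] by auto
    have "isCont (\<lambda>y. g (y - x)) x"
      using g0 by (intro isCont_o2[where g = g and f = "\<lambda>y. y - x"]) auto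
    moreover have "g (y - x) = g y" for y using periodic_int[OF pg, of "y - x" k] k by (simp add: mult_ac)
    ultimately show ?thesis by simp
  next
    case False
    have "open {y. cis y \<noteq> 1}"
      by (intro open_Collect_neq continuous_intros)
    then have "eventually (\<lambda>y. f y / (cis y - 1) = g y) (nhds x)"
      unfolding eventually_nhds using False
      by (intro exI[of _ "{y. cis y \<noteq> 1}"]) (auto simp: g_def)
    from isCont_cong[OF this] show ?thesis
      using False isCf continuous_on_eq_continuous_at[of UNIV cis] continuous_on_cis[OF continuous_on_id]
      by (auto intro!: continuous_divide continuous_diff)
  qed
  then have cg: "continuous_on UNIV g" by (simp add: continuous_at_imp_continuous_on)
  have fg: "f x = (cis x - 1) * g x" for x
  proof (cases "cis x = 1")
    case True
    then have "cos x = 1" by (simp add: complex_eq_iff)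
    then obtain k :: int where k: "x = of_int k * (2 * pi)" using cos_one_2pi_int[of x] by auto
    then have "f x = 0" using periodic_int[OF f(2), of 0 k] f(3) by (simp add: mult_ac)
    then show ?thesis using True by simp
  qed (simp add: g_def)
  \<comment> \<open>Multiplication by \<open>cis x\<close> shifts the Fourier index by one.\<close>
  have tel: "fourier_coeff f n = fourier_coeff g (n - 1) - fourier_coeff g n" for n
  proof -
    have "f x * cis (- (of_int n * x)) = g x * cis (- (of_int (n - 1) * x)) - g x * cis (- (of_int n * x))" for x
      by (simp add: fg algebra_simps cis_mult)
    then show ?thesis
      unfolding fourier_coeff_def diff_divide_distrib[symmetric]
      by (simp only:) (subst integral_diff,
         auto intro!: integrable_continuous_real continuous_intros continuous_on_subset[OF cg])
  qed
  have sum: "(\<Sum>n = - int N..int N. fourier_coeff f n) = fourier_coeff g (- int N - 1) - fourier_coeff g (int N)" for N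
  proof (induction N)
    case 0
    then show ?case by (simp add: tel)
  next
    case (Suc N)
    have "{- int (Suc N)..int (Suc N)} = insert (- int N - 1) (insert (int N + 1) {- int N..int N})"
      by auto
    then show ?case by (simp add: Suc.IH tel[of "- int N - 1"] tel[of "int N + 1"])
        (simp only: add.commute)
  qed
  show ?thesis
    unfolding sum
  proof (rule LIMSEQ_I)
    fix e :: real assume "0 < e"
    then obtain N where N: "\<And>n. \<bar>n\<bar> \<ge> N \<Longrightarrow> norm (fourier_coeff g n) < e / 2"
      using riemann_lebesgue[OF cg pg, of "e / 2"] by auto
    have "norm (fourier_coeff g (- int n - 1) - fourier_coeff g (int n) - 0) < e" if "n \<ge> nat N" for n
      using norm_triangle_ineq4[of "fourier_coeff g (- int n - 1)" "fourier_coeff g (int n)"]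
        N[of "- int n - 1"] N[of "int n"] that by (smt (verit) nat_le_iff diff_zero field_sum_of_halves)
    then show "\<exists>no. \<forall>n\<ge>no. norm (fourier_coeff g (- int n - 1) - fourier_coeff g (int n) - 0) < e" by blast
  qed
qed

lemma integral_cis_int: "integral {0..2*pi} (\<lambda>x. cis (of_int n * x)) = (if n = 0 then 2 * pi else 0)"
proof (cases "n = 0")
  case False
  have "((\<lambda>x. \<i> * of_real (of_int n) * cis (of_int n * x)) has_integral 0) {0..2*pi}"
    by (rule integral_deriv_periodic[OF cis_has_vector_derivative periodic_cis_int])
  from has_integral_mult_right[OF this, of "1 / (\<i> * of_real (of_int n))"] False
  show ?thesis by (auto intro!: integral_unique)
qed (simp add: scaleR_conv_of_real)

text \<open>Reduction to a function vanishing at 0: translating by \<open>\<theta>\<close>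
  multiplies the coefficients by \<open>cis (of_int n * \<theta>)\<close>, and subtracting the value
  at \<open>\<theta>\<close> changes only the mode \<open>n = 0\<close>.\<close>

lemma fourier_inversion:
  assumes f: "continuous_on UNIV f" "periodic f" "(f has_vector_derivative d) (at \<theta>)"
  shows "(\<lambda>N. \<Sum>n = - int N..int N. fourier_coeff f n * cis (of_int n * \<theta>)) \<longlonglongrightarrow> f \<theta>"
proof -
  define F where "F x = f (x + \<theta>) - f \<theta>" for x
  have "((\<lambda>x. f (x + \<theta>)) has_vector_derivative d) (at 0)"
    using f(3) by (simp add: has_vector_derivative_at_shift_iff)
  then have F: "continuous_on UNIV F" "periodic F" "F 0 = 0" "(F has_vector_derivative d) (at 0)"
    using f(2) unfolding F_def
    by (auto simp: periodic_def algebra_simps has_vector_derivative_diff_const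
        intro!: continuous_intros continuous_on_compose2[OF f(1)]) (metis add.commute add.left_commute)
  have coeff: "fourier_coeff F n = fourier_coeff f n * cis (of_int n * \<theta>) - (if n = 0 then f \<theta> else 0)" for n
  proof -
    let ?e = "\<lambda>x. cis (- (of_int n * x))"
    have p: "periodic (\<lambda>x. f x * ?e x)"
      using f(2) periodic_cis_int[of "- n"] by (simp add: periodic_def)
    have "F x * ?e x = cis (of_int n * \<theta>) * (f (x + \<theta>) * ?e (x + \<theta>)) - f \<theta> * ?e x" for x
    proof -
      have "?e (x + \<theta>) * cis (of_int n * \<theta>) = ?e x" by (simp add: cis_mult algebra_simps)
      then show ?thesis by (simp add: F_def algebra_simps)
    qed
    then have "integral {0..2*pi} (\<lambda>x. F x * ?e x) =
        integral {0..2*pi} (\<lambda>x. cis (of_int n * \<theta>) * (f (x + \<theta>) * ?e (x + \<theta>)) - f \<theta> * ?e x)"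
      by simp
    also have "\<dots> = cis (of_int n * \<theta>) * integral {0..2*pi} (\<lambda>x. f (x + \<theta>) * ?e (x + \<theta>))
        - f \<theta> * integral {0..2*pi} ?e"
      by (subst integral_diff)
        (auto intro!: integrable_continuous_real continuous_intros continuous_on_compose2[OF f(1)])
    also have "integral {0..2*pi} (\<lambda>x. f (x + \<theta>) * ?e (x + \<theta>)) = integral {0..2*pi} (\<lambda>x. f x * ?e x)"
      by (rule integral_periodic_shift[OF _ p]) (intro continuous_intros f(1))
    finally show ?thesis
      using integral_cis_int[of "- n"] unfolding fourier_coeff_def by (auto simp: field_simps)
  qed
  have "(\<lambda>N. (\<Sum>n = - int N..int N. fourier_coeff F n) + f \<theta>) \<longlonglongrightarrow> 0 + f \<theta>"
    by (intro tendsto_add sum_fourier_coeff_tendsto_0[OF F] tendsto_const)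
  then show ?thesis by (simp add: coeff sum_subtractf)
qed


text \<open>The decay rates of the modes under \<open>p\<^sub>t = p'' + p - \<lambda>\<close>; the mean is preserved, as \<open>\<lambda>\<close> is the mean of \<open>p\<close>.\<close>

definition rate :: "nat \<Rightarrow> real" where
  "rate n = (if n = 0 then 0 else (real n)\<^sup>2 - 1)"

lemma rate_nonneg: "rate n \<ge> 0"
  by (simp add: rate_def)

lemma rate_le: "rate n \<le> (real n)\<^sup>2"
  by (simp add: rate_def)

lemma rate_ge: "n \<ge> 2 \<Longrightarrow> rate n \<ge> 3"
  using power_mono[of 2 "real n" 2] by (auto simp: rate_def)

text \<open>Decay faster than every power. The class is stable under polynomially bounded factors,
  hence under the factors \<open>- rate n\<close> and \<open>\<i> * of_nat n\<close> that the
  partial derivatives of a heat series produce.\<close>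

definition rapid :: "(nat \<Rightarrow> complex) \<Rightarrow> bool" where
  "rapid c \<longleftrightarrow> (\<forall>k. summable (\<lambda>n. norm (c n) * real n ^ k))"

lemma rapid_summable: "rapid c \<Longrightarrow> summable (\<lambda>n. norm (c n))"
  unfolding rapid_def by (drule spec[of _ 0]) simp

lemma rapid_mult:
  assumes "rapid c" "\<And>n. norm (a n) \<le> 1 + real n ^ j"
  shows "rapid (\<lambda>n. a n * c n)"
  unfolding rapid_def
proof
  fix k
  have "summable (\<lambda>n. norm (c n) * real n ^ k + norm (c n) * real n ^ (j + k))"
    using assms(1) by (intro summable_add) (auto simp: rapid_def)
  then show "summable (\<lambda>n. norm (a n * c n) * real n ^ k)"
  proof (rule summable_comparison_test')
    fix n
    have "norm (a n) * (norm (c n) * real n ^ k) \<le> (1 + real n ^ j) * (norm (c n) * real n ^ k)"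
      by (intro mult_right_mono assms) auto
    then show "norm (norm (a n * c n) * real n ^ k) \<le> norm (c n) * real n ^ k + norm (c n) * real n ^ (j + k)"
      by (simp add: norm_mult algebra_simps power_add)
  qed
qed

section \<open>Exponentially damped Fourier series\<close>

abbreviation heat_term :: "(nat \<Rightarrow> complex) \<Rightarrow> real \<Rightarrow> real \<Rightarrow> nat \<Rightarrow> complex" where
  "heat_term c t x n \<equiv> c n * of_real (exp (- rate n * t)) * cis (real n * x)"

text \<open>Only modes \<open>n \<ge> 0\<close> occur, since real functions are recovered as real
  parts. The coefficients \<open>c\<close> are those at \<open>t = 0\<close>; both partials are
  again series of this form, up to and including the initial time.\<close>

definition heat_series :: "(nat \<Rightarrow> complex) \<Rightarrow> real \<Rightarrow> real \<Rightarrow> complex" where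
  "heat_series c t x = (\<Sum>n. heat_term c t x n)"

abbreviation dt_coeff :: "(nat \<Rightarrow> complex) \<Rightarrow> nat \<Rightarrow> complex" where
  "dt_coeff c \<equiv> \<lambda>n. of_real (- rate n) * c n"

abbreviation dx_coeff :: "(nat \<Rightarrow> complex) \<Rightarrow> nat \<Rightarrow> complex" where
  "dx_coeff c \<equiv> \<lambda>n. \<i> * of_nat n * c n"

lemma heat_term_norm:
  assumes "t \<ge> 0"
  shows "norm (heat_term c t x n) \<le> norm (c n)"
  using assms rate_nonneg[of n] by (auto simp: norm_mult intro!: mult_left_le)

lemma heat_series_summable:
  assumes "rapid c" "t \<ge> 0"
  shows "summable (heat_term c t x)"
  using rapid_summable[OF assms(1)] heat_term_norm[OF assms(2)] by (rule summable_comparison_test')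

lemma heat_series_uniform_limit:
  assumes "rapid c"
  shows "uniform_limit ({0..} \<times> UNIV)
    (\<lambda>N x. \<Sum>n<N. heat_term c (fst x) (snd x) n)
    (\<lambda>x. heat_series c (fst x) (snd x)) sequentially"
  unfolding heat_series_def
  by (rule Weierstrass_m_test[OF _ rapid_summable[OF assms]]) (use heat_term_norm in auto)

lemma heat_series_continuous:
  assumes "rapid c"
  shows "continuous_family (\<lambda>t x. heat_series c t x)"
  unfolding case_prod_unfold
  by (rule uniform_limit_theorem[OF _ heat_series_uniform_limit[OF assms]])
    (auto intro!: continuous_intros always_eventually)

text \<open>Termwise differentiation on a convex set, with derivatives relative to that set, so that
  it serves both the time variable on \<open>{0..}\<close> and the space variable on the whole
  line.\<close>

lemma has_vector_derivative_suminf: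
  fixes f :: "nat \<Rightarrow> real \<Rightarrow> 'b::banach"
  assumes S: "convex S" and x: "x \<in> S"
    and f: "\<And>n x. x \<in> S \<Longrightarrow> (f n has_vector_derivative f' n x) (at x within S)"
    and M: "\<And>n x. x \<in> S \<Longrightarrow> norm (f' n x) \<le> M n" "summable M"
    and s: "\<And>x. x \<in> S \<Longrightarrow> summable (\<lambda>n. f n x)"
  shows "((\<lambda>x. \<Sum>n. f n x) has_vector_derivative (\<Sum>n. f' n x)) (at x within S)"
proof -
  have ul: "uniform_limit S (\<lambda>N x. \<Sum>n<N. f' n x) (\<lambda>x. \<Sum>n. f' n x) sequentially"
    by (rule Weierstrass_m_test[OF M])
  have "\<exists>g. \<forall>x\<in>S. (\<lambda>n. f n x) sums (g x) \<and> (g has_derivative (\<lambda>h. h *\<^sub>R (\<Sum>n. f' n x))) (at x within S)"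
  proof (rule has_derivative_series[where f = f and f' = "\<lambda>n x h. h *\<^sub>R f' n x" and x = x])
    show "(\<lambda>n. f n x) sums (\<Sum>n. f n x)" by (rule summable_sums[OF s[OF x]])
    show "(f n has_derivative (\<lambda>h. h *\<^sub>R f' n x)) (at x within S)" if "x \<in> S" for n x
      using f[OF that] by (simp add: has_vector_derivative_def)
    fix e :: real assume "0 < e"
    then have "\<forall>\<^sub>F N in sequentially. \<forall>x\<in>S. dist (\<Sum>n<N. f' n x) (\<Sum>n. f' n x) < e"
      using ul by (auto simp: uniform_limit_iff)
    then show "\<forall>\<^sub>F N in sequentially. \<forall>x\<in>S. \<forall>h. norm ((\<Sum>n<N. h *\<^sub>R f' n x) - h *\<^sub>R (\<Sum>n. f' n x)) \<le> e * norm h"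
    proof eventually_elim
      case (elim N)
      show ?case
      proof (intro ballI allI)
        fix x and h :: real assume "x \<in> S"
        have "norm ((\<Sum>n<N. h *\<^sub>R f' n x) - h *\<^sub>R (\<Sum>n. f' n x)) = \<bar>h\<bar> * norm ((\<Sum>n<N. f' n x) - (\<Sum>n. f' n x))"
          by (simp flip: scaleR_right.sum scaleR_diff_right)
        also have "\<dots> \<le> \<bar>h\<bar> * e"
          using elim \<open>x \<in> S\<close> by (intro mult_left_mono) (auto simp: dist_norm less_imp_le)
        finally show "norm ((\<Sum>n<N. h *\<^sub>R f' n x) - h *\<^sub>R (\<Sum>n. f' n x)) \<le> e * norm h"
          by (simp add: mult.commute)
      qed
    qed
  qed (use S x in auto)
  then obtain g where g: "\<And>x. x \<in> S \<Longrightarrow> (\<lambda>n. f n x) sums (g x)"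
      "(g has_vector_derivative (\<Sum>n. f' n x)) (at x within S)"
    using x by (auto simp: has_vector_derivative_def)
  show ?thesis
    by (rule has_vector_derivative_transform[OF x _ g(2)]) (use g(1) in \<open>simp add: sums_iff\<close>)
qed

lemma heat_series_has_partials:
  assumes "rapid c"
  shows "has_partials (heat_series c) (heat_series (dt_coeff c)) (heat_series (dx_coeff c))" (is ?partials)
    and "rapid (dt_coeff c)" and "rapid (dx_coeff c)"
proof -
  show 1: "rapid (dt_coeff c)"
    using rate_nonneg rate_le by (intro rapid_mult[OF assms, of _ 2]) (auto intro: add_increasing)
  show 2: "rapid (dx_coeff c)"
    by (intro rapid_mult[OF assms, of _ 1]) (auto simp: norm_mult)
  show ?partials
    unfolding has_partials_def
  proof (intro conjI allI impI)
    show "continuous_family (\<lambda>t x. heat_series c t x)"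
      by (rule heat_series_continuous[OF assms])
    fix t x :: real assume t: "0 \<le> t"
    show "((\<lambda>s. heat_series c s x) has_vector_derivative heat_series (dt_coeff c) t x)
        (at t within {0..})"
      unfolding heat_series_def
    proof (rule has_vector_derivative_suminf[where M = "\<lambda>n. norm (of_real (- rate n) * c n)"])
      show "((\<lambda>s. heat_term c s x n) has_vector_derivative
          heat_term (dt_coeff c) s x n) (at s within {0..})" for n s
        unfolding has_vector_derivative_def
        by (auto intro!: derivative_eq_intros simp: scaleR_conv_of_real)
      show "norm (heat_term (dt_coeff c) s x n)
          \<le> norm (of_real (- rate n) * c n)" if "s \<in> {0..}" for n s
        using that by (intro heat_term_norm) auto
    qed (use t rapid_summable[OF 1] heat_series_summable[OF assms] in auto)
    have "((\<lambda>x. heat_series c t x) has_vector_derivative heat_series (dx_coeff c) t x)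
        (at x within UNIV)"
      unfolding heat_series_def
    proof (rule has_vector_derivative_suminf[where M = "\<lambda>n. norm (\<i> * of_nat n * c n)"])
      show "((\<lambda>x. heat_term c t x n) has_vector_derivative
          heat_term (dx_coeff c) t x n) (at x within UNIV)" for n x
        using has_vector_derivative_mult_right[OF cis_has_vector_derivative[of "real n" x UNIV],
            of "c n * of_real (exp (- rate n * t))"] by (simp add: mult_ac)
      show "norm (heat_term (dx_coeff c) t x n)
          \<le> norm (\<i> * of_nat n * c n)" for n x
        using t by (rule heat_term_norm)
    qed (use t rapid_summable[OF 2] heat_series_summable[OF assms t] in auto)
    then show "(heat_series c t has_vector_derivative heat_series (dx_coeff c) t x) (at x)"
      by simp
  qed
qed

lemma C_inf_heat_series:
  assumes "rapid c"
  shows "C_inf (heat_series c)"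
proof (rule C_inf_coinduct[where X = "\<lambda>f. \<exists>c. rapid c \<and> f = heat_series c"])
  fix f assume "\<exists>c. rapid c \<and> f = heat_series c"
  then obtain c where "rapid c" "f = heat_series c" by blast
  then show "\<exists>ft fx. has_partials f ft fx \<and> (\<exists>c. rapid c \<and> ft = heat_series c) \<and> (\<exists>c. rapid c \<and> fx = heat_series c)"
    using heat_series_has_partials by blast
qed (use assms in blast)

lemma periodic_heat_series: "periodic (heat_series c t)"
proof -
  have "cis (real n * (x + 2 * pi)) = cis (real n * x)" for n x
    using periodic_cis_int[of "int n"] by (simp add: periodic_def)
  then show ?thesis by (simp add: periodic_def heat_series_def)
qed

lemma heat_series_const:
  "heat_series (\<lambda>n. if n = 0 then c else 0) t x = c"
proof -
  have "heat_series (\<lambda>n. if n = 0 then c else 0) t x = (\<Sum>n. if n = 0 then c else 0)"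
    unfolding heat_series_def by (intro suminf_cong) (auto simp: rate_def)
  then show ?thesis using suminf_finite[of "{0::nat}" "\<lambda>n. if n = 0 then c else 0"] by simp
qed

lemma heat_series_diff:
  assumes "rapid c" "rapid d" "t \<ge> 0"
  shows "heat_series (\<lambda>n. c n - d n) t x = heat_series c t x - heat_series d t x"
  unfolding heat_series_def using suminf_diff[OF heat_series_summable[OF assms(1,3)] heat_series_summable[OF assms(2,3)]]
  by (simp add: algebra_simps)

lemma rapid_finite_support: "finite {n. c n \<noteq> 0} \<Longrightarrow> rapid c"
  unfolding rapid_def by (intro allI summable_finite[where N = "{n. c n \<noteq> 0}"]) auto

text \<open>Away from the constant term the series has a periodic primitive.\<close>

lemma integral_heat_series:
  fixes c :: "nat \<Rightarrow> complex"
  assumes "rapid c" "t \<ge> 0"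
  shows "(heat_series c t has_integral 2 * pi * c 0) {0..2*pi}"
proof -
  define b where "b n = (if n = 0 then 0 else 1 / (\<i> * of_nat n)) * c n" for n
  have b: "rapid b"
    unfolding b_def by (intro rapid_mult[OF assms(1), of _ 0]) (auto simp: norm_divide norm_mult field_simps)
  let ?z = "\<lambda>n. if n = 0 then c 0 else 0"
  have z: "rapid ?z" by (rule rapid_finite_support) auto
  have "(heat_series b t has_vector_derivative heat_series (dx_coeff b) t x) (at x)" for x
    using has_partialsD(3)[OF heat_series_has_partials(1)[OF b] assms(2)] .
  moreover have "(dx_coeff b) = (\<lambda>n. c n - ?z n)" by (auto simp: b_def)
  ultimately have "(heat_series b t has_vector_derivative heat_series c t x - c 0) (at x)" for x
    using heat_series_diff[OF assms(1) z assms(2)] by (simp add: heat_series_const)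
  from integral_deriv_periodic[OF this periodic_heat_series]
  have "((\<lambda>x. heat_series c t x - c 0) has_integral 0) {0..2*pi}" .
  from has_integral_add[OF this has_integral_const_real[of "c 0" 0 "2*pi"]]
  show ?thesis by (simp add: scaleR_conv_of_real)
qed

text \<open>The coefficients of a real function at \<open>n\<close> and \<open>- n\<close> are
  conjugate; the factor 2 folds each such pair into the real part of a single mode.\<close>

definition real_coeff :: "(real \<Rightarrow> real) \<Rightarrow> nat \<Rightarrow> complex" where
  "real_coeff p n = (if n = 0 then 1 else 2) * fourier_coeff (\<lambda>x. of_real (p x)) (int n)"

lemma fourier_coeff_of_real_uminus:
  assumes "continuous_on UNIV p"
  shows "fourier_coeff (\<lambda>x. of_real (p x)) (- n) = cnj (fourier_coeff (\<lambda>x. of_real (p x)) n)"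
proof -
  have "((\<lambda>x. of_real (p x) * cis (- (of_int n * x))) has_integral
      integral {0..2*pi} (\<lambda>x. of_real (p x) * cis (- (of_int n * x)))) {0..2*pi}"
    by (intro integrable_integral integrable_continuous_real continuous_intros continuous_on_subset[OF assms]) auto
  from has_integral_linear[OF this bounded_linear_cnj]
  have "((\<lambda>x. of_real (p x) * cis (- (of_int (- n) * x))) has_integral
      cnj (integral {0..2*pi} (\<lambda>x. of_real (p x) * cis (- (of_int n * x))))) {0..2*pi}"
    by (simp add: o_def cis_cnj)
  then show ?thesis by (simp add: fourier_coeff_def integral_unique)
qed

lemma sum_fourier_real:
  assumes "continuous_on UNIV p"
  shows "(\<Sum>n = - int N..int N. fourier_coeff (\<lambda>x. of_real (p x)) n * cis (of_int n * \<theta>))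
    = of_real (Re (\<Sum>n<Suc N. real_coeff p n * cis (real n * \<theta>)))"
proof (induction N)
  case 0
  have "fourier_coeff (\<lambda>x. of_real (p x)) 0 = cnj (fourier_coeff (\<lambda>x. of_real (p x)) 0)"
    using fourier_coeff_of_real_uminus[OF assms, of 0] by simp
  then show ?case by (simp add: real_coeff_def complex_eq_iff)
next
  case (Suc N)
  let ?a = "\<lambda>n. fourier_coeff (\<lambda>x. of_real (p x)) n * cis (of_int n * \<theta>)"
  have "{- int (Suc N)..int (Suc N)} = insert (- (int N + 1)) (insert (int N + 1) {- int N..int N})"
    by auto
  then have "(\<Sum>n = - int (Suc N)..int (Suc N). ?a n) = (?a (- (int N + 1)) + ?a (int N + 1)) + (\<Sum>n = - int N..int N. ?a n)"
    by simp
  also have "?a (- (int N + 1)) = cnj (?a (int N + 1))"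
    unfolding fourier_coeff_of_real_uminus[OF assms] complex_cnj_mult cis_cnj
    by (simp add: algebra_simps)
  also have "cnj (?a (int N + 1)) + ?a (int N + 1) = of_real (Re (real_coeff p (Suc N) * cis (real (Suc N) * \<theta>)))"
    by (simp add: real_coeff_def complex_eq_iff algebra_simps)
  finally show ?case by (simp add: Suc.IH del: of_real_sum)
qed

text \<open>Integration by parts \<open>k + 2\<close> times bounds the coefficient by a constant
  times \<open>n^(-k-2)\<close>. The two extra powers pay for summability after the weight
  \<open>real n ^ k\<close>.\<close>

lemma rapid_real_coeff:
  assumes "smooth p" "periodic p"
  shows "rapid (real_coeff p)"
  unfolding rapid_def
proof
  fix k
  let ?P = "\<lambda>k x. of_real ((vderiv ^^ k) p x) :: complex"
  have sm: "smooth ((vderiv ^^ k) p)" for k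
    by (induction k) (auto simp: assms smooth_vderiv)
  have d: "((vderiv ^^ k) p has_vector_derivative (vderiv ^^ Suc k) p x) (at x)" for k x
    using smooth_imp_differentiable[OF sm] by simp
  have dc: "(?P k has_vector_derivative ?P (Suc k) x) (at x)" for k x
    using d[of k x] by (intro has_vector_derivative_of_real) (simp add: has_real_derivative_iff_has_vector_derivative)
  have per: "periodic ((vderiv ^^ k) p)" for k
    by (induction k) (use assms(2) periodic_vderiv[OF _ d] in auto)
  have cont: "continuous_on S (?P k)" for k S
    by (intro continuous_intros smooth_imp_continuous sm)
  have iter: "fourier_coeff (?P k) n = (\<i> * of_int n) ^ k * fourier_coeff (?P 0) n" for k n
  proof (induction k)
    case (Suc k)
    have "fourier_coeff (?P (Suc k)) n = \<i> * of_int n * fourier_coeff (?P k) n"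
      by (rule fourier_coeff_deriv[OF dc cont]) (use per[of k] in \<open>simp add: periodic_def\<close>)
    then show ?case by (simp add: Suc.IH)
  qed simp
  have "compact (?P (k + 2) ` {0..2*pi})" by (intro compact_continuous_image cont) auto
  then obtain B where B: "\<And>x. x \<in> {0..2*pi} \<Longrightarrow> norm (?P (k + 2) x) \<le> B"
    using compact_imp_bounded bounded_iff by (metis image_eqI)
  have le: "norm (fourier_coeff (?P 0) (int n)) * real n ^ (k + 2) \<le> B" for n
    using fourier_coeff_norm_le[OF cont B, of "int n"] iter[of "k + 2" "int n"]
    by (simp add: norm_mult norm_power mult.commute)
  show "summable (\<lambda>n. norm (real_coeff p n) * real n ^ k)"
  proof (rule summable_comparison_test'[where N = 1])
    show "summable (\<lambda>n. 2 * B * inverse (real n ^ 2))"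
      by (intro summable_mult inverse_power_summable) simp
    fix n :: nat assume n: "1 \<le> n"
    have "norm (real_coeff p n) * real n ^ k = 2 * (norm (fourier_coeff (?P 0) (int n)) * real n ^ (k + 2)) * inverse (real n ^ 2)"
      using n by (simp add: real_coeff_def norm_mult power_add power2_eq_square field_simps)
    also have "\<dots> \<le> 2 * B * inverse (real n ^ 2)"
      by (intro mult_right_mono mult_left_mono le) auto
    finally show "norm (norm (real_coeff p n) * real n ^ k) \<le> 2 * B * inverse (real n ^ 2)" by simp
  qed
qed

text \<open>Inversion gives the limit of the symmetric partial sums, rapid decay gives summability
  of the one-sided series; folding conjugate pairs shows that the limits agree.\<close>

lemma fourier_series_real:
  assumes "smooth p" "periodic p"
  shows "p \<theta> = Re (\<Sum>n. real_coeff p n * cis (real n * \<theta>))"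
proof -
  let ?P = "\<lambda>x. of_real (p x) :: complex"
  have cont: "continuous_on UNIV p" by (rule smooth_imp_continuous[OF assms(1)])
  have "(?P has_vector_derivative of_real (vderiv p \<theta>)) (at \<theta>)"
    using smooth_imp_differentiable[OF assms(1)]
    by (intro has_vector_derivative_of_real) (simp add: has_real_derivative_iff_has_vector_derivative)
  from fourier_inversion[OF _ _ this]
  have "(\<lambda>N. of_real (Re (\<Sum>n<Suc N. real_coeff p n * cis (real n * \<theta>)))) \<longlonglongrightarrow> ?P \<theta>"
    using assms(2) cont unfolding sum_fourier_real[OF cont] by (simp add: periodic_def continuous_on_of_real)
  from tendsto_Re[OF this]
  have "(\<lambda>N. Re (\<Sum>n<Suc N. real_coeff p n * cis (real n * \<theta>))) \<longlonglongrightarrow> p \<theta>" by simp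
  moreover have "summable (\<lambda>n. real_coeff p n * cis (real n * \<theta>))"
    using heat_series_summable[OF rapid_real_coeff[OF assms], of 0 \<theta>] by simp
  then have "(\<lambda>N. Re (\<Sum>n<Suc N. real_coeff p n * cis (real n * \<theta>))) \<longlonglongrightarrow> Re (\<Sum>n. real_coeff p n * cis (real n * \<theta>))"
    by (intro tendsto_Re LIMSEQ_Suc summable_LIMSEQ)
  ultimately show ?thesis by (rule LIMSEQ_unique)
qed

section \<open>Flows of periodic vector fields on the line\<close>

lemma has_integral_exp_scaled:
  fixes a t :: real
  assumes "a \<noteq> 0" "0 \<le> t"
  shows "((\<lambda>s. exp (a * s)) has_integral (exp (a * t) - 1) / a) {0..t}"
proof -
  have "((\<lambda>s. exp (a * s)) has_integral exp (a * t) / a - exp (a * 0) / a) {0..t}"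
    using assms
    by (intro fundamental_theorem_of_calculus[where f = "\<lambda>s. exp (a * s) / a"])
      (auto intro!: derivative_eq_intros simp flip: has_real_derivative_iff_has_vector_derivative)
  then show ?thesis by (simp add: diff_divide_distrib)
qed

text \<open>The weight \<open>e\<^sup>-\<^sup>2\<^sup>K\<^sup>t\<close> makes the Picard operator a contraction on all of \<open>[0, \<infinity>)\<close> at once, and
  working with functions of time and initial position yields joint continuity.\<close>

lemma integral_equation_exists:
  fixes w :: "real \<Rightarrow> real \<Rightarrow> real"
  assumes w: "continuous_family w"
    and M: "\<And>t \<theta>. t \<ge> 0 \<Longrightarrow> \<bar>w t \<theta>\<bar> \<le> M"
    and K: "K > 0" "\<And>t x y. t \<ge> 0 \<Longrightarrow> \<bar>w t x - w t y\<bar> \<le> K * \<bar>x - y\<bar>"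
  obtains \<phi> where "continuous_family \<phi>"
    and "\<And>t u. t \<ge> 0 \<Longrightarrow> \<phi> t u = u + a + integral {0..t} (\<lambda>s. w s (\<phi> s u))"
proof -
  \<comment> \<open>The solution itself is unbounded in \<open>u\<close>. The unknown in the Banach
    space is its deviation from \<open>u + a\<close>, divided by
    \<open>exp (2 * K * t)\<close>.\<close>
  define lift where "lift g t u = u + a + exp (2 * K * t) * apply_bcontfun g (t, u)"
    for g :: "(real \<times> real) \<Rightarrow>\<^sub>C real" and t u
  have lift_cont: "continuous_on S (\<lambda>x. lift g (fst x) (snd x))" for g S
    unfolding lift_def
    by (auto intro!: continuous_intros continuous_on_compose2[OF continuous_on_apply_bcontfun[of UNIV]])
  have w_cont: "continuous_family (\<lambda>s u. w s (lift g s u))" for g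
    unfolding case_prod_unfold
    by (intro continuous_on_halfplane_compose[OF w] continuous_intros lift_cont) auto
  define J where "J g t u = integral {0..t} (\<lambda>s. w s (lift g s u))" for g t u
  have J_cont: "continuous_family (\<lambda>t u. J g t u)" for g
    unfolding J_def by (rule continuous_on_time_integral[OF w_cont])
  have w_int: "(\<lambda>s. w s (lift g s u)) integrable_on {0..t}" if "t \<ge> 0" for g t u
    by (intro integrable_continuous_real continuous_on_subset[OF continuous_on_slice1[OF w_cont]]) auto
  \<comment> \<open>Bounded continuous functions live on the whole plane here; \<open>max 0\<close>
    freezes the operator at its initial value for negative times.\<close>
  define Psi where "Psi g x = exp (- 2 * K * max 0 (fst x)) * J g (max 0 (fst x)) (snd x)" for g x
  have Psi_bcontfun: "Psi g \<in> bcontfun" for g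
  proof (rule bcontfun_normI)
    show "continuous_on UNIV (Psi g)"
      unfolding Psi_def
      by (intro continuous_intros continuous_on_halfplane_compose[OF J_cont]) auto
    fix x :: "real \<times> real"
    define t where "t = max 0 (fst x)"
    have t: "t \<ge> 0" by (simp add: t_def)
    have "norm (J g t (snd x)) \<le> M * (t - 0)"
      unfolding J_def using t M
      by (intro integral_bound continuous_on_subset[OF continuous_on_slice1[OF w_cont]]) auto
    then have "norm (Psi g x) \<le> exp (- 2 * K * t) * (M * t)"
      unfolding Psi_def by (simp add: abs_mult flip: t_def)
    also have "\<dots> = M / (2 * K) * ((2 * K * t) * exp (- (2 * K * t)))"
      using K(1) by simp
    \<comment> \<open>The deviation grows at most linearly in \<open>t\<close>; the weight absorbs
      it because \<open>x exp (- x) \<le> 1\<close> for \<open>x = 2 * K * t\<close>.\<close>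
    also have "\<dots> \<le> M / (2 * K) * 1"
    proof (rule mult_left_mono)
      have "2 * K * t \<le> exp (2 * K * t)" using exp_ge_add_one_self[of "2 * K * t"] by linarith
      then show "(2 * K * t) * exp (- (2 * K * t)) \<le> 1" by (simp add: exp_minus field_simps)
      show "0 \<le> M / (2 * K)" using K(1) M[of 0 0] by auto
    qed
    finally show "norm (Psi g x) \<le> M / (2 * K)" by simp
  qed
  define T where "T g = Bcontfun (Psi g)" for g
  have T_apply: "apply_bcontfun (T g) x = Psi g x" for g x
    unfolding T_def using Psi_bcontfun by (simp add: Bcontfun_inverse)
  \<comment> \<open>The factor \<open>1/2\<close> arises since the integral of
    \<open>K * exp (2 * K * s)\<close> over \<open>{0..t}\<close> is at most half of
    \<open>exp (2 * K * t)\<close>.\<close>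
  have "\<exists>!g. T g = g"
  proof (rule banach_fix_type[where c = "1/2"])
    have "dist (T g) (T h) \<le> 1/2 * dist g h" for g h
    proof (rule dist_bound)
      fix x :: "real \<times> real"
      define t where "t = max 0 (fst x)"
      have t: "t \<ge> 0" by (simp add: t_def)
      have "norm (J g t (snd x) - J h t (snd x))
          = norm (integral {0..t} (\<lambda>s. w s (lift g s (snd x)) - w s (lift h s (snd x))))"
        unfolding J_def by (simp add: integral_diff w_int t)
      also have "\<dots> \<le> integral {0..t} (\<lambda>s. K * dist g h * exp (2 * K * s))"
      proof (rule integral_norm_bound_integral)
        show "(\<lambda>s. w s (lift g s (snd x)) - w s (lift h s (snd x))) integrable_on {0..t}"
          by (intro integrable_diff w_int t)
        show "(\<lambda>s. K * dist g h * exp (2 * K * s)) integrable_on {0..t}"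
          by (intro integrable_continuous_real continuous_intros)
        fix s assume s: "s \<in> {0..t}"
        have "norm (w s (lift g s (snd x)) - w s (lift h s (snd x))) \<le> K * \<bar>lift g s (snd x) - lift h s (snd x)\<bar>"
          using K(2)[of s] s by simp
        also have "\<bar>lift g s (snd x) - lift h s (snd x)\<bar> = exp (2 * K * s) * dist (apply_bcontfun g (s, snd x)) (apply_bcontfun h (s, snd x))"
          by (simp add: lift_def dist_real_def abs_mult flip: right_diff_distrib)
        also have "K * \<dots> \<le> K * (exp (2 * K * s) * dist g h)"
          using K(1) by (intro mult_left_mono dist_bounded) auto
        finally show "norm (w s (lift g s (snd x)) - w s (lift h s (snd x))) \<le> K * dist g h * exp (2 * K * s)"
          by (simp add: mult_ac)
      qed
      also have "\<dots> = K * dist g h * ((exp (2 * K * t) - 1) / (2 * K))"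
        by (rule integral_unique[OF has_integral_mult_right[OF has_integral_exp_scaled]]) (use K(1) t in auto)
      also have "\<dots> \<le> 1/2 * dist g h * exp (2 * K * t)"
        using K(1) by (simp add: field_simps)
      finally have "exp (- 2 * K * t) * norm (J g t (snd x) - J h t (snd x)) \<le> exp (- 2 * K * t) * (1/2 * dist g h * exp (2 * K * t))"
        by (intro mult_left_mono) auto
      also have "\<dots> = 1/2 * dist g h" by (simp flip: exp_add)
      finally show "dist (apply_bcontfun (T g) x) (apply_bcontfun (T h) x) \<le> 1/2 * dist g h"
        unfolding T_apply Psi_def t_def[symmetric]
        by (simp add: dist_real_def abs_mult flip: right_diff_distrib)
    qed
    then show "\<forall>g h. dist (T g) (T h) \<le> 1/2 * dist g h" by blast
  qed auto
  then obtain g where g: "T g = g" by blast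
  show ?thesis
  proof
    show "continuous_family (\<lambda>t u. lift g t u)"
      using lift_cont by (simp add: case_prod_unfold)
    fix t u :: real assume t: "t \<ge> 0"
    have "apply_bcontfun g (t, u) = exp (- 2 * K * t) * J g t u"
      using T_apply[of g "(t, u)"] t unfolding g Psi_def by simp
    then have "lift g t u = u + a + (exp (2 * K * t) * exp (- (2 * K * t))) * J g t u"
      unfolding lift_def by simp
    then show "lift g t u = u + a + integral {0..t} (\<lambda>s. w s (lift g s u))"
      by (simp add: J_def flip: exp_add)
  qed
qed

section \<open>Comparison of solutions of scalar differential equations\<close>

lemma mvt_halfline:
  fixes f :: "real \<Rightarrow> real"
  assumes "0 \<le> t" "\<And>s. 0 \<le> s \<Longrightarrow> s \<le> t \<Longrightarrow> (f has_vector_derivative f' s) (at s within {0..})"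
  shows "\<exists>s\<in>{0..t}. f t - f 0 = t * f' s"
proof -
  have "\<exists>s\<in>{0..t}. f t - f 0 = (t - 0) *\<^sub>R f' s"
  proof (rule mvt_very_simple[OF assms(1)])
    fix s assume s: "0 \<le> s" "s \<le> t"
    have "(f has_vector_derivative f' s) (at s within {0..t})"
      using has_vector_derivative_within_subset[OF assms(2)[OF s], of "{0..t}"] by auto
    then show "(f has_derivative (\<lambda>h. h *\<^sub>R f' s)) (at s within {0..t})"
      by (simp only: has_vector_derivative_def)
  qed
  then show ?thesis by simp
qed

text \<open>The squared difference times \<open>exp (- 2 * K * t)\<close> has nonpositive
  derivative; squaring avoids differentiating an absolute value. With equal initial values the
  estimate is a uniqueness statement.\<close>

lemma gronwall_difference:
  fixes x y :: "real \<Rightarrow> real"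
  assumes "\<And>t. t \<ge> 0 \<Longrightarrow> (x has_vector_derivative x' t) (at t within {0..})"
    and "\<And>t. t \<ge> 0 \<Longrightarrow> (y has_vector_derivative y' t) (at t within {0..})"
    and "\<And>t. t \<ge> 0 \<Longrightarrow> \<bar>x' t - y' t\<bar> \<le> K * \<bar>x t - y t\<bar>"
    and t: "t \<ge> 0"
  shows "\<bar>x t - y t\<bar> \<le> \<bar>x 0 - y 0\<bar> * exp (K * t)"
proof -
  define d where "d s = x s - y s" for s
  define d' where "d' s = x' s - y' s" for s
  have d: "(d has_vector_derivative d' s) (at s within {0..})" if "s \<ge> 0" for s
    using has_vector_derivative_diff[OF assms(1,2)[OF that]] unfolding d_def d'_def by simp
  have der: "((\<lambda>s. (d s)\<^sup>2 * exp (- 2 * K * s)) has_vector_derivative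
      (2 * d s * d' s - 2 * K * (d s)\<^sup>2) * exp (- 2 * K * s)) (at s within {0..})" if "s \<ge> 0" for s
    using d[OF that] unfolding has_real_derivative_iff_has_vector_derivative[symmetric]
    by (auto intro!: derivative_eq_intros simp: algebra_simps)
  obtain s where s: "s \<in> {0..t}" "(d t)\<^sup>2 * exp (- 2 * K * t) - (d 0)\<^sup>2 * exp (- 2 * K * 0)
      = t * ((2 * d s * d' s - 2 * K * (d s)\<^sup>2) * exp (- 2 * K * s))"
    using mvt_halfline[OF t der] by auto
  have "d s * d' s \<le> \<bar>d s\<bar> * \<bar>d' s\<bar>" by (metis abs_ge_self abs_mult)
  also have "\<dots> \<le> \<bar>d s\<bar> * (K * \<bar>d s\<bar>)"
    using assms(3)[of s] s(1) by (intro mult_left_mono) (auto simp: d_def d'_def)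
  finally have "d s * d' s \<le> K * (d s)\<^sup>2"
    by (simp add: power2_eq_square mult_ac flip: abs_mult)
  then have "t * ((2 * d s * d' s - 2 * K * (d s)\<^sup>2) * exp (- 2 * K * s)) \<le> 0"
    by (intro mult_nonneg_nonpos[OF t] mult_nonpos_nonneg) auto
  then have "(d t)\<^sup>2 * exp (- 2 * K * t) \<le> (d 0)\<^sup>2"
    using s(2) by simp
  then have "(d t)\<^sup>2 \<le> (\<bar>d 0\<bar> * exp (K * t))\<^sup>2"
    by (simp add: exp_minus field_simps power_mult_distrib flip: exp_double)
  then have "\<bar>d t\<bar>\<^sup>2 \<le> (\<bar>d 0\<bar> * exp (K * t))\<^sup>2" by simp
  then show ?thesis
    unfolding d_def[symmetric] by (rule power2_le_imp_le) simp
qed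

lemma has_vector_derivative_if_quadratic:
  fixes f :: "real \<Rightarrow> real"
  assumes "\<And>h. \<bar>f (u + h) - f u - h * d\<bar> \<le> C * h\<^sup>2"
  shows "(f has_vector_derivative d) (at u)"
  unfolding has_real_derivative_iff_has_vector_derivative[symmetric] DERIV_def
proof (rule Lim_null[THEN iffD2], rule Lim_null_comparison)
  show "\<forall>\<^sub>F h in at 0. norm ((f (u + h) - f u) / h - d) \<le> C * \<bar>h\<bar>"
    unfolding eventually_at_topological
  proof (intro exI[of _ UNIV] conjI ballI impI)
    fix h :: real assume "h \<noteq> 0"
    then have "norm ((f (u + h) - f u) / h - d) * \<bar>h\<bar> = \<bar>f (u + h) - f u - h * d\<bar>"
      by (simp add: field_simps flip: abs_mult)
    also have "\<dots> \<le> (C * \<bar>h\<bar>) * \<bar>h\<bar>" using assms[of h] by (simp add: power2_eq_square mult.assoc)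
    finally show "norm ((f (u + h) - f u) / h - d) \<le> C * \<bar>h\<bar>"
      using \<open>h \<noteq> 0\<close> by simp
  qed auto
  have "((\<lambda>h. C * \<bar>h\<bar>) \<longlongrightarrow> C * \<bar>0\<bar>) (at (0::real))" by (intro tendsto_intros)
  then show "((\<lambda>h. C * \<bar>h\<bar>) \<longlongrightarrow> 0) (at (0::real))" by simp
qed

text \<open>Compactness of \<open>{0..T}\<close> times one period, extended by periodicity. It
  supplies the second-order constant in the Taylor estimate for the flow map.\<close>

lemma periodic_bounded_on_strip:
  fixes f :: "real \<Rightarrow> real \<Rightarrow> real"
  assumes f: "continuous_family f" and per: "\<And>t. t \<ge> 0 \<Longrightarrow> periodic (f t)"
  obtains B where "\<And>t \<theta>. t \<in> {0..T} \<Longrightarrow> \<bar>f t \<theta>\<bar> \<le> B"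
proof -
  have "bounded ((\<lambda>(t, \<theta>). f t \<theta>) ` ({0..T} \<times> {0..2*pi}))"
    by (intro compact_imp_bounded compact_continuous_image compact_Times continuous_on_subset[OF f]) auto
  then obtain B where "\<forall>y\<in>(\<lambda>(t, \<theta>). f t \<theta>) ` ({0..T} \<times> {0..2*pi}). \<bar>y\<bar> \<le> B"
    unfolding bounded_real by blast
  then have B: "\<bar>f t \<theta>\<bar> \<le> B" if "t \<in> {0..T}" "\<theta> \<in> {0..2*pi}" for t \<theta>
    using that by force
  have "\<bar>f t \<theta>\<bar> \<le> B" if t: "t \<in> {0..T}" for t \<theta>
  proof -
    define k where "k = \<lfloor>\<theta> / (2 * pi)\<rfloor>"
    define \<theta>' where "\<theta>' = \<theta> - 2 * pi * of_int k"
    have "of_int k \<le> \<theta> / (2 * pi)" "\<theta> / (2 * pi) < of_int k + 1" by (auto simp: k_def)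
    then have "\<theta>' \<in> {0..2*pi}" by (auto simp: \<theta>'_def field_simps)
    moreover have "f t \<theta> = f t \<theta>'" using periodic_int[OF per, of t \<theta>' k] t by (simp add: \<theta>'_def)
    ultimately show ?thesis using B t by metis
  qed
  then show ?thesis using that by blast
qed

lemma smooth_has_real_derivative: "smooth f \<Longrightarrow> (f has_real_derivative vderiv f x) (at x)"
  using smooth_imp_differentiable by (simp add: has_real_derivative_iff_has_vector_derivative)

lemma deriv_eq_vderiv: "smooth f \<Longrightarrow> deriv f = vderiv f"
  using smooth_has_real_derivative DERIV_imp_deriv by blast

lemma mean_value_general:
  fixes f f' :: "real \<Rightarrow> real"
  assumes f: "\<And>x. (f has_vector_derivative f' x) (at x)"
  shows "\<exists>z. \<bar>z - x\<bar> \<le> \<bar>y - x\<bar> \<and> f y - f x = f' z * (y - x)"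
proof -
  have *: "\<exists>z. a < z \<and> z < b \<and> f b - f a = (b - a) * f' z" if "a < b" for a b
    using MVT2[OF that, of f f'] f by (auto simp: has_real_derivative_iff_has_vector_derivative)
  consider "x < y" | "x = y" | "y < x" by linarith
  then show ?thesis
  proof cases
    case 1
    then obtain z where "x < z" "z < y" "f y - f x = (y - x) * f' z" using * by blast
    then show ?thesis by (intro exI[of _ z]) auto
  next
    case 3
    then obtain z where "y < z" "z < x" "f x - f y = (x - y) * f' z" using * by blast
    then show ?thesis by (intro exI[of _ z]) (auto simp: algebra_simps)
  qed auto
qed

text \<open>The \<open>u\<close>-derivative of the solution is explicit, since the equation is scalar; bootstrapping on it
  gives smoothness.\<close>

lemma flow_map_exists:
  fixes w :: "real \<Rightarrow> real \<Rightarrow> real"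
  assumes w: "C_inf w" and per: "\<And>t. t \<ge> 0 \<Longrightarrow> periodic (w t)"
    and M: "\<And>t \<theta>. t \<ge> 0 \<Longrightarrow> \<bar>w t \<theta>\<bar> \<le> M"
    and K: "\<And>t \<theta>. t \<ge> 0 \<Longrightarrow> \<bar>dx w t \<theta>\<bar> \<le> K"
  obtains \<phi> where "C_inf \<phi>" and "\<And>u. \<phi> 0 u = u + a"
    and "\<And>t u. t \<ge> 0 \<Longrightarrow> ((\<lambda>s. \<phi> s u) has_vector_derivative w t (\<phi> t u)) (at t within {0..})"
    and "\<And>t. t \<ge> 0 \<Longrightarrow> circle_reparam (\<phi> t)"
proof -
  \<comment> \<open>\<open>K\<close> may be 0, whereas the Picard argument requires a positive
    Lipschitz constant.\<close>
  define L where "L = max K 1"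
  have L: "L > 0" by (simp add: L_def)
  note wp = C_inf_dt_dx[OF w]
  note wxp = C_inf_dt_dx[OF wp(3)]
  have lip: "\<bar>w t x - w t y\<bar> \<le> L * \<bar>x - y\<bar>" if t: "t \<ge> 0" for t x y
  proof -
    obtain z where "w t x - w t y = dx w t z * (x - y)"
      using mean_value_general[OF has_partialsD(3)[OF wp(1) t], where x = y and y = x] by blast
    moreover have "\<bar>dx w t z\<bar> \<le> L" using K[OF t, of z] by (simp add: L_def)
    ultimately show ?thesis by (simp add: abs_mult mult_right_mono)
  qed
  obtain \<phi> where \<phi>: "continuous_family \<phi>"
    and \<phi>_int: "\<And>t u. t \<ge> 0 \<Longrightarrow> \<phi> t u = u + a + integral {0..t} (\<lambda>s. w s (\<phi> s u))"
    using integral_equation_exists[OF has_partialsD(1)[OF wp(1)] M L lip] by blast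
  have \<phi>0: "\<phi> 0 u = u + a" for u using \<phi>_int[of 0 u] by simp
  have cont: "continuous_family (\<lambda>t u. f t (\<phi> t u))" if "C_inf f" for f :: "real \<Rightarrow> real \<Rightarrow> real"
    using \<phi> unfolding case_prod_unfold
    by (intro continuous_on_halfplane_compose[OF C_upto_continuous[OF C_infD[OF that]]] continuous_intros) auto
  have \<phi>_t: "((\<lambda>s. \<phi> s u) has_vector_derivative w t (\<phi> t u)) (at t within {0..})" if t: "t \<ge> 0" for t u
  proof (rule has_vector_derivative_transform)
    show "((\<lambda>t. integral {0..t} (\<lambda>s. w s (\<phi> s u)) + (u + a)) has_vector_derivative w t (\<phi> t u)) (at t within {0..})"
      by (rule has_vector_derivative_add_const[THEN iffD2],
          rule has_vector_derivative_time_integral[where f = "\<lambda>s. w s (\<phi> s u)", OF continuous_on_slice1[OF cont[OF w]] t])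
  qed (use t \<phi>_int in auto)
  have growth: "\<bar>\<phi> t u - \<phi> t v\<bar> \<le> \<bar>u - v\<bar> * exp (L * t)" if "t \<ge> 0" for t u v
    using gronwall_difference[where K = L, OF \<phi>_t \<phi>_t lip that, of u v] by (simp add: \<phi>0)
  \<comment> \<open>By periodicity of \<open>w\<close>, the shifted solution
    \<open>\<phi> s u + 2 * pi\<close> solves the same equation with the initial value belonging to
    \<open>u + 2 * pi\<close>; the comparison estimate identifies the two.\<close>
  have shift: "\<phi> t (u + 2 * pi) = \<phi> t u + 2 * pi" if "t \<ge> 0" for t u
  proof -
    have "((\<lambda>s. \<phi> s u + 2 * pi) has_vector_derivative w t (\<phi> t u + 2 * pi)) (at t within {0..})" if "t \<ge> 0" for t
      using has_vector_derivative_add_const[THEN iffD2, OF \<phi>_t[OF that]] per[OF that] by (simp add: periodic_def)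
    from gronwall_difference[where K = L, OF \<phi>_t this lip that, of "u + 2 * pi"]
    show ?thesis by (simp add: \<phi>0)
  qed
  \<comment> \<open>The linearised equation predicts that the \<open>u\<close>-derivative of
    \<open>\<phi> t\<close> is \<open>exp (I t u)\<close>; its positivity makes
    \<open>\<phi> t\<close> a diffeomorphism.\<close>
  define I where "I t u = integral {0..t} (\<lambda>s. dx w s (\<phi> s u))" for t u
  have I_t: "((\<lambda>t. I t u) has_vector_derivative dx w t (\<phi> t u)) (at t within {0..})" if "t \<ge> 0" for t u
    unfolding I_def
    by (rule has_vector_derivative_time_integral[where f = "\<lambda>s. dx w s (\<phi> s u)", OF continuous_on_slice1[OF cont[OF wp(3)]] that])
  have I_bound: "\<bar>I t u\<bar> \<le> L * t" if "t \<ge> 0" for t u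
  proof -
    have "norm (integral {0..t} (\<lambda>s. dx w s (\<phi> s u))) \<le> L * (t - 0)"
      using K that by (intro integral_bound continuous_on_subset[OF continuous_on_slice1[OF cont[OF wp(3)]]])
        (auto simp: L_def le_max_iff_disj)
    then show ?thesis by (simp add: I_def)
  qed
  have \<phi>_u: "(\<phi> t has_vector_derivative exp (I t u)) (at u)" if t: "t \<ge> 0" for t u
  proof -
    have "periodic (dx (dx w) s)" if "s \<ge> 0" for s
      using periodic_vderiv[OF periodic_vderiv[OF per[OF that] has_partialsD(3)[OF wp(1) that]]
          has_partialsD(3)[OF wxp(1) that]] .
    from periodic_bounded_on_strip[OF C_upto_continuous[OF C_infD[OF wxp(3)]] this, of t]
    obtain C where C: "\<And>s \<theta>. s \<in> {0..t} \<Longrightarrow> \<bar>dx (dx w) s \<theta>\<bar> \<le> C" by blast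
    have C0: "C \<ge> 0" using C[of 0 0] t by auto
    have taylor: "\<bar>w s y - w s x - dx w s x * (y - x)\<bar> \<le> C * \<bar>y - x\<bar>\<^sup>2" if s: "s \<in> {0..t}" for s x y
    proof -
      have s0: "s \<ge> 0" using s by simp
      obtain z where z: "\<bar>z - x\<bar> \<le> \<bar>y - x\<bar>" "w s y - w s x = dx w s z * (y - x)"
        using mean_value_general[OF has_partialsD(3)[OF wp(1) s0], where x = x and y = y] by blast
      obtain v where v: "dx w s z - dx w s x = dx (dx w) s v * (z - x)"
        using mean_value_general[OF has_partialsD(3)[OF wxp(1) s0], where x = x and y = z] by blast
      have "\<bar>w s y - w s x - dx w s x * (y - x)\<bar> = \<bar>dx (dx w) s v\<bar> * \<bar>z - x\<bar> * \<bar>y - x\<bar>"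
        unfolding z(2) left_diff_distrib[symmetric] v abs_mult ..
      also have "\<dots> \<le> C * \<bar>y - x\<bar> * \<bar>y - x\<bar>"
        using C[OF s] z(1) C0 by (intro mult_mono) auto
      finally show ?thesis by (simp add: power2_eq_square)
    qed
    show ?thesis
    proof (rule has_vector_derivative_if_quadratic)
      fix h
      define D where "D s = \<phi> s (u + h) - \<phi> s u" for s
      define D' where "D' s = w s (\<phi> s (u + h)) - w s (\<phi> s u)" for s
      have D: "(D has_vector_derivative D' s) (at s within {0..})" if "s \<ge> 0" for s
        using has_vector_derivative_diff[OF \<phi>_t[OF that] \<phi>_t[OF that]] unfolding D_def D'_def .
      \<comment> \<open>With this integrating factor only the Taylor remainder survives in the
        derivative. It is quadratic in \<open>h\<close> by the growth bound, so
        \<open>D t * exp (- I t u)\<close> differs from its initial value \<open>h\<close> by a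
        quadratic error.\<close>
      have der: "((\<lambda>s. D s * exp (- I s u)) has_vector_derivative
          (D' s - dx w s (\<phi> s u) * D s) * exp (- I s u)) (at s within {0..})" if "s \<ge> 0" for s
        using D[OF that] I_t[OF that, of u] unfolding has_real_derivative_iff_has_vector_derivative[symmetric]
        by (auto intro!: derivative_eq_intros simp: algebra_simps)
      obtain s where s: "s \<in> {0..t}" "D t * exp (- I t u) - D 0 * exp (- I 0 u)
          = t * ((D' s - dx w s (\<phi> s u) * D s) * exp (- I s u))"
        using mvt_halfline[OF t der] by auto
      have "\<bar>D' s - dx w s (\<phi> s u) * D s\<bar> \<le> C * \<bar>D s\<bar>\<^sup>2"
        using taylor[OF s(1)] unfolding D'_def D_def .
      also have "\<dots> \<le> C * (\<bar>h\<bar> * exp (L * t))\<^sup>2"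
      proof (intro mult_left_mono power_mono C0)
        have "\<bar>D s\<bar> \<le> \<bar>h\<bar> * exp (L * s)" using growth[of s "u + h" u] s(1) by (simp add: D_def)
        also have "\<dots> \<le> \<bar>h\<bar> * exp (L * t)" using s(1) L by (intro mult_left_mono) auto
        finally show "\<bar>D s\<bar> \<le> \<bar>h\<bar> * exp (L * t)" .
      qed auto
      finally have 1: "\<bar>D' s - dx w s (\<phi> s u) * D s\<bar> \<le> C * (\<bar>h\<bar> * exp (L * t))\<^sup>2" .
      have "L * s \<le> L * t" using s(1) L by (intro mult_left_mono) auto
      then have exp_le: "exp (- I s u) \<le> exp (L * t)"
        using I_bound[of s u] s(1) by (simp add: abs_le_iff)
      have "\<bar>D t * exp (- I t u) - h\<bar> = t * (\<bar>D' s - dx w s (\<phi> s u) * D s\<bar> * exp (- I s u))"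
        using s(2) t by (simp add: D_def \<phi>0 I_def abs_mult)
      also have "\<dots> \<le> t * ((C * (\<bar>h\<bar> * exp (L * t))\<^sup>2) * exp (L * t))"
        using C0 by (intro mult_left_mono mult_mono 1 exp_le t) auto
      finally have 2: "\<bar>D t * exp (- I t u) - h\<bar> \<le> t * ((C * (\<bar>h\<bar> * exp (L * t))\<^sup>2) * exp (L * t))" .
      have "\<phi> t (u + h) - \<phi> t u - h * exp (I t u) = exp (I t u) * (D t * exp (- I t u) - h)"
        by (simp add: D_def algebra_simps flip: exp_add)
      then have "\<bar>\<phi> t (u + h) - \<phi> t u - h * exp (I t u)\<bar> = exp (I t u) * \<bar>D t * exp (- I t u) - h\<bar>"
        by (simp add: abs_mult)
      also have "\<dots> \<le> exp (I t u) * (t * ((C * (\<bar>h\<bar> * exp (L * t))\<^sup>2) * exp (L * t)))"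
        by (intro mult_left_mono 2) auto
      finally show "\<bar>\<phi> t (u + h) - \<phi> t u - h * exp (I t u)\<bar>
          \<le> (exp (I t u) * (t * (C * (exp (L * t))\<^sup>2 * exp (L * t)))) * h\<^sup>2"
        by (simp add: power_mult_distrib mult_ac)
    qed
  qed
  have hp: "has_partials \<phi> (\<lambda>t u. w t (\<phi> t u)) (\<lambda>t u. exp (I t u))"
    unfolding has_partials_def using \<phi> \<phi>_t \<phi>_u by blast
  have "C_upto k \<phi>" for k
  proof (induction k)
    case 0
    show ?case using \<phi> by simp
  next
    case (Suc k)
    have "C_upto k (\<lambda>t u. w t (\<phi> t u))" by (rule C_upto_compose[OF C_infD[OF w] Suc])
    moreover have "C_upto k I"
      unfolding I_def by (rule C_upto_time_integral[OF C_upto_compose[OF C_infD[OF wp(3)] Suc]])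
    then have "C_upto k (\<lambda>t u. exp (I t u))" by (rule C_upto_compose[OF C_infD[OF C_inf_exp]])
    ultimately show ?case unfolding C_upto_Suc_partials using hp by blast
  qed
  then have C: "C_inf \<phi>" by (simp add: C_inf_def)
  have "circle_reparam (\<phi> t)" if t: "t \<ge> 0" for t
    unfolding circle_reparam_def
  proof (intro conjI allI)
    show "smooth (\<phi> t)" by (rule C_inf_slice[OF C t])
    show "deriv (\<phi> t) u > 0" for u
      using DERIV_imp_deriv[OF \<phi>_u[OF t, of u, folded has_real_derivative_iff_has_vector_derivative]] by simp
  qed (rule shift[OF t])
  then show ?thesis using that[OF C \<phi>0 \<phi>_t] by blast
qed

text \<open>A positive derivative gives injectivity, and growth by \<open>2 * pi\<close> per period
  gives surjectivity through intermediate values. Smoothness is a bootstrap: the derivative of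
  \<open>\<sigma>\<close> is \<open>inverse (vderiv f (\<sigma> \<theta>))\<close>, which is as
  regular as \<open>\<sigma>\<close>.\<close>

lemma circle_reparam_inverse:
  assumes f: "circle_reparam f"
  obtains \<sigma> where "circle_reparam \<sigma>" "\<And>\<theta>. f (\<sigma> \<theta>) = \<theta>" "\<And>u. \<sigma> (f u) = u"
proof -
  have sm: "smooth f" and shift: "\<And>u. f (u + 2 * pi) = f u + 2 * pi"
    using f by (auto simp: circle_reparam_def)
  have pos: "vderiv f u > 0" for u using f deriv_eq_vderiv[OF sm] by (simp add: circle_reparam_def)
  have der: "(f has_real_derivative vderiv f u) (at u)" for u by (rule smooth_has_real_derivative[OF sm])
  have mono: "f x < f y" if "x < y" for x y
    using DERIV_pos_imp_increasing[OF that] der pos by blast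
  then have inj: "inj f" by (metis injI linorder_neqE_linordered_idom order_less_irrefl)
  have cont: "continuous_on S f" for S by (rule smooth_imp_continuous[OF sm])
  have "periodic (\<lambda>u. f u - u)" using shift by (simp add: periodic_def)
  from periodic_int[OF this, of 0] have fk: "f (2 * pi * of_int k) = f 0 + 2 * pi * of_int k" for k
    by (simp add: algebra_simps)
  have "\<exists>x. f x = y" for y
  proof -
    define k where "k = \<lfloor>(y - f 0) / (2 * pi)\<rfloor>"
    have "of_int k \<le> (y - f 0) / (2 * pi)" "(y - f 0) / (2 * pi) < of_int (k + 1)" by (auto simp: k_def)
    then have "f (2 * pi * of_int k) \<le> y" "y \<le> f (2 * pi * of_int (k + 1))"
      unfolding fk by (simp_all add: field_simps)
    moreover have "2 * pi * of_int k \<le> 2 * pi * of_int (k + 1)" by simp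
    ultimately show ?thesis using IVT'[of f _ y] cont by blast
  qed
  then have surj: "surj f" by (metis surjI)
  define \<sigma> where "\<sigma> = inv f"
  have f\<sigma>: "f (\<sigma> \<theta>) = \<theta>" for \<theta> unfolding \<sigma>_def by (rule surj_f_inv_f[OF surj])
  have \<sigma>f: "\<sigma> (f u) = u" for u unfolding \<sigma>_def by (rule inv_f_f[OF inj])
  have \<sigma>_mono: "\<sigma> x < \<sigma> y" if "x < y" for x y
    using mono[of "\<sigma> y" "\<sigma> x"] that f\<sigma> by (metis linorder_neqE_linordered_idom not_less_iff_gr_or_eq)
  have \<sigma>_cont: "isCont \<sigma> \<theta>" for \<theta>
  proof -
    have "isCont \<sigma> (f (\<sigma> \<theta>))"
      by (rule isCont_inverse_function[where d = 1])
        (use \<sigma>f cont[of UNIV] in \<open>auto simp: continuous_on_eq_continuous_at\<close>)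
    then show ?thesis by (simp add: f\<sigma>)
  qed
  have \<sigma>_der: "(\<sigma> has_real_derivative inverse (vderiv f (\<sigma> \<theta>))) (at \<theta>)" for \<theta>
    by (rule DERIV_inverse_function[where f = f and a = "\<theta> - 1" and b = "\<theta> + 1"])
      (use der pos f\<sigma> \<sigma>_cont in \<open>auto simp: less_imp_neq[symmetric] order.strict_implies_not_eq\<close>)
  have "C_upto k (\<lambda>_. \<sigma>)" for k
  proof (induction k)
    case 0
    have "continuous_on UNIV \<sigma>" using \<sigma>_cont by (simp add: continuous_at_imp_continuous_on)
    then show ?case by (auto simp: case_prod_unfold intro!: continuous_on_compose2[of UNIV \<sigma>] continuous_intros)
  next
    case (Suc k)
    have "C_inf (\<lambda>_. vderiv f)" using smooth_vderiv[OF sm] by (simp add: smooth_iff_C_inf)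
    then have "C_inf (\<lambda>_ u. inverse (vderiv f u))" using pos less_irrefl by (intro C_inf_inverse) (auto, metis less_irrefl)
    from C_upto_compose[OF C_infD[OF this] Suc]
    have "C_upto k (\<lambda>_ \<theta>. inverse (vderiv f (\<sigma> \<theta>)))" .
    moreover have "has_partials (\<lambda>_. \<sigma>) (\<lambda>_ _. 0) (\<lambda>_ \<theta>. inverse (vderiv f (\<sigma> \<theta>)))"
      unfolding has_partials_def
      using C_upto_continuous[OF Suc] \<sigma>_der by (simp add: has_real_derivative_iff_has_vector_derivative)
    ultimately show ?case unfolding C_upto_Suc_partials using C_infD[OF C_inf_const] by blast
  qed
  then have \<sigma>_sm: "smooth \<sigma>" by (simp add: smooth_iff_C_inf C_inf_def)
  show ?thesis
  proof (rule that[OF _ f\<sigma> \<sigma>f])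
    have "\<sigma> (\<theta> + 2 * pi) = \<sigma> \<theta> + 2 * pi" for \<theta>
      using \<sigma>f[of "\<sigma> \<theta> + 2 * pi"] by (simp add: shift f\<sigma>)
    then show "circle_reparam \<sigma>"
      using \<sigma>_sm DERIV_imp_deriv[OF \<sigma>_der] pos by (simp add: circle_reparam_def)
  qed
qed

section \<open>Support functions\<close>

lemma smooth_add: "smooth f \<Longrightarrow> smooth g \<Longrightarrow> smooth (\<lambda>x. f x + g x)"
  unfolding smooth_iff_C_inf by (rule C_inf_add)

lemma smooth_scaleR: "smooth f \<Longrightarrow> smooth g \<Longrightarrow> smooth (\<lambda>x. f x *\<^sub>R g x)"
  unfolding smooth_iff_C_inf by (rule C_inf_scaleR)

lemma smooth_inner: "smooth f \<Longrightarrow> smooth g \<Longrightarrow> smooth (\<lambda>x. f x \<bullet> g x)"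
  unfolding smooth_iff_C_inf by (rule C_inf_inner)

lemma smooth_const: "smooth (\<lambda>x. c)"
  unfolding smooth_iff_C_inf by (rule C_inf_const)

lemma smooth_compose: "smooth f \<Longrightarrow> smooth g \<Longrightarrow> smooth (\<lambda>x. f (g x))"
  unfolding smooth_iff_C_inf by (rule C_inf_compose)

lemma smooth_mult: "smooth f \<Longrightarrow> smooth g \<Longrightarrow> smooth (\<lambda>x. f x * g x :: 'a::real_normed_algebra)"
  unfolding smooth_iff_C_inf by (rule C_inf_mult)

lemma smooth_cis: "smooth cis"
  unfolding smooth_iff_C_inf by (rule C_inf_cis)

lemma smooth_shift: "smooth f \<Longrightarrow> smooth (\<lambda>x. f (x + a))"
  by (rule smooth_compose) (simp_all add: smooth_iff_C_inf C_inf_add[OF C_inf_snd C_inf_const])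

lemma C_inf_Re: "C_inf f \<Longrightarrow> C_inf (\<lambda>t \<theta>. Re (f t \<theta>))"
  using C_inf_inner[OF _ C_inf_const[of "1::complex"]] by (simp add: inner_complex_def)

lemma cis_vderiv: "(cis has_vector_derivative \<i> * cis \<theta>) (at \<theta>)"
  using cis_has_vector_derivative[of 1 \<theta> UNIV] by simp

lemma inner_cis [simp]:
  "cis \<theta> \<bullet> cis \<theta> = 1" "(\<i> * cis \<theta>) \<bullet> cis \<theta> = 0" "cis \<theta> \<bullet> (\<i> * cis \<theta>) = 0"
  "(\<i> * cis \<theta>) \<bullet> (\<i> * cis \<theta>) = 1"
  by (simp_all add: inner_complex_def flip: power2_eq_square)

text \<open>The coordinates of \<open>z\<close> in the frame \<open>v\<close>,
  \<open>\<i> * v\<close> are the real and imaginary parts of \<open>z * cnj v\<close>.\<close>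

lemma frame_decomposition:
  assumes "norm v = 1"
  shows "z = (z \<bullet> v) *\<^sub>R v + (z \<bullet> (\<i> * v)) *\<^sub>R (\<i> * v)"
proof -
  have "of_real (z \<bullet> v) + \<i> * of_real (z \<bullet> (\<i> * v)) = z * cnj v"
    by (simp add: complex_eq_iff inner_complex_def)
  moreover have "z = z * cnj v * v"
    using assms complex_norm_square[of v] by (simp add: mult.assoc mult.commute[of "cnj v"])
  moreover have "(z \<bullet> v) *\<^sub>R v + (z \<bullet> (\<i> * v)) *\<^sub>R (\<i> * v)
      = (of_real (z \<bullet> v) + \<i> * of_real (z \<bullet> (\<i> * v))) * v"
    by (simp add: scaleR_conv_of_real algebra_simps)
  ultimately show ?thesis by simp
qed

lemma vderiv_compose:
  assumes "smooth f" "smooth \<sigma>"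
  shows "vderiv (f \<circ> \<sigma>) \<theta> = vderiv \<sigma> \<theta> *\<^sub>R vderiv f (\<sigma> \<theta>)"
  using vderiv_eqI[of "f \<circ> \<sigma>" "\<lambda>\<theta>. vderiv \<sigma> \<theta> *\<^sub>R vderiv f (\<sigma> \<theta>)"]
    vector_diff_chain_at[OF smooth_imp_differentiable[OF assms(2)] smooth_imp_differentiable[OF assms(1)]]
  by simp

lemma circle_reparamD:
  assumes "circle_reparam \<sigma>"
  shows "smooth \<sigma>" "vderiv \<sigma> \<theta> > 0" "\<sigma> (\<theta> + 2 * pi) = \<sigma> \<theta> + 2 * pi" "surj \<sigma>"
proof -
  show "smooth \<sigma>" "\<sigma> (\<theta> + 2 * pi) = \<sigma> \<theta> + 2 * pi" using assms by (auto simp: circle_reparam_def)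
  then show "vderiv \<sigma> \<theta> > 0" using assms deriv_eq_vderiv by (metis circle_reparam_def)
  show "surj \<sigma>" using circle_reparam_inverse[OF assms] by (metis surjI)
qed

lemma beta_compose:
  assumes "smooth \<gamma>" "smooth \<sigma>"
  shows "beta (\<gamma> \<circ> \<sigma>) (\<nu> \<circ> \<sigma>) \<theta> = vderiv \<sigma> \<theta> * beta \<gamma> \<nu> (\<sigma> \<theta>)"
  by (simp add: beta_def vderiv_compose[OF assms])

lemma ell_compose:
  assumes "smooth \<nu>" "smooth \<sigma>"
  shows "ell (\<nu> \<circ> \<sigma>) \<theta> = vderiv \<sigma> \<theta> * ell \<nu> (\<sigma> \<theta>)"
  by (simp add: ell_def vderiv_compose[OF assms])

lemma smooth_rot: "smooth \<nu> \<Longrightarrow> smooth (\<lambda>\<theta>. rot (\<nu> \<theta>))"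
  unfolding rot_def by (intro smooth_mult smooth_const)

lemma smooth_beta: "smooth \<gamma> \<Longrightarrow> smooth \<nu> \<Longrightarrow> smooth (beta \<gamma> \<nu>)"
  unfolding beta_def[abs_def] by (intro smooth_inner smooth_vderiv smooth_rot)

lemma periodic_vderiv': "smooth f \<Longrightarrow> periodic f \<Longrightarrow> periodic (vderiv f)"
  using periodic_vderiv smooth_imp_differentiable by blast

text \<open>Reparametrization multiplies \<open>\<beta>\<close> by the derivative of
  \<open>\<sigma>\<close>, so the integral over a period is unchanged. Hence
  \<open>\<lambda>\<close>, defined through the labels, may be computed in the normal angle.\<close>

lemma algebraic_length_compose:
  assumes "smooth \<gamma>" "smooth \<nu>" "periodic \<gamma>" "periodic \<nu>" "circle_reparam \<sigma>"
  shows "algebraic_length (\<gamma> \<circ> \<sigma>) (\<nu> \<circ> \<sigma>) = algebraic_length \<gamma> \<nu>"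
proof -
  note \<sigma> = circle_reparamD[OF assms(5)]
  have "periodic (beta \<gamma> \<nu>)"
    using periodic_vderiv'[OF assms(1,3)] assms(4) by (simp add: periodic_def beta_def)
  moreover have "continuous_on UNIV (beta \<gamma> \<nu>)"
    by (intro smooth_imp_continuous smooth_beta assms)
  moreover have "(\<sigma> has_vector_derivative vderiv \<sigma> \<theta>) (at \<theta> within {0..2*pi})" for \<theta>
    using smooth_imp_differentiable[OF \<sigma>(1)] by (rule has_vector_derivative_at_within)
  moreover have "\<sigma> (2 * pi) = \<sigma> 0 + 2 * pi" using \<sigma>(3)[of 0] by simp
  ultimately have "((\<lambda>\<theta>. vderiv \<sigma> \<theta> *\<^sub>R beta \<gamma> \<nu> (\<sigma> \<theta>)) has_integral integral {0..2*pi} (beta \<gamma> \<nu>)) {0..2*pi}"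
    by (intro integral_periodic_reparam)
  then have "((\<lambda>\<theta>. beta (\<gamma> \<circ> \<sigma>) (\<nu> \<circ> \<sigma>) \<theta>) has_integral integral {0..2*pi} (beta \<gamma> \<nu>)) {0..2*pi}"
    by (simp add: beta_compose[OF assms(1) \<sigma>(1)])
  then show ?thesis unfolding algebraic_length_def by (rule integral_unique)
qed

lemma ell_cis: "ell cis \<theta> = 1"
  using vderiv_eqI[OF cis_vderiv] by (simp add: ell_def rot_def)

text \<open>Since \<open>\<nu>\<close> has length 1, \<open>\<ell> = 1\<close> means \<open>\<nu>' = i\<nu>\<close>.\<close>

lemma normal_eq_cis:
  assumes "smooth \<nu>" "\<And>\<theta>. norm (\<nu> \<theta>) = 1" "\<And>\<theta>. ell \<nu> \<theta> = 1"
  obtains a where "\<And>\<theta>. \<nu> \<theta> = cis (\<theta> + a)"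
proof -
  have d: "(\<nu> has_vector_derivative vderiv \<nu> \<theta>) (at \<theta>)" for \<theta> by (rule smooth_imp_differentiable[OF assms(1)])
  have "((\<lambda>\<theta>. \<nu> \<theta> \<bullet> \<nu> \<theta>) has_vector_derivative \<nu> \<theta> \<bullet> vderiv \<nu> \<theta> + vderiv \<nu> \<theta> \<bullet> \<nu> \<theta>) (at \<theta>)" for \<theta>
    by (rule bounded_bilinear.has_vector_derivative[OF bounded_bilinear_inner d d])
  moreover have "(\<lambda>\<theta>. \<nu> \<theta> \<bullet> \<nu> \<theta>) = (\<lambda>\<theta>. 1)" using assms(2) by (simp add: dot_square_norm)
  ultimately have "\<nu> \<theta> \<bullet> vderiv \<nu> \<theta> + vderiv \<nu> \<theta> \<bullet> \<nu> \<theta> = 0" for \<theta>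
    using vector_derivative_unique_at has_vector_derivative_const by metis
  then have orth: "vderiv \<nu> \<theta> \<bullet> \<nu> \<theta> = 0" for \<theta> by (simp add: inner_commute)
  have "vderiv \<nu> \<theta> = \<i> * \<nu> \<theta>" for \<theta>
    using frame_decomposition[OF assms(2), of "vderiv \<nu> \<theta>" \<theta>] orth[of \<theta>] assms(3)[of \<theta>]
    by (simp add: ell_def rot_def)
  then have d': "(\<nu> has_vector_derivative \<i> * \<nu> \<theta>) (at \<theta>)" for \<theta> using d by metis
  have "((\<lambda>\<theta>. \<nu> \<theta> * cis (- \<theta>)) has_vector_derivative 0) (at \<theta>)" for \<theta>
    using has_vector_derivative_mult[OF d' cis_has_vector_derivative[of "-1" \<theta> UNIV]] by simp
  then have "\<exists>c. \<forall>\<theta>. \<nu> \<theta> * cis (- \<theta>) = c"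
    using has_vector_derivative_zero_constant[OF convex_UNIV, of "\<lambda>\<theta>. \<nu> \<theta> * cis (- \<theta>)"]
    by (metis UNIV_I)
  then obtain c where c: "\<And>\<theta>. \<nu> \<theta> * cis (- \<theta>) = c" by blast
  have "norm c = 1" using c[of 0] assms(2)[of 0] by simp
  then have "c = cis (Arg c)" using rcis_cmod_Arg[of c] by (simp add: rcis_def)
  then obtain a where a: "c = cis a" by blast
  have "\<nu> \<theta> = \<nu> \<theta> * cis (- \<theta>) * cis \<theta>" for \<theta> by (simp add: mult.assoc cis_mult)
  then have "\<nu> \<theta> = c * cis \<theta>" for \<theta> by (simp only: c)
  then have "\<nu> \<theta> = cis (\<theta> + a)" for \<theta> by (simp add: a cis_mult add.commute)
  then show ?thesis using that by blast
qed

definition support_curve :: "(real \<Rightarrow> real) \<Rightarrow> real \<Rightarrow> complex" where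
  "support_curve p \<theta> = p \<theta> *\<^sub>R cis \<theta> + vderiv p \<theta> *\<^sub>R (\<i> * cis \<theta>)"

lemma support_curve_deriv:
  assumes "smooth p"
  shows "(support_curve p has_vector_derivative (p \<theta> + vderiv (vderiv p) \<theta>) *\<^sub>R (\<i> * cis \<theta>)) (at \<theta>)"
proof -
  note 1 = has_vector_derivative_scaleR[OF smooth_has_real_derivative[OF assms] cis_vderiv, of \<theta>]
  note 2 = has_vector_derivative_scaleR[OF smooth_has_real_derivative[OF smooth_vderiv[OF assms]]
      has_vector_derivative_mult_right[OF cis_vderiv, of \<i>], of \<theta>]
  show ?thesis unfolding support_curve_def[abs_def]
    using has_vector_derivative_add[OF 1 2]
    by (rule has_vector_derivative_eq_rhs) (simp add: scaleR_conv_of_real algebra_simps)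
qed

lemma beta_support_curve:
  assumes "smooth p"
  shows "beta (support_curve p) cis = (\<lambda>\<theta>. p \<theta> + vderiv (vderiv p) \<theta>)"
  unfolding beta_def[abs_def] vderiv_eqI[OF support_curve_deriv[OF assms]] rot_def by simp

text \<open>In the derivative of \<open>G \<theta> \<bullet> cis \<theta>\<close> the term with
  \<open>G'\<close> vanishes by the Legendre condition, so this derivative is the tangential
  coordinate of \<open>G\<close>; decomposing \<open>G\<close> in the moving frame finishes.\<close>

lemma support_representation:
  assumes "smooth G" "\<And>\<theta>. vderiv G \<theta> \<bullet> cis \<theta> = 0"
  shows "smooth (\<lambda>\<theta>. G \<theta> \<bullet> cis \<theta>)" "G = support_curve (\<lambda>\<theta>. G \<theta> \<bullet> cis \<theta>)"
proof -
  show "smooth (\<lambda>\<theta>. G \<theta> \<bullet> cis \<theta>)" by (intro smooth_inner assms smooth_cis)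
  have "vderiv (\<lambda>\<theta>. G \<theta> \<bullet> cis \<theta>) \<theta> = G \<theta> \<bullet> (\<i> * cis \<theta>)" for \<theta>
    using vderiv_eqI[OF bounded_bilinear.has_vector_derivative[OF bounded_bilinear_inner
          smooth_imp_differentiable[OF assms(1)] cis_vderiv]] assms(2) by simp
  then show "G = support_curve (\<lambda>\<theta>. G \<theta> \<bullet> cis \<theta>)"
    unfolding support_curve_def[abs_def] using frame_decomposition[of "cis _"] by auto
qed

lemma velocity_cis:
  assumes "smooth G"
  shows "velocity_curve lam G cis \<theta> = (vderiv (beta G cis) \<theta> / (1 + (beta G cis \<theta>)\<^sup>2)) *\<^sub>R (\<i> * cis \<theta>)
           + (beta G cis \<theta> - lam) *\<^sub>R cis \<theta>" (is ?thesis1)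
    and "velocity_normal lam G cis \<theta> =
           (- (beta G cis \<theta> * vderiv (beta G cis) \<theta> / (1 + (beta G cis \<theta>)\<^sup>2))) *\<^sub>R (\<i> * cis \<theta>)" (is ?thesis2)
proof -
  have "deriv (\<lambda>x. beta G cis x - lam) \<theta> = vderiv (beta G cis) \<theta>"
    using smooth_has_real_derivative[OF smooth_beta[OF assms smooth_cis], of \<theta>]
    by (intro DERIV_imp_deriv) (auto intro!: derivative_eq_intros)
  then show ?thesis1 ?thesis2
    by (simp_all add: velocity_curve_def velocity_normal_def ell_cis rot_def)
qed

text \<open>All rates are nonnegative, so one bound holds for all times. It provides the
  time-independent constants for the vector field of the normal angle.\<close>

lemma heat_series_bound:
  assumes "rapid c" "t \<ge> 0"
  shows "norm (heat_series c t x) \<le> (\<Sum>n. norm (c n))"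
proof -
  have s: "summable (\<lambda>n. norm (heat_term c t x n))"
    using rapid_summable[OF assms(1)] heat_term_norm[OF assms(2)]
    by (intro summable_comparison_test'[OF rapid_summable[OF assms(1)]]) simp
  have "norm (heat_series c t x) \<le> (\<Sum>n. norm (heat_term c t x n))"
    unfolding heat_series_def by (rule summable_norm[OF s])
  also have "\<dots> \<le> (\<Sum>n. norm (c n))"
    by (rule suminf_le[OF _ s rapid_summable[OF assms(1)]]) (rule heat_term_norm[OF assms(2)])
  finally show ?thesis .
qed

lemma has_partials_Re:
  "has_partials f ft fx \<Longrightarrow> has_partials (\<lambda>t \<theta>. Re (f t \<theta>)) (\<lambda>t \<theta>. Re (ft t \<theta>)) (\<lambda>t \<theta>. Re (fx t \<theta>))"
  unfolding has_partials_def case_prod_unfold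
  by (auto intro!: continuous_intros bounded_linear.has_vector_derivative[OF bounded_linear_Re])

text \<open>Complex form of the equation \<open>p\<^sub>t = p'' + p - \<lambda>\<close> for the support function of the evolving curve.\<close>

lemma heat_series_equation:
  assumes c: "rapid c" and t: "t \<ge> 0"
  shows "heat_series (dt_coeff c) t \<theta> =
    heat_series (\<lambda>n. \<i> * of_nat n * (\<i> * of_nat n * c n)) t \<theta> + heat_series c t \<theta> - c 0"
proof -
  let ?c2 = "\<lambda>n. \<i> * of_nat n * (\<i> * of_nat n * c n)" and ?z = "\<lambda>n. if n = 0 then c 0 else 0"
  have c2: "rapid ?c2" by (intro heat_series_has_partials c)
  have z: "rapid ?z" by (rule rapid_finite_support) auto
  have r: "rapid (dt_coeff c)" by (intro heat_series_has_partials c)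
  have "(\<lambda>n. of_real (- rate n) * c n - ?c2 n) = (\<lambda>n. c n - ?z n)"
    by (auto simp: rate_def power2_eq_square algebra_simps)
  then have "heat_series (dt_coeff c) t \<theta> - heat_series ?c2 t \<theta>
      = heat_series (\<lambda>n. c n - ?z n) t \<theta>"
    using heat_series_diff[OF r c2 t, of \<theta>] by (simp only:)
  also have "\<dots> = heat_series c t \<theta> - c 0"
    by (simp only: heat_series_diff[OF c z t] heat_series_const)
  finally have *: "heat_series (dt_coeff c) t \<theta> - heat_series ?c2 t \<theta>
      = heat_series c t \<theta> - c 0" .
  have "x = y + z - w" if "x - y = z - w" for x y z w :: complex using that by (simp add: algebra_simps)
  from this[OF *] show ?thesis .
qed

section \<open>Existence\<close>

text \<open>This bounds the angular velocity \<open>\<beta>\<beta>'/(1 + \<beta>\<^sup>2)\<close> by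
  the absolute value of \<open>\<beta>'\<close>, however large \<open>\<beta>\<close> is.\<close>

lemma abs_div_one_plus_square_le: "\<bar>x * inverse (1 + x\<^sup>2)\<bar> \<le> (1::real)"
proof -
  have "\<bar>x\<bar> \<le> 1 + x\<^sup>2"
    using zero_le_power2[of "\<bar>x\<bar> - 1"] zero_le_power2[of x] by (simp add: power2_diff)
  moreover have "0 < 1 + x\<^sup>2" by (simp add: add_pos_nonneg)
  ultimately show ?thesis by (simp add: abs_mult field_simps)
qed

text \<open>The solution is sought as \<open>G t (\<phi> t u)\<close> with normal
  \<open>cis (\<phi> t u)\<close>, where \<open>G t\<close> is the support curve of the linear
  evolution. The equation for the normal dictates the velocity \<open>w\<close> of
  \<open>\<phi>\<close>. The equation for the curve then holds automatically, since
  \<open>\<beta>' + w\<beta> = \<beta>'/(1 + \<beta>\<^sup>2)\<close>.\<close>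

lemma flow_exists:
  assumes p0: "smooth p\<^sub>0" "periodic p\<^sub>0"
  shows "\<exists>\<gamma> \<nu>. flow_solution (\<lambda>u. support_curve p\<^sub>0 (u + a)) (\<lambda>u. cis (u + a)) \<gamma> \<nu>"
proof -
  define c where "c = real_coeff p\<^sub>0"
  define c1 where "c1 n = \<i> * of_nat n * c n" for n
  define c2 where "c2 n = \<i> * of_nat n * c1 n" for n
  \<comment> \<open>Coefficients of the time derivative of \<open>p\<close>, that is, of
    \<open>\<beta> - \<lambda>\<close>. Representing \<open>\<beta>\<close> as this series plus
    \<open>l\<close>, instead of as \<open>p + p''\<close>, makes its mean visibly equal to
    \<open>l\<close>, because \<open>rate 0 = 0\<close>.\<close>
  define r where "r n = of_real (- rate n) * c n" for n
  define r1 where "r1 n = \<i> * of_nat n * r n" for n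
  define r2 where "r2 n = \<i> * of_nat n * r1 n" for n
  define l where "l = Re (c 0)"
  define P P1 B B1 B2 where "P t x = Re (heat_series c t x)"
    and "P1 t x = Re (heat_series c1 t x)" and "B t x = Re (heat_series r t x) + l"
    and "B1 t x = Re (heat_series r1 t x)" and "B2 t x = Re (heat_series r2 t x)" for t x
  have c: "rapid c" unfolding c_def by (rule rapid_real_coeff[OF p0])
  have c1: "rapid c1" unfolding c1_def by (rule heat_series_has_partials(3)[OF c])
  have c2: "rapid c2" unfolding c2_def by (rule heat_series_has_partials(3)[OF c1])
  have r: "rapid r" unfolding r_def by (rule heat_series_has_partials(2)[OF c])
  have r1: "rapid r1" unfolding r1_def by (rule heat_series_has_partials(3)[OF r])
  have r2: "rapid r2" unfolding r2_def by (rule heat_series_has_partials(3)[OF r1])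
  \<comment> \<open>Symmetry of mixed derivatives on the level of coefficients: the time derivative
    of \<open>p'\<close> is \<open>\<beta>'\<close>.\<close>
  have r1': "r1 = (dt_coeff c1)"
    by (simp add: r1_def r_def c1_def fun_eq_iff)
  have pP: "has_partials P (\<lambda>t x. B t x - l) P1"
    using has_partials_Re[OF heat_series_has_partials(1)[OF c]]
    unfolding r_def[symmetric] c1_def[symmetric] P_def[abs_def] P1_def[abs_def] B_def by simp
  have pP1: "has_partials P1 B1 (\<lambda>t x. Re (heat_series c2 t x))"
    using has_partials_Re[OF heat_series_has_partials(1)[OF c1]]
    unfolding r1'[symmetric] c2_def[symmetric] P1_def[abs_def] B1_def[abs_def] by simp
  have pB: "\<exists>Bt. has_partials B Bt B1"
    using has_partials_add[OF has_partials_Re[OF heat_series_has_partials(1)[OF r]] has_partials_const[of l]]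
    unfolding r1_def[symmetric] B_def[abs_def] B1_def[abs_def] by auto
  have pB1: "\<exists>Bt. has_partials B1 Bt B2"
    using has_partials_Re[OF heat_series_has_partials(1)[OF r1]]
    unfolding r2_def[symmetric] B1_def[abs_def] B2_def[abs_def] by blast
  have smooth: "C_inf P" "C_inf P1" "C_inf B" "C_inf B1"
    unfolding P_def[abs_def] P1_def[abs_def] B_def[abs_def] B1_def[abs_def]
    by (intro C_inf_Re C_inf_heat_series c c1 r r1 C_inf_add C_inf_const)+
  have per: "periodic (B t)" "periodic (B1 t)" "periodic (P t)" "periodic (P1 t)" for t
    using periodic_heat_series unfolding periodic_def B_def B1_def P_def P1_def by auto
  have Px: "vderiv (P t) = P1 t" if "t \<ge> 0" for t
    by (rule vderiv_eqI[OF has_partialsD(3)[OF pP that]])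
  have Pxx: "vderiv (P1 t) = (\<lambda>x. Re (heat_series c2 t x))" if "t \<ge> 0" for t
    by (rule vderiv_eqI[OF has_partialsD(3)[OF pP1 that]])
  have Bx: "(B t has_real_derivative B1 t x) (at x)" "(B1 t has_real_derivative B2 t x) (at x)" if "t \<ge> 0" for t x
    using pB pB1 has_partialsD(3)[OF _ that] by (auto simp: has_real_derivative_iff_has_vector_derivative)
  have B_eq: "P t x + Re (heat_series c2 t x) = B t x" if "t \<ge> 0" for t x
    using heat_series_equation[OF c that, of x] unfolding r_def[symmetric] c1_def[symmetric] c2_def[symmetric]
    by (simp add: B_def P_def l_def)
  have smP: "smooth (P t)" if "t \<ge> 0" for t by (rule C_inf_slice[OF smooth(1) that])
  define G where "G t x = P t x *\<^sub>R cis x + P1 t x *\<^sub>R (\<i> * cis x)" for t x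
  have G_support: "G t = support_curve (P t)" if "t \<ge> 0" for t
    by (simp add: G_def support_curve_def Px[OF that] fun_eq_iff)
  have betaG: "beta (G t) cis = B t" if "t \<ge> 0" for t
    using B_eq[OF that] by (simp add: G_support[OF that] beta_support_curve[OF smP[OF that]] Px[OF that] Pxx[OF that])
  have smG: "C_inf G"
    unfolding G_def[abs_def]
    by (intro C_inf_add C_inf_scaleR C_inf_mult C_inf_const C_inf_cis smooth)
  have Gx: "(G t has_vector_derivative B t x *\<^sub>R (\<i> * cis x)) (at x)" if "t \<ge> 0" for t x
    using support_curve_deriv[OF smP[OF that], of x] B_eq[OF that, of x]
    by (simp add: G_support[OF that] Px[OF that] Pxx[OF that])
  have Gt: "((\<lambda>s. G s x) has_vector_derivative (B t x - l) *\<^sub>R cis x + B1 t x *\<^sub>R (\<i> * cis x)) (at t within {0..})"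
    if "t \<ge> 0" for t x
    unfolding G_def
    using has_partialsD(2)[OF pP that] has_partialsD(2)[OF pP1 that]
    by (auto intro!: derivative_eq_intros simp: has_real_derivative_iff_has_vector_derivative)
  have perG: "periodic (G t)" for t
    using per periodic_cis_int[of 1] by (simp add: periodic_def G_def)
  have pG: "has_partials G (\<lambda>t x. (B t x - l) *\<^sub>R cis x + B1 t x *\<^sub>R (\<i> * cis x)) (\<lambda>t x. B t x *\<^sub>R (\<i> * cis x))"
    unfolding has_partials_def using Gx Gt C_upto_continuous[OF C_infD[OF smG]] by blast
  have G0: "G 0 = support_curve p\<^sub>0"
  proof -
    have "P 0 = p\<^sub>0"
      using fourier_series_real[OF p0] by (simp add: P_def heat_series_def c_def fun_eq_iff)
    then show ?thesis using G_support[of 0] by simp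
  qed
  define q where "q t x = inverse (1 + (B t x)\<^sup>2)" for t x
  define w where "w t x = - (B t x * B1 t x * q t x)" for t x
  have pos: "1 + (B t x)\<^sup>2 > 0" for t x by (simp add: add_pos_nonneg)
  have smw: "C_inf w"
    unfolding w_def[abs_def] q_def power2_eq_square
    by (intro C_inf_uminus C_inf_mult C_inf_inverse C_inf_add C_inf_const smooth)
      (use pos in \<open>simp add: power2_eq_square order.strict_implies_not_eq less_imp_neq[symmetric]\<close>)
  have perw: "periodic (w t)" for t
    using per by (simp add: periodic_def w_def q_def)
  have q_bound: "\<bar>q t x\<bar> \<le> 1" "\<bar>B t x * q t x\<bar> \<le> 1" for t x
    unfolding q_def using abs_div_one_plus_square_le pos[of t x] by (auto simp: field_simps)
  define b1 b2 where "b1 = (\<Sum>n. norm (r1 n))" and "b2 = (\<Sum>n. norm (r2 n))"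
  have B1_bound: "\<bar>B1 t x\<bar> \<le> b1" "\<bar>B2 t x\<bar> \<le> b2" if "t \<ge> 0" for t x
    unfolding B1_def b1_def B2_def b2_def
    using abs_Re_le_cmod heat_series_bound[OF r1 that, of x] heat_series_bound[OF r2 that, of x] order_trans by blast+
  have w_bound: "\<bar>w t x\<bar> \<le> b1" if "t \<ge> 0" for t x
  proof -
    have "\<bar>w t x\<bar> = \<bar>B t x * q t x\<bar> * \<bar>B1 t x\<bar>" by (simp add: w_def abs_mult)
    also have "\<dots> \<le> 1 * b1" by (intro mult_mono q_bound B1_bound that) auto
    finally show ?thesis by simp
  qed
  \<comment> \<open>Arranged in \<open>q\<close> and \<open>B * q\<close>, both bounded by 1, and in
    \<open>B1\<close> and \<open>B2\<close>, both bounded uniformly in time; this yields a Lipschitz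
    constant valid for all times.\<close>
  have wx: "dx w t x = - ((B1 t x)\<^sup>2 * q t x + (B t x * q t x) * B2 t x - 2 * (B t x * q t x)\<^sup>2 * (B1 t x)\<^sup>2)"
    if "t \<ge> 0" for t x
  proof -
    have "(q t has_real_derivative - (2 * B t x * B1 t x * (q t x)\<^sup>2)) (at x)"
      unfolding q_def using Bx[OF that] pos[of t x]
      by (auto intro!: derivative_eq_intros simp: power2_eq_square mult_ac)
    then have "(w t has_real_derivative - ((B1 t x)\<^sup>2 * q t x + (B t x * q t x) * B2 t x - 2 * (B t x * q t x)\<^sup>2 * (B1 t x)\<^sup>2)) (at x)"
      unfolding w_def using Bx[OF that]
      by (auto intro!: derivative_eq_intros simp: power2_eq_square algebra_simps)
    then show ?thesis
      unfolding dx_def vderiv_def has_real_derivative_iff_has_vector_derivative by (rule vector_derivative_at)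
  qed
  have wx_bound: "\<bar>dx w t x\<bar> \<le> b1\<^sup>2 * 1 + 1 * b2 + 2 * 1\<^sup>2 * b1\<^sup>2" if "t \<ge> 0" for t x
  proof -
    have sq: "(B1 t x)\<^sup>2 \<le> b1\<^sup>2" using B1_bound[OF that, of x] by (simp add: abs_le_square_iff[symmetric])
    have "\<bar>dx w t x\<bar> \<le> \<bar>(B1 t x)\<^sup>2 * q t x\<bar> + \<bar>(B t x * q t x) * B2 t x\<bar> + \<bar>2 * (B t x * q t x)\<^sup>2 * (B1 t x)\<^sup>2\<bar>"
      unfolding wx[OF that] by linarith
    also have "\<bar>(B1 t x)\<^sup>2 * q t x\<bar> = (B1 t x)\<^sup>2 * \<bar>q t x\<bar>" by (simp add: abs_mult)
    also have "\<bar>(B t x * q t x) * B2 t x\<bar> = \<bar>B t x * q t x\<bar> * \<bar>B2 t x\<bar>" by (simp add: abs_mult)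
    also have "\<bar>2 * (B t x * q t x)\<^sup>2 * (B1 t x)\<^sup>2\<bar> = 2 * \<bar>B t x * q t x\<bar>\<^sup>2 * (B1 t x)\<^sup>2" by (simp add: abs_mult power_mult_distrib)
    also have "(B1 t x)\<^sup>2 * \<bar>q t x\<bar> + \<bar>B t x * q t x\<bar> * \<bar>B2 t x\<bar> + 2 * \<bar>B t x * q t x\<bar>\<^sup>2 * (B1 t x)\<^sup>2
        \<le> b1\<^sup>2 * 1 + 1 * b2 + 2 * 1\<^sup>2 * b1\<^sup>2"
      by (intro add_mono mult_mono power_mono sq q_bound B1_bound that) auto
    finally show ?thesis .
  qed
  obtain \<phi> where \<phi>: "C_inf \<phi>" "\<And>u. \<phi> 0 u = u + a"
    "\<And>t u. t \<ge> 0 \<Longrightarrow> ((\<lambda>s. \<phi> s u) has_vector_derivative w t (\<phi> t u)) (at t within {0..})"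
    "\<And>t. t \<ge> 0 \<Longrightarrow> circle_reparam (\<phi> t)"
    using flow_map_exists[OF smw perw w_bound wx_bound] by blast
  define \<gamma> where "\<gamma> t u = G t (\<phi> t u)" for t u
  define \<nu> where "\<nu> t u = cis (\<phi> t u)" for t u
  have sm\<gamma>: "C_inf \<gamma>" unfolding \<gamma>_def[abs_def] by (rule C_inf_compose[OF smG \<phi>(1)])
  have sm\<nu>: "C_inf \<nu>" unfolding \<nu>_def[abs_def] by (rule C_inf_compose[OF C_inf_cis \<phi>(1)])
  have per\<gamma>: "periodic (\<gamma> t)" and per\<nu>: "periodic (\<nu> t)" if "t \<ge> 0" for t
    using circle_reparamD(3)[OF \<phi>(4)[OF that]] perG[of t] periodic_cis_int[of 1]
    by (simp_all add: periodic_def \<gamma>_def \<nu>_def)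
  have "flow_solution (\<lambda>u. support_curve p\<^sub>0 (u + a)) (\<lambda>u. cis (u + a)) \<gamma> \<nu>"
    unfolding flow_solution_def Let_def
  proof (intro conjI allI impI)
    show "smooth_family \<gamma>" "smooth_family \<nu>"
      using sm\<gamma> sm\<nu> per\<gamma> per\<nu> by (auto simp: smooth_family_def C_inf_def)
    show "\<gamma> 0 = (\<lambda>u. support_curve p\<^sub>0 (u + a))" "\<nu> 0 = (\<lambda>u. cis (u + a))"
      by (auto simp: \<gamma>_def \<nu>_def \<phi>(2) G0)
    fix t :: real assume t: "0 \<le> t"
    \<comment> \<open>\<open>\<sigma> x\<close> is the label of the point whose normal angle at time
      \<open>t\<close> is \<open>x\<close>, so composing with it turns the moving curve into
      \<open>G t\<close>.\<close>
    obtain \<sigma> where \<sigma>: "circle_reparam \<sigma>" "\<And>x. \<phi> t (\<sigma> x) = x" "\<And>u. \<sigma> (\<phi> t u) = u"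
      by (rule circle_reparam_inverse[OF \<phi>(4)[OF t]]) (rule that)
    have \<gamma>\<sigma>: "\<gamma> t \<circ> \<sigma> = G t" and \<nu>\<sigma>: "\<nu> t \<circ> \<sigma> = cis"
      by (auto simp: \<gamma>_def \<nu>_def \<sigma>(2))
    have "algebraic_length (\<gamma> t) (\<nu> t) = algebraic_length (G t) cis"
      using algebraic_length_compose[OF C_inf_slice[OF sm\<gamma> t] C_inf_slice[OF sm\<nu> t] per\<gamma>[OF t] per\<nu>[OF t] \<sigma>(1)]
      by (simp add: \<gamma>\<sigma> \<nu>\<sigma>)
    also have "\<dots> = 2 * pi * l"
    proof -
      have "((\<lambda>x. Re (heat_series r t x)) has_integral Re (2 * pi * r 0)) {0..2*pi}"
        using has_integral_linear[OF integral_heat_series[OF r t] bounded_linear_Re] by (simp add: o_def)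
      from has_integral_add[OF this has_integral_const_real[of l 0 "2*pi"]]
      have "(B t has_integral 2 * pi * l) {0..2*pi}" by (simp add: B_def[abs_def] r_def rate_def)
      then show ?thesis unfolding algebraic_length_def betaG[OF t] by (rule integral_unique)
    qed
    finally have lam: "algebraic_length (\<gamma> t) (\<nu> t) / (2 * pi) = l" by simp
    have smGt: "smooth (G t)" by (rule C_inf_slice[OF smG t])
    have vB: "vderiv (B t) = B1 t"
      using Bx(1)[OF t] by (intro vderiv_eqI) (simp add: has_real_derivative_iff_has_vector_derivative)
    show "\<exists>\<sigma>. circle_reparam \<sigma> \<and> (\<forall>x. ell (\<nu> t \<circ> \<sigma>) x = 1) \<and>
        (\<forall>x. ((\<lambda>s. \<gamma> s (\<sigma> x)) has_vector_derivative
           velocity_curve (algebraic_length (\<gamma> t) (\<nu> t) / (2 * pi)) (\<gamma> t \<circ> \<sigma>) (\<nu> t \<circ> \<sigma>) x) (at t within {0..})) \<and>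
        (\<forall>x. ((\<lambda>s. \<nu> s (\<sigma> x)) has_vector_derivative
           velocity_normal (algebraic_length (\<gamma> t) (\<nu> t) / (2 * pi)) (\<gamma> t \<circ> \<sigma>) (\<nu> t \<circ> \<sigma>) x) (at t within {0..}))"
      unfolding lam
    proof (intro exI[of _ \<sigma>] conjI allI)
      fix x
      show "ell (\<nu> t \<circ> \<sigma>) x = 1" by (simp add: \<nu>\<sigma> ell_cis)
      have d\<phi>: "((\<lambda>s. \<phi> s (\<sigma> x)) has_vector_derivative w t x) (at t within {0..})"
        using \<phi>(3)[OF t, of "\<sigma> x"] by (simp add: \<sigma>(2))
      have q: "q t x * (1 + (B t x)\<^sup>2) = 1" using pos[of t x] by (simp add: q_def)
      have "((\<lambda>s. \<gamma> s (\<sigma> x)) has_vector_derivative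
          (B t x - l) *\<^sub>R cis x + B1 t x *\<^sub>R (\<i> * cis x) + w t x *\<^sub>R (B t x *\<^sub>R (\<i> * cis x))) (at t within {0..})"
        unfolding \<gamma>_def
        using has_vector_derivative_along_curve[OF pG _ t d\<phi>] C_upto_continuous[OF C_infD[OF smooth(3)]]
        by (simp add: \<sigma>(2) case_prod_unfold continuous_intros)
      \<comment> \<open>Transport by \<open>w\<close> cuts the tangential velocity down, as
        \<open>1 - B\<^sup>2/(1 + B\<^sup>2) = 1/(1 + B\<^sup>2)\<close>.\<close>
      moreover have "B1 t x + w t x * B t x = B1 t x / (1 + (B t x)\<^sup>2)"
        using q pos[of t x] by (simp add: w_def q_def field_simps power2_eq_square)
      then have "(B t x - l) *\<^sub>R cis x + B1 t x *\<^sub>R (\<i> * cis x) + w t x *\<^sub>R (B t x *\<^sub>R (\<i> * cis x))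
          = velocity_curve l (G t) cis x"
        unfolding velocity_cis[OF smGt] betaG[OF t] vB
        by (simp add: add_ac flip: scaleR_add_left)
      ultimately show "((\<lambda>s. \<gamma> s (\<sigma> x)) has_vector_derivative velocity_curve l (\<gamma> t \<circ> \<sigma>) (\<nu> t \<circ> \<sigma>) x) (at t within {0..})"
        by (simp add: \<gamma>\<sigma> \<nu>\<sigma>)
      have "((\<lambda>s. \<nu> s (\<sigma> x)) has_vector_derivative 0 + w t x *\<^sub>R (\<i> * cis x)) (at t within {0..})"
        unfolding \<nu>_def
        using has_vector_derivative_along_curve[of "\<lambda>_. cis" "\<lambda>_ _. 0" "\<lambda>_ x. \<i> * cis x", OF _ _ t d\<phi>] cis_vderiv
        by (simp add: \<sigma>(2) case_prod_unfold continuous_intros has_partials_def)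
      moreover have "w t x *\<^sub>R (\<i> * cis x) = velocity_normal l (G t) cis x"
        unfolding velocity_cis[OF smGt] betaG[OF t] vB by (simp add: w_def q_def divide_inverse)
      ultimately show "((\<lambda>s. \<nu> s (\<sigma> x)) has_vector_derivative velocity_normal l (\<gamma> t \<circ> \<sigma>) (\<nu> t \<circ> \<sigma>) x) (at t within {0..})"
        by (simp add: \<gamma>\<sigma> \<nu>\<sigma>)
    qed (rule \<sigma>(1))
  qed
  then show ?thesis by blast
qed

section \<open>Arbitrary solutions\<close>

lemma vderiv_shift: "vderiv (\<lambda>x. f (x + a)) = (\<lambda>x. vderiv f (x + a))"
  unfolding vderiv_def vector_derivative_def has_vector_derivative_at_shift_iff by simp

lemma deriv_shift:
  fixes f :: "real \<Rightarrow> real"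
  shows "deriv (\<lambda>x. f (x + a)) \<theta> = deriv f (\<theta> + a)"
  unfolding deriv_def DERIV_shift[symmetric] by simp

lemma ell_shift: "ell (\<lambda>x. \<nu> (x + a)) \<theta> = ell \<nu> (\<theta> + a)"
  by (simp add: ell_def vderiv_shift)

lemma beta_shift: "beta (\<lambda>x. \<gamma> (x + a)) (\<lambda>x. \<nu> (x + a)) \<theta> = beta \<gamma> \<nu> (\<theta> + a)"
  by (simp add: beta_def vderiv_shift)

text \<open>A parametrization with \<open>\<ell> = 1\<close> is determined only up to translation;
  by this invariance it can be normalised so that the normal is exactly \<open>cis\<close>.\<close>

lemma velocity_shift:
  "velocity_curve lam (\<lambda>x. \<gamma> (x + a)) (\<lambda>x. \<nu> (x + a)) \<theta> = velocity_curve lam \<gamma> \<nu> (\<theta> + a)"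
  "velocity_normal lam (\<lambda>x. \<gamma> (x + a)) (\<lambda>x. \<nu> (x + a)) \<theta> = velocity_normal lam \<gamma> \<nu> (\<theta> + a)"
  unfolding velocity_curve_def velocity_normal_def ell_shift beta_shift
    deriv_shift[of "\<lambda>x. beta \<gamma> \<nu> x - lam"] by simp_all

lemma circle_reparam_shift:
  assumes "circle_reparam \<sigma>"
  shows "circle_reparam (\<lambda>x. \<sigma> (x + a))"
  using assms unfolding circle_reparam_def
  by (auto simp: deriv_shift add.assoc intro!: smooth_shift) (metis add.assoc add.commute)

lemma periodic_dt:
  assumes f: "C_inf f" and per: "\<And>t. t \<ge> 0 \<Longrightarrow> periodic (f t)" and t: "t \<ge> 0"
  shows "periodic (dt f t)"
  unfolding periodic_def
proof
  fix \<theta>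
  note hp = C_inf_dt_dx(1)[OF f]
  have "((\<lambda>s. f s \<theta>) has_vector_derivative dt f t (\<theta> + 2 * pi)) (at t within {0..})"
    by (rule has_vector_derivative_transform[OF _ _ has_partialsD(2)[OF hp t]])
      (use per t in \<open>auto simp: periodic_def\<close>)
  from vector_derivative_within[OF at_within_atLeast_neq_bot[OF t] this]
  show "dt f t (\<theta> + 2 * pi) = dt f t \<theta>" unfolding dt_def by simp
qed

lemma constant_on_halfline:
  fixes f :: "real \<Rightarrow> 'a::real_normed_vector"
  assumes "\<And>t. t \<ge> 0 \<Longrightarrow> (f has_vector_derivative 0) (at t within {0..})" "t \<ge> 0"
  shows "f t = f 0"
proof -
  obtain c where "\<And>x. x \<in> {0..} \<Longrightarrow> f x = c"
    using has_vector_derivative_zero_constant[of "{0..}" f] assms(1) by auto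
  then show ?thesis using assms(2) by simp
qed

lemma smooth_inverse:
  fixes f :: "real \<Rightarrow> real"
  shows "smooth f \<Longrightarrow> (\<And>x. f x \<noteq> 0) \<Longrightarrow> smooth (\<lambda>x. inverse (f x))"
  unfolding smooth_iff_C_inf by (rule C_inf_inverse)

lemma smooth_frame:
  assumes "smooth A" "smooth B"
  shows "smooth (\<lambda>\<theta>. A \<theta> *\<^sub>R (\<i> * cis \<theta>) + B \<theta> *\<^sub>R cis \<theta>)"
    and "vderiv (\<lambda>\<theta>. A \<theta> *\<^sub>R (\<i> * cis \<theta>) + B \<theta> *\<^sub>R cis \<theta>) \<theta> =
      (vderiv A \<theta> + B \<theta>) *\<^sub>R (\<i> * cis \<theta>) + (vderiv B \<theta> - A \<theta>) *\<^sub>R cis \<theta>" (is ?deriv)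
proof -
  show "smooth (\<lambda>\<theta>. A \<theta> *\<^sub>R (\<i> * cis \<theta>) + B \<theta> *\<^sub>R cis \<theta>)"
    by (intro smooth_add smooth_scaleR smooth_mult smooth_const smooth_cis assms)
  have "((\<lambda>\<theta>. A \<theta> *\<^sub>R (\<i> * cis \<theta>) + B \<theta> *\<^sub>R cis \<theta>) has_vector_derivative
      (vderiv A \<theta> + B \<theta>) *\<^sub>R (\<i> * cis \<theta>) + (vderiv B \<theta> - A \<theta>) *\<^sub>R cis \<theta>) (at \<theta>)" for \<theta>
    using has_vector_derivative_add[OF
        has_vector_derivative_scaleR[OF smooth_has_real_derivative[OF assms(1)] has_vector_derivative_mult_right[OF cis_vderiv, of \<i>]]
        has_vector_derivative_scaleR[OF smooth_has_real_derivative[OF assms(2)] cis_vderiv]]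
    by (rule has_vector_derivative_eq_rhs) (simp add: scaleR_conv_of_real algebra_simps)
  from vderiv_eqI[OF this] show ?deriv by simp
qed

lemma inner_rot [simp]: "v \<bullet> (\<i> * v) = 0" "(\<i> * v) \<bullet> v = 0"
  by (simp_all add: inner_complex_def)

lemma C_inf_cnj: "C_inf f \<Longrightarrow> C_inf (\<lambda>t \<theta>. cnj (f t \<theta>))"
proof -
  assume f: "C_inf f"
  have "C_inf (\<lambda>t \<theta>. of_real (2 * Re (f t \<theta>)) + - f t \<theta>)"
    by (intro C_inf_add C_inf_of_real C_inf_mult C_inf_const C_inf_Re C_inf_uminus f)
  then show ?thesis by (rule C_inf_cong) (simp add: complex_eq_iff)
qed

lemma C_inf_power:
  fixes f :: "real \<Rightarrow> real \<Rightarrow> 'a::real_normed_field"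
  assumes "C_inf f"
  shows "C_inf (\<lambda>t \<theta>. f t \<theta> ^ n)"
  by (induction n) (auto intro: C_inf_const C_inf_mult[OF assms])

lemma has_vector_derivative_power:
  fixes f :: "real \<Rightarrow> 'a::real_normed_field"
  assumes "(f has_vector_derivative f') (at t within S)"
  shows "((\<lambda>x. f x ^ n) has_vector_derivative of_nat n * f' * f t ^ (n - 1)) (at t within S)"
  using has_derivative_power[OF assms[unfolded has_vector_derivative_def], of n]
  unfolding has_vector_derivative_def by (simp add: mult_ac)

locale legendre_flow =
  fixes \<gamma>\<^sub>0 \<nu>\<^sub>0 :: "real \<Rightarrow> complex" and \<gamma> \<nu> :: "real \<Rightarrow> real \<Rightarrow> complex"
  assumes init: "legendre_curve \<gamma>\<^sub>0 \<nu>\<^sub>0" and flow: "flow_solution \<gamma>\<^sub>0 \<nu>\<^sub>0 \<gamma> \<nu>"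
begin

lemma start: "\<gamma> 0 = \<gamma>\<^sub>0" "\<nu> 0 = \<nu>\<^sub>0"
  using flow by (auto simp: flow_solution_def)

lemma C_inf_flow: "C_inf \<gamma>" "C_inf \<nu>"
  using flow by (auto simp: flow_solution_def smooth_family_def C_inf_def)

lemma periodic_flow: "t \<ge> 0 \<Longrightarrow> periodic (\<gamma> t)" "t \<ge> 0 \<Longrightarrow> periodic (\<nu> t)"
  using flow by (auto simp: flow_solution_def smooth_family_def)

lemma smooth_flow: "t \<ge> 0 \<Longrightarrow> smooth (\<gamma> t)" "t \<ge> 0 \<Longrightarrow> smooth (\<nu> t)"
  using C_inf_slice C_inf_flow by auto

definition lam :: "real \<Rightarrow> real" where
  "lam t = algebraic_length (\<gamma> t) (\<nu> t) / (2 * pi)"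

lemma velocity:
  assumes t: "t \<ge> 0"
  obtains \<sigma> where "circle_reparam \<sigma>" "\<And>\<theta>. ell (\<nu> t \<circ> \<sigma>) \<theta> = 1"
    "\<And>\<theta>. dt \<gamma> t (\<sigma> \<theta>) = velocity_curve (lam t) (\<gamma> t \<circ> \<sigma>) (\<nu> t \<circ> \<sigma>) \<theta>"
    "\<And>\<theta>. dt \<nu> t (\<sigma> \<theta>) = velocity_normal (lam t) (\<gamma> t \<circ> \<sigma>) (\<nu> t \<circ> \<sigma>) \<theta>"
proof -
  obtain \<sigma> where \<sigma>: "circle_reparam \<sigma>" "\<And>\<theta>. ell (\<nu> t \<circ> \<sigma>) \<theta> = 1"
    "\<And>\<theta>. ((\<lambda>s. \<gamma> s (\<sigma> \<theta>)) has_vector_derivative velocity_curve (lam t) (\<gamma> t \<circ> \<sigma>) (\<nu> t \<circ> \<sigma>) \<theta>) (at t within {0..})"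
    "\<And>\<theta>. ((\<lambda>s. \<nu> s (\<sigma> \<theta>)) has_vector_derivative velocity_normal (lam t) (\<gamma> t \<circ> \<sigma>) (\<nu> t \<circ> \<sigma>) \<theta>) (at t within {0..})"
    using flow t unfolding flow_solution_def Let_def lam_def by metis
  show ?thesis
    by (rule that[OF \<sigma>(1,2)])
      (simp_all add: dt_def vector_derivative_within[OF at_within_atLeast_neq_bot[OF t] \<sigma>(3)]
        vector_derivative_within[OF at_within_atLeast_neq_bot[OF t] \<sigma>(4)])
qed

text \<open>The velocity of \<open>\<nu>\<close> is a multiple of \<open>rot (\<nu> t u)\<close> and
  hence orthogonal to \<open>\<nu>\<close>, whatever its length, so the squared norm keeps its
  initial value. Unit length has to be known before \<open>\<ell> = 1\<close> can be turned into an
  explicit formula for the normal.\<close>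

lemma norm_normal: "t \<ge> 0 \<Longrightarrow> norm (\<nu> t u) = 1"
proof -
  have "((\<lambda>t. \<nu> t u \<bullet> \<nu> t u) has_vector_derivative 0) (at t within {0..})" if t: "t \<ge> 0" for t
  proof -
    obtain \<sigma> where \<sigma>: "circle_reparam \<sigma>"
      "\<And>\<theta>. dt \<nu> t (\<sigma> \<theta>) = velocity_normal (lam t) (\<gamma> t \<circ> \<sigma>) (\<nu> t \<circ> \<sigma>) \<theta>"
      using velocity[OF t] by metis
    obtain \<theta> where "u = \<sigma> \<theta>" using circle_reparamD(4)[OF \<sigma>(1)] by blast
    then have "dt \<nu> t u \<bullet> \<nu> t u = 0" "\<nu> t u \<bullet> dt \<nu> t u = 0"
      using \<sigma>(2)[of \<theta>] by (auto simp: velocity_normal_def rot_def)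
    moreover have "((\<lambda>t. \<nu> t u \<bullet> \<nu> t u) has_vector_derivative \<nu> t u \<bullet> dt \<nu> t u + dt \<nu> t u \<bullet> \<nu> t u) (at t within {0..})"
      using has_partialsD(2)[OF C_inf_dt_dx(1)[OF C_inf_flow(2)] t]
      by (intro bounded_bilinear.has_vector_derivative[OF bounded_bilinear_inner])
    ultimately show ?thesis by simp
  qed
  moreover assume "t \<ge> 0"
  ultimately have "\<nu> t u \<bullet> \<nu> t u = \<nu> 0 u \<bullet> \<nu> 0 u" by (rule constant_on_halfline)
  also have "\<dots> = 1" using init by (simp add: start legendre_curve_def dot_square_norm)
  finally show ?thesis by (simp add: norm_eq_1)
qed

text \<open>\<open>\<beta>\<close> as a function of the normal angle; \<open>cis\<close> stands for
  the normal after reparametrization.\<close>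

definition speed :: "real \<Rightarrow> (real \<Rightarrow> real) \<Rightarrow> real \<Rightarrow> real" where
  "speed t \<sigma> = beta (\<gamma> t \<circ> \<sigma>) cis"

text \<open>The angular velocity with which the flow turns the normal at the point of normal angle
  \<open>\<theta>\<close>.\<close>

definition spin :: "real \<Rightarrow> (real \<Rightarrow> real) \<Rightarrow> real \<Rightarrow> real" where
  "spin t \<sigma> \<theta> = - (speed t \<sigma> \<theta> * vderiv (speed t \<sigma>) \<theta> * inverse (1 + (speed t \<sigma> \<theta>)\<^sup>2))"

text \<open>Everything the flow equation says at a single time, read at the label whose normal is
  \<open>cis \<theta>\<close>. The \<open>\<sigma>\<close> for different times are
  unrelated.\<close>

definition normal_param :: "real \<Rightarrow> (real \<Rightarrow> real) \<Rightarrow> bool" where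
  "normal_param t \<sigma> \<longleftrightarrow> circle_reparam \<sigma> \<and> (\<forall>\<theta>. \<nu> t (\<sigma> \<theta>) = cis \<theta>) \<and>
     (\<forall>\<theta>. dt \<gamma> t (\<sigma> \<theta>) = (vderiv (speed t \<sigma>) \<theta> * inverse (1 + (speed t \<sigma> \<theta>)\<^sup>2)) *\<^sub>R (\<i> * cis \<theta>)
        + (speed t \<sigma> \<theta> - lam t) *\<^sub>R cis \<theta>) \<and>
     (\<forall>\<theta>. dt \<nu> t (\<sigma> \<theta>) = spin t \<sigma> \<theta> *\<^sub>R (\<i> * cis \<theta>))"

text \<open>The parametrization supplied by the solution has normal
  \<open>cis (\<theta> + a)\<close> by \<open>normal_eq_cis\<close>; translating it by
  \<open>- a\<close> gives the required one.\<close>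

lemma normal_param_exists:
  assumes t: "t \<ge> 0"
  shows "\<exists>\<sigma>. normal_param t \<sigma>"
proof -
  obtain \<tau> where \<tau>: "circle_reparam \<tau>" "\<And>\<theta>. ell (\<nu> t \<circ> \<tau>) \<theta> = 1"
    "\<And>\<theta>. dt \<gamma> t (\<tau> \<theta>) = velocity_curve (lam t) (\<gamma> t \<circ> \<tau>) (\<nu> t \<circ> \<tau>) \<theta>"
    "\<And>\<theta>. dt \<nu> t (\<tau> \<theta>) = velocity_normal (lam t) (\<gamma> t \<circ> \<tau>) (\<nu> t \<circ> \<tau>) \<theta>"
    using velocity[OF t] by metis
  have "smooth (\<nu> t \<circ> \<tau>)"
    using smooth_compose[OF smooth_flow(2)[OF t] circle_reparamD(1)[OF \<tau>(1)]] by (simp add: o_def)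
  moreover have "norm ((\<nu> t \<circ> \<tau>) \<theta>) = 1" for \<theta> using norm_normal[OF t] by simp
  ultimately obtain a where a: "\<And>\<theta>. (\<nu> t \<circ> \<tau>) \<theta> = cis (\<theta> + a)" using normal_eq_cis \<tau>(2) by metis
  define \<sigma> where "\<sigma> \<theta> = \<tau> (\<theta> + (- a))" for \<theta>
  have \<sigma>: "circle_reparam \<sigma>" unfolding \<sigma>_def by (rule circle_reparam_shift[OF \<tau>(1)])
  have \<nu>\<sigma>: "(\<lambda>x. (\<nu> t \<circ> \<tau>) (x + (- a))) = cis" using a by auto
  have \<gamma>\<sigma>: "(\<lambda>x. (\<gamma> t \<circ> \<tau>) (x + (- a))) = \<gamma> t \<circ> \<sigma>" by (auto simp: \<sigma>_def)
  have sm: "smooth (\<gamma> t \<circ> \<sigma>)"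
    using smooth_compose[OF smooth_flow(1)[OF t] circle_reparamD(1)[OF \<sigma>]] by (simp add: o_def)
  have "dt \<gamma> t (\<sigma> \<theta>) = velocity_curve (lam t) (\<gamma> t \<circ> \<sigma>) cis \<theta>"
    "dt \<nu> t (\<sigma> \<theta>) = velocity_normal (lam t) (\<gamma> t \<circ> \<sigma>) cis \<theta>" for \<theta>
    using \<tau>(3)[of "\<theta> + (- a)"] \<tau>(4)[of "\<theta> + (- a)"]
    unfolding velocity_shift[of _ "\<gamma> t \<circ> \<tau>" "- a" "\<nu> t \<circ> \<tau>", symmetric] \<nu>\<sigma> \<gamma>\<sigma> by (simp_all add: \<sigma>_def)
  moreover have "\<nu> t (\<sigma> \<theta>) = cis \<theta>" for \<theta> using fun_cong[OF \<nu>\<sigma>, of \<theta>] by (simp add: \<sigma>_def)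
  ultimately have "normal_param t \<sigma>"
    unfolding normal_param_def spin_def speed_def using \<sigma>
    by (simp add: velocity_cis[OF sm] divide_inverse)
  then show ?thesis by blast
qed

context
  fixes t \<sigma>
  assumes t: "t \<ge> 0" and \<sigma>: "normal_param t \<sigma>"
begin

lemma normal_paramD:
  "circle_reparam \<sigma>" "\<nu> t (\<sigma> \<theta>) = cis \<theta>"
  "dt \<gamma> t (\<sigma> \<theta>) = (vderiv (speed t \<sigma>) \<theta> * inverse (1 + (speed t \<sigma> \<theta>)\<^sup>2)) *\<^sub>R (\<i> * cis \<theta>)
        + (speed t \<sigma> \<theta> - lam t) *\<^sub>R cis \<theta>"
  "dt \<nu> t (\<sigma> \<theta>) = spin t \<sigma> \<theta> *\<^sub>R (\<i> * cis \<theta>)"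
  using \<sigma> by (auto simp: normal_param_def)

lemma smooth_curve: "smooth (\<gamma> t \<circ> \<sigma>)"
  using smooth_compose[OF smooth_flow(1)[OF t] circle_reparamD(1)[OF normal_paramD(1)]] by (simp add: o_def)

lemma smooth_speed: "smooth (speed t \<sigma>)"
  unfolding speed_def by (rule smooth_beta[OF smooth_curve smooth_cis])

lemma one_plus_speed_square_pos: "1 + (speed t \<sigma> \<theta>)\<^sup>2 > 0"
  by (simp add: add_pos_nonneg)

lemma smooth_quotient: "smooth (\<lambda>\<theta>. vderiv (speed t \<sigma>) \<theta> * inverse (1 + (speed t \<sigma> \<theta>)\<^sup>2))"
  unfolding power2_eq_square
  by (intro smooth_mult smooth_vderiv smooth_inverse smooth_add smooth_const smooth_speed)
    (use one_plus_speed_square_pos in \<open>simp add: power2_eq_square order.strict_implies_not_eq less_imp_neq[symmetric]\<close>)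

lemma smooth_spin: "smooth (spin t \<sigma>)"
proof -
  have "smooth (\<lambda>\<theta>. (- 1) * (speed t \<sigma> \<theta> * (vderiv (speed t \<sigma>) \<theta> * inverse (1 + (speed t \<sigma> \<theta>)\<^sup>2))))"
    by (intro smooth_mult smooth_const smooth_speed smooth_quotient)
  then show ?thesis by (simp add: spin_def[abs_def] mult.assoc)
qed

text \<open>A label derivative times the derivative of \<open>\<sigma>\<close> is a derivative in
  the normal angle. As the latter factor is positive, identities between label derivatives may be
  verified in the normal angle.\<close>

lemma dx_reparam:
  assumes "C_inf f"
  shows "vderiv \<sigma> \<theta> *\<^sub>R dx f t (\<sigma> \<theta>) = vderiv (\<lambda>\<theta>. f t (\<sigma> \<theta>)) \<theta>"
  using vderiv_compose[OF C_inf_slice[OF assms t] circle_reparamD(1)[OF normal_paramD(1)]]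
  by (simp add: dx_def o_def)

lemma dx_dt_curve: "vderiv \<sigma> \<theta> *\<^sub>R dx (dt \<gamma>) t (\<sigma> \<theta>) \<bullet> cis \<theta> =
    vderiv (speed t \<sigma>) \<theta> - vderiv (speed t \<sigma>) \<theta> * inverse (1 + (speed t \<sigma> \<theta>)\<^sup>2)"
proof -
  have sm: "smooth (\<lambda>\<theta>. speed t \<sigma> \<theta> - lam t)"
    using smooth_add[OF smooth_speed smooth_const[of "- lam t"]] by simp
  have "vderiv (\<lambda>\<theta>. speed t \<sigma> \<theta> - lam t) \<theta> = vderiv (speed t \<sigma>) \<theta>"
    using smooth_imp_differentiable[OF smooth_speed]
    by (subst vderiv_eqI[of _ "vderiv (speed t \<sigma>)"]) (simp_all add: has_vector_derivative_diff_const)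
  then show ?thesis
    unfolding dx_reparam[OF C_inf_dt_dx(2)[OF C_inf_flow(1)]] normal_paramD(3) smooth_frame(2)[OF smooth_quotient sm]
    by (simp add: inner_add_left)
qed

lemma dx_dt_normal: "vderiv \<sigma> \<theta> *\<^sub>R dx (dt \<nu>) t (\<sigma> \<theta>) \<bullet> (\<i> * cis \<theta>) = vderiv (spin t \<sigma>) \<theta>"
  unfolding dx_reparam[OF C_inf_dt_dx(2)[OF C_inf_flow(2)]] normal_paramD(4)
  using smooth_frame(2)[OF smooth_spin smooth_const[of 0], of \<theta>]
  by (simp add: inner_diff_left vderiv_zero)

lemma dx_normal: "vderiv \<sigma> \<theta> *\<^sub>R dx \<nu> t (\<sigma> \<theta>) = \<i> * cis \<theta>"
  unfolding dx_reparam[OF C_inf_flow(2)] normal_paramD(2) using vderiv_eqI[OF cis_vderiv] by simp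

lemma dx_curve: "vderiv \<sigma> \<theta> *\<^sub>R dx \<gamma> t (\<sigma> \<theta>) \<bullet> (\<i> * cis \<theta>) = speed t \<sigma> \<theta>"
  unfolding dx_reparam[OF C_inf_flow(1)] by (simp add: speed_def beta_def rot_def o_def)

end

text \<open>The velocities are such that \<open>\<langle>\<gamma>', \<nu>\<rangle>\<close> is constant in time.\<close>

lemma legendre_condition:
  assumes "t \<ge> 0"
  shows "dx \<gamma> t u \<bullet> \<nu> t u = 0"
proof -
  have "((\<lambda>t. dx \<gamma> t u \<bullet> \<nu> t u) has_vector_derivative 0) (at t within {0..})" if t: "t \<ge> 0" for t
  proof -
    obtain \<sigma> where \<sigma>: "normal_param t \<sigma>" using normal_param_exists[OF t] by blast
    note np = normal_paramD[OF t \<sigma>]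
    obtain \<theta> where u: "u = \<sigma> \<theta>" using circle_reparamD(4)[OF np(1)] by blast
    \<comment> \<open>In the normal angle the sum is \<open>- \<beta>\<^sup>2\<beta>'/(1 +
      \<beta>\<^sup>2) + \<beta>' - \<beta>'/(1 + \<beta>\<^sup>2)\<close>: the turning of the
      normal exactly compensates the change of the tangent.\<close>
    have "vderiv \<sigma> \<theta> * (dx \<gamma> t u \<bullet> dt \<nu> t u + dx (dt \<gamma>) t u \<bullet> \<nu> t u)
        = spin t \<sigma> \<theta> * (vderiv \<sigma> \<theta> *\<^sub>R dx \<gamma> t (\<sigma> \<theta>) \<bullet> (\<i> * cis \<theta>)) + vderiv \<sigma> \<theta> *\<^sub>R dx (dt \<gamma>) t (\<sigma> \<theta>) \<bullet> cis \<theta>"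
      by (simp add: u np(2,4) algebra_simps)
    also have "\<dots> = 0"
      unfolding dx_curve[OF t \<sigma>] dx_dt_curve[OF t \<sigma>] spin_def
      using one_plus_speed_square_pos[OF t \<sigma>, of \<theta>] by (simp add: field_simps power2_eq_square)
    finally have 0: "dx \<gamma> t u \<bullet> dt \<nu> t u + dx (dt \<gamma>) t u \<bullet> \<nu> t u = 0"
      using circle_reparamD(2)[OF np(1), of \<theta>] by simp
    have "((\<lambda>t. dx \<gamma> t u) has_vector_derivative dx (dt \<gamma>) t u) (at t within {0..})"
      using has_partialsD(2)[OF C_inf_dt_dx(1)[OF C_inf_dt_dx(3)[OF C_inf_flow(1)]] t, of u]
      by (simp add: dt_dx_commute[OF C_inf_flow(1) t])
    from bounded_bilinear.has_vector_derivative[OF bounded_bilinear_inner this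
        has_partialsD(2)[OF C_inf_dt_dx(1)[OF C_inf_flow(2)] t, of u]]
    show ?thesis by (simp add: 0)
  qed
  then have "dx \<gamma> t u \<bullet> \<nu> t u = dx \<gamma> 0 u \<bullet> \<nu> 0 u" using assms by (rule constant_on_halfline)
  also have "\<dots> = 0" using init by (simp add: start dx_def legendre_curve_def)
  finally show ?thesis .
qed

text \<open>In the normal parametrization \<open>\<ell>\<close> is 1, and passing back to labels
  divides it by the positive derivative of \<open>\<sigma>\<close>.\<close>

lemma ell_convex_flow:
  assumes t: "t \<ge> 0"
  shows "ell_convex (\<gamma> t) (\<nu> t)"
proof -
  obtain \<sigma> where \<sigma>: "normal_param t \<sigma>" using normal_param_exists[OF t] by blast
  note np = normal_paramD[OF t \<sigma>]
  note cr = circle_reparamD[OF np(1)]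
  have "ell (\<nu> t) u > 0" for u
  proof -
    obtain \<theta> where u: "u = \<sigma> \<theta>" using cr(4) by blast
    have "\<nu> t \<circ> \<sigma> = cis" using np(2) by auto
    then have "vderiv \<sigma> \<theta> * ell (\<nu> t) u = 1"
      using ell_compose[OF smooth_flow(2)[OF t] cr(1), of \<theta>] by (simp add: u ell_cis)
    then show ?thesis using cr(2)[of \<theta>] by (metis zero_less_mult_pos zero_less_one)
  qed
  moreover have "vderiv (\<gamma> t) u \<bullet> \<nu> t u = 0" for u using legendre_condition[OF t, of u] by (simp add: dx_def)
  ultimately show ?thesis
    using smooth_flow[OF t] periodic_flow[OF t] norm_normal[OF t] by (simp add: ell_convex_def legendre_curve_def)
qed

end

section \<open>Evolution of the Fourier coefficients\<close>

lemma fourier_coeff_add: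
  assumes "continuous_on {0..2*pi} f" "continuous_on {0..2*pi} g"
  shows "fourier_coeff (\<lambda>x. f x + g x) n = fourier_coeff f n + fourier_coeff g n"
  unfolding fourier_coeff_def add_divide_distrib[symmetric] distrib_right
  by (subst integral_add) (auto intro!: integrable_continuous_real continuous_intros assms)

lemma fourier_coeff_const: "fourier_coeff (\<lambda>x. c) n = (if n = 0 then c else 0)"
  using integral_cis_int[of "- n"] by (auto simp: fourier_coeff_def)

lemma fourier_coeff_of_real_0:
  assumes "continuous_on {0..2*pi} f"
  shows "fourier_coeff (\<lambda>x. of_real (f x)) 0 = of_real (integral {0..2*pi} f / (2 * pi))"
proof -
  have "(f has_integral integral {0..2*pi} f) {0..2*pi}"
    by (intro integrable_integral integrable_continuous_real assms)
  from has_integral_linear[OF this bounded_linear_of_real]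
  have "((\<lambda>x. complex_of_real (f x)) has_integral of_real (integral {0..2*pi} f)) {0..2*pi}"
    by (simp add: o_def)
  then show ?thesis by (simp add: fourier_coeff_def o_def integral_unique)
qed

lemma fourier_coeff_second_deriv:
  assumes "smooth p" "periodic p"
  shows "fourier_coeff (\<lambda>x. of_real (vderiv (vderiv p) x)) n = - (of_int n)\<^sup>2 * fourier_coeff (\<lambda>x. of_real (p x)) n"
proof -
  have *: "fourier_coeff (\<lambda>x. of_real (vderiv f x)) n = \<i> * of_int n * fourier_coeff (\<lambda>x. of_real (f x)) n"
    if f: "smooth f" "periodic f" for f
    by (rule fourier_coeff_deriv)
      (use f smooth_has_real_derivative[OF f(1)] smooth_imp_continuous[OF smooth_vderiv[OF f(1)]]
        in \<open>auto simp: periodic_def intro!: has_vector_derivative_of_real continuous_intros\<close>)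
  have "\<i> * x * (\<i> * x * z) = (\<i> * \<i>) * (x\<^sup>2 * z)" for x z :: complex
    by (simp only: power2_eq_square mult_ac)
  then show ?thesis
    unfolding *[OF smooth_vderiv[OF assms(1)] periodic_vderiv'[OF assms]] *[OF assms] by simp
qed

context legendre_flow
begin

text \<open>In the parametrization by the normal angle, the integral of the density over the circle is, up
  to a factor, a Fourier coefficient of the support function.\<close>

definition density :: "nat \<Rightarrow> real \<Rightarrow> real \<Rightarrow> complex" where
  "density n t u = of_real (\<gamma> t u \<bullet> \<nu> t u) * cnj (\<nu> t u) ^ n * of_real (dx \<nu> t u \<bullet> (\<i> * \<nu> t u))"

lemma C_inf_density: "C_inf (density n)"
  unfolding density_def[abs_def]
  by (intro C_inf_mult C_inf_of_real C_inf_inner C_inf_power C_inf_cnj C_inf_const C_inf_flow C_inf_dt_dx)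

lemma periodic_density: "t \<ge> 0 \<Longrightarrow> periodic (density n t)"
  using periodic_flow[of t] periodic_vderiv'[OF smooth_flow(2) periodic_flow(2), of t]
  by (simp add: periodic_def density_def dx_def)

lemma dt_density:
  assumes t: "t \<ge> 0"
  shows "dt (density n) t u =
    of_real (\<gamma> t u \<bullet> \<nu> t u) * cnj (\<nu> t u) ^ n
      * of_real (dx \<nu> t u \<bullet> (\<i> * dt \<nu> t u) + dx (dt \<nu>) t u \<bullet> (\<i> * \<nu> t u))
    + (of_real (\<gamma> t u \<bullet> \<nu> t u) * (of_nat n * cnj (dt \<nu> t u) * cnj (\<nu> t u) ^ (n - 1))
       + of_real (\<gamma> t u \<bullet> dt \<nu> t u + dt \<gamma> t u \<bullet> \<nu> t u) * cnj (\<nu> t u) ^ n)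
      * of_real (dx \<nu> t u \<bullet> (\<i> * \<nu> t u))"
proof -
  have dg: "((\<lambda>s. \<gamma> s u) has_vector_derivative dt \<gamma> t u) (at t within {0..})"
    by (rule has_partialsD(2)[OF C_inf_dt_dx(1)[OF C_inf_flow(1)] t])
  have dn: "((\<lambda>s. \<nu> s u) has_vector_derivative dt \<nu> t u) (at t within {0..})"
    by (rule has_partialsD(2)[OF C_inf_dt_dx(1)[OF C_inf_flow(2)] t])
  have dnx: "((\<lambda>s. dx \<nu> s u) has_vector_derivative dx (dt \<nu>) t u) (at t within {0..})"
    using has_partialsD(2)[OF C_inf_dt_dx(1)[OF C_inf_dt_dx(3)[OF C_inf_flow(2)]] t, of u]
    by (simp add: dt_dx_commute[OF C_inf_flow(2) t])
  note inner = bounded_bilinear.has_vector_derivative[OF bounded_bilinear_inner]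
  note 1 = has_vector_derivative_of_real[OF inner[OF dg dn, folded has_real_derivative_iff_has_vector_derivative]]
  note 2 = has_vector_derivative_power[OF bounded_linear.has_vector_derivative[OF bounded_linear_cnj dn], of n]
  note 3 = has_vector_derivative_of_real[OF inner[OF dnx has_vector_derivative_mult_right[OF dn, of \<i>],
      folded has_real_derivative_iff_has_vector_derivative]]
  from has_vector_derivative_mult[OF has_vector_derivative_mult[OF 1 2] 3]
  show ?thesis
    unfolding dt_def density_def
    by (rule vector_derivative_within[OF at_within_atLeast_neq_bot[OF t]])
qed

definition support :: "real \<Rightarrow> (real \<Rightarrow> real) \<Rightarrow> real \<Rightarrow> real" where
  "support t \<sigma> \<theta> = \<gamma> t (\<sigma> \<theta>) \<bullet> cis \<theta>"

context
  fixes t \<sigma>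
  assumes t: "t \<ge> 0" and \<sigma>: "normal_param t \<sigma>"
begin

lemma support_facts:
  shows "smooth (support t \<sigma>)" "periodic (support t \<sigma>)" "\<gamma> t \<circ> \<sigma> = support_curve (support t \<sigma>)"
    "speed t \<sigma> = (\<lambda>\<theta>. support t \<sigma> \<theta> + vderiv (vderiv (support t \<sigma>)) \<theta>)"
    "vderiv (support t \<sigma>) \<theta> = \<gamma> t (\<sigma> \<theta>) \<bullet> (\<i> * cis \<theta>)"
proof -
  have orth: "vderiv (\<gamma> t \<circ> \<sigma>) \<theta> \<bullet> cis \<theta> = 0" for \<theta>
  proof -
    have "vderiv (\<gamma> t \<circ> \<sigma>) \<theta> = vderiv \<sigma> \<theta> *\<^sub>R dx \<gamma> t (\<sigma> \<theta>)"
      using dx_reparam[OF t \<sigma> C_inf_flow(1), of \<theta>] by (simp add: o_def)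
    then show ?thesis
      using legendre_condition[OF t, of "\<sigma> \<theta>"] by (simp add: normal_paramD(2)[OF t \<sigma>])
  qed
  have eq: "support t \<sigma> = (\<lambda>\<theta>. (\<gamma> t \<circ> \<sigma>) \<theta> \<bullet> cis \<theta>)" by (simp add: support_def fun_eq_iff)
  show 1: "smooth (support t \<sigma>)"
    unfolding eq by (rule support_representation(1)[OF smooth_curve[OF t \<sigma>] orth])
  show 2: "\<gamma> t \<circ> \<sigma> = support_curve (support t \<sigma>)"
    unfolding eq by (rule support_representation(2)[OF smooth_curve[OF t \<sigma>] orth])
  show "speed t \<sigma> = (\<lambda>\<theta>. support t \<sigma> \<theta> + vderiv (vderiv (support t \<sigma>)) \<theta>)"
    unfolding speed_def 2 beta_support_curve[OF 1] ..
  show "periodic (support t \<sigma>)"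
    using circle_reparamD(3)[OF normal_paramD(1)[OF t \<sigma>]] periodic_flow(1)[OF t] periodic_cis_int[of 1]
    by (simp add: periodic_def support_def)
  have "(\<gamma> t \<circ> \<sigma>) \<theta> \<bullet> (\<i> * cis \<theta>) = vderiv (support t \<sigma>) \<theta>"
    unfolding 2 by (simp add: support_curve_def inner_add_left)
  then show "vderiv (support t \<sigma>) \<theta> = \<gamma> t (\<sigma> \<theta>) \<bullet> (\<i> * cis \<theta>)" by simp
qed

lemma normal_speed: "vderiv \<sigma> \<theta> * (dx \<nu> t (\<sigma> \<theta>) \<bullet> (\<i> * cis \<theta>)) = 1"
  using arg_cong[OF dx_normal[OF t \<sigma>, of \<theta>], of "\<lambda>z. z \<bullet> (\<i> * cis \<theta>)"] by simp

lemma cnj_cis_power: "cnj (cis \<theta>) ^ n = cis (- (of_int (int n) * \<theta>))"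
  unfolding cis_cnj Complex.DeMoivre by simp

text \<open>The factor \<open>\<ell>\<close> in the density is the reciprocal of the derivative of
  \<open>\<sigma>\<close>, so the change of variables leaves exactly the integrand of a Fourier
  coefficient.\<close>

lemma density_reparam:
  "vderiv \<sigma> \<theta> *\<^sub>R density n t (\<sigma> \<theta>) = of_real (support t \<sigma> \<theta>) * cis (- (of_int (int n) * \<theta>))"
proof -
  have "vderiv \<sigma> \<theta> *\<^sub>R density n t (\<sigma> \<theta>) =
      of_real (support t \<sigma> \<theta>) * cnj (cis \<theta>) ^ n * of_real (vderiv \<sigma> \<theta> * (dx \<nu> t (\<sigma> \<theta>) \<bullet> (\<i> * cis \<theta>)))"
    by (simp add: density_def support_def normal_paramD(2)[OF t \<sigma>] scaleR_conv_of_real)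
  then show ?thesis unfolding normal_speed cnj_cis_power by simp
qed

lemma integral_reparam:
  fixes f :: "real \<Rightarrow> real \<Rightarrow> complex"
  assumes "C_inf f" "periodic (f t)"
  shows "((\<lambda>\<theta>. vderiv \<sigma> \<theta> *\<^sub>R f t (\<sigma> \<theta>)) has_integral integral {0..2*pi} (f t)) {0..2*pi}"
proof (rule integral_periodic_reparam[OF _ assms(2)])
  note cr = circle_reparamD[OF normal_paramD(1)[OF t \<sigma>]]
  show "continuous_on UNIV (f t)" by (rule smooth_imp_continuous[OF C_inf_slice[OF assms(1) t]])
  show "(\<sigma> has_vector_derivative vderiv \<sigma> \<theta>) (at \<theta> within {0..2*pi})" for \<theta>
    by (rule has_vector_derivative_at_within[OF smooth_imp_differentiable[OF cr(1)]])
  show "\<sigma> (2 * pi) = \<sigma> 0 + 2 * pi" using cr(3)[of 0] by simp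
qed

lemma integral_density:
  "integral {0..2*pi} (density n t) = 2 * pi * fourier_coeff (\<lambda>x. of_real (support t \<sigma> x)) (int n)"
  using integral_unique[OF integral_reparam[OF C_inf_density periodic_density[OF t], of n]]
  unfolding density_reparam fourier_coeff_def by simp

text \<open>The right-hand side is \<open>(\<beta> - \<lambda>)\<close> times the exponential plus
  the full \<open>\<theta>\<close>-derivative of spin times support times the exponential: the
  motion of labels relative to the normal angle enters only through an exact derivative.\<close>

lemma dt_density_reparam:
  "vderiv \<sigma> \<theta> *\<^sub>R dt (density n) t (\<sigma> \<theta>) =
     of_real (speed t \<sigma> \<theta> - lam t) * cis (- (of_int (int n) * \<theta>))
     + (of_real (spin t \<sigma> \<theta> * support t \<sigma> \<theta>) * (\<i> * of_real (- of_int (int n)) * cis (- (of_int (int n) * \<theta>)))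
        + of_real (spin t \<sigma> \<theta> * vderiv (support t \<sigma>) \<theta> + vderiv (spin t \<sigma>) \<theta> * support t \<sigma> \<theta>)
          * cis (- (of_int (int n) * \<theta>)))"
proof -
  note np = normal_paramD[OF t \<sigma>]
  let ?N = "cis (- (of_int (int n) * \<theta>))" and ?p = "support t \<sigma> \<theta>" and ?w = "spin t \<sigma> \<theta>"
  have 1: "dx \<nu> t (\<sigma> \<theta>) \<bullet> (\<i> * dt \<nu> t (\<sigma> \<theta>)) = 0"
  proof -
    have "vderiv \<sigma> \<theta> * (dx \<nu> t (\<sigma> \<theta>) \<bullet> (\<i> * dt \<nu> t (\<sigma> \<theta>))) = (\<i> * cis \<theta>) \<bullet> (\<i> * dt \<nu> t (\<sigma> \<theta>))"
      using dx_normal[OF t \<sigma>, of \<theta>] by (metis inner_scaleR_left)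
    also have "\<dots> = 0" unfolding np(4) by (simp add: inner_complex_def)
    finally show ?thesis using circle_reparamD(2)[OF np(1), of \<theta>] by simp
  qed
  have 2: "vderiv \<sigma> \<theta> * (dx (dt \<nu>) t (\<sigma> \<theta>) \<bullet> (\<i> * cis \<theta>)) = vderiv (spin t \<sigma>) \<theta>"
    using dx_dt_normal[OF t \<sigma>, of \<theta>] by simp
  have 3: "of_nat n * cnj (dt \<nu> t (\<sigma> \<theta>)) * cnj (cis \<theta>) ^ (n - 1) = - (\<i> * of_nat n * of_real ?w * ?N)"
    unfolding np(4) cnj_cis_power[symmetric]
    by (cases n) (simp_all add: scaleR_conv_of_real algebra_simps)
  have 4: "\<gamma> t (\<sigma> \<theta>) \<bullet> dt \<nu> t (\<sigma> \<theta>) = ?w * vderiv (support t \<sigma>) \<theta>"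
    unfolding np(4) by (simp add: support_facts(5))
  have 5: "dt \<gamma> t (\<sigma> \<theta>) \<bullet> cis \<theta> = speed t \<sigma> \<theta> - lam t"
    unfolding np(3) by (simp add: inner_add_left)
  have "vderiv \<sigma> \<theta> *\<^sub>R dt (density n) t (\<sigma> \<theta>) =
      of_real ?p * ?N * of_real (vderiv \<sigma> \<theta> * (dx (dt \<nu>) t (\<sigma> \<theta>) \<bullet> (\<i> * cis \<theta>)))
      + (of_real ?p * - (\<i> * of_nat n * of_real ?w * ?N)
         + of_real (?w * vderiv (support t \<sigma>) \<theta> + (speed t \<sigma> \<theta> - lam t)) * ?N)
        * of_real (vderiv \<sigma> \<theta> * (dx \<nu> t (\<sigma> \<theta>) \<bullet> (\<i> * cis \<theta>)))"
    unfolding dt_density[OF t] np(2) 1 3 4 5 unfolding cnj_cis_power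
    by (simp add: support_def scaleR_conv_of_real algebra_simps)
  also have "\<dots> = of_real ?p * ?N * of_real (vderiv (spin t \<sigma>) \<theta>)
      + (of_real ?p * - (\<i> * of_nat n * of_real ?w * ?N)
         + of_real (?w * vderiv (support t \<sigma>) \<theta> + (speed t \<sigma> \<theta> - lam t)) * ?N)"
    unfolding 2 normal_speed by simp
  finally show ?thesis by (simp add: algebra_simps)
qed

text \<open>\<open>\<lambda>\<close> is the mean of \<open>\<beta> = p + p''\<close>, and
  \<open>p''\<close> has mean zero.\<close>

lemma lam_eq_fourier_coeff: "of_real (lam t) = fourier_coeff (\<lambda>x. of_real (support t \<sigma> x)) 0"
proof -
  note sm = support_facts(1) smooth_vderiv[OF smooth_vderiv[OF support_facts(1)]]
  note c = sm[THEN smooth_imp_continuous]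
  have "\<nu> t \<circ> \<sigma> = cis" using normal_paramD(2)[OF t \<sigma>] by auto
  then have "algebraic_length (\<gamma> t) (\<nu> t) = integral {0..2*pi} (speed t \<sigma>)"
    using algebraic_length_compose[OF smooth_flow[OF t] periodic_flow[OF t] normal_paramD(1)[OF t \<sigma>]]
    by (simp add: algebraic_length_def speed_def)
  then have "of_real (lam t) = fourier_coeff (\<lambda>x. of_real (speed t \<sigma> x)) 0"
    unfolding lam_def by (simp add: fourier_coeff_of_real_0 smooth_imp_continuous[OF smooth_speed[OF t \<sigma>]])
  also have "\<dots> = fourier_coeff (\<lambda>x. of_real (support t \<sigma> x)) 0"
    unfolding support_facts(4) of_real_add
    by (subst fourier_coeff_add)
      (auto intro!: continuous_intros c simp: fourier_coeff_second_deriv[OF support_facts(1,2)])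
  finally show ?thesis .
qed

text \<open>The exact derivative integrates to zero, which leaves the coefficient of
  \<open>p + p'' - \<lambda>\<close>. For \<open>n \<ge> 1\<close> this is
  \<open>1 - n\<^sup>2\<close> times that of \<open>p\<close>; for \<open>n = 0\<close> the mean
  cancels against \<open>\<lambda>\<close>. This is the origin of \<open>rate\<close>.\<close>

lemma integral_dt_density:
  "integral {0..2*pi} (dt (density n) t) = of_real (- rate n) * integral {0..2*pi} (density n t)"
proof -
  let ?N = "\<lambda>\<theta>. cis (- (of_int (int n) * \<theta>))"
  note sm = support_facts(1) smooth_vderiv[OF smooth_vderiv[OF support_facts(1)]] smooth_speed[OF t \<sigma>] smooth_spin[OF t \<sigma>]
  note c = sm[THEN smooth_imp_continuous]
  let ?f = "\<lambda>\<theta>. of_real (spin t \<sigma> \<theta> * support t \<sigma> \<theta>) * ?N \<theta>"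
  let ?f' = "\<lambda>\<theta>. of_real (spin t \<sigma> \<theta> * support t \<sigma> \<theta>) * (\<i> * of_real (- of_int (int n)) * ?N \<theta>)
        + of_real (spin t \<sigma> \<theta> * vderiv (support t \<sigma>) \<theta> + vderiv (spin t \<sigma>) \<theta> * support t \<sigma> \<theta>) * ?N \<theta>"
  have "(?f has_vector_derivative ?f' \<theta>) (at \<theta>)" for \<theta>
    using has_vector_derivative_mult[OF has_vector_derivative_of_real[OF
          DERIV_mult'[OF smooth_has_real_derivative[OF sm(4)] smooth_has_real_derivative[OF sm(1)]]]
        cis_has_vector_derivative[of "- of_int (int n)"]]
    by simp
  moreover have "periodic ?f"
  proof -
    have "periodic (speed t \<sigma>)"
      using support_facts(2) periodic_vderiv'[OF smooth_vderiv[OF support_facts(1)] periodic_vderiv'[OF support_facts(1,2)]]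
      by (simp add: periodic_def support_facts(4))
    then have "periodic (spin t \<sigma>)"
      using periodic_vderiv'[OF sm(3)] by (simp add: periodic_def spin_def)
    then show ?thesis using support_facts(2) periodic_cis_int[of "- int n"] by (simp add: periodic_def)
  qed
  ultimately have f': "(?f' has_integral 0) {0..2*pi}" by (rule integral_deriv_periodic)
  have "((\<lambda>\<theta>. of_real (speed t \<sigma> \<theta> - lam t) * ?N \<theta>) has_integral
      2 * pi * fourier_coeff (\<lambda>x. of_real (speed t \<sigma> x - lam t)) (int n)) {0..2*pi}"
    using integrable_integral[OF integrable_continuous_real, of 0 "2*pi" "\<lambda>\<theta>. of_real (speed t \<sigma> \<theta> - lam t) * ?N \<theta>"]
    by (simp add: fourier_coeff_def continuous_intros c)
  from has_integral_add[OF this f']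
  have "((\<lambda>\<theta>. vderiv \<sigma> \<theta> *\<^sub>R dt (density n) t (\<sigma> \<theta>)) has_integral
      2 * pi * fourier_coeff (\<lambda>x. of_real (speed t \<sigma> x - lam t)) (int n)) {0..2*pi}"
    unfolding dt_density_reparam by simp
  from has_integral_unique[OF integral_reparam[OF C_inf_dt_dx(2)[OF C_inf_density]
        periodic_dt[OF C_inf_density periodic_density t]] this]
  have "integral {0..2*pi} (dt (density n) t) = 2 * pi * fourier_coeff (\<lambda>x. of_real (speed t \<sigma> x - lam t)) (int n)" .
  also have "(\<lambda>x. complex_of_real (speed t \<sigma> x - lam t)) =
      (\<lambda>x. (of_real (support t \<sigma> x) + of_real (vderiv (vderiv (support t \<sigma>)) x)) + - of_real (lam t))"
    by (simp add: support_facts(4))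
  also have "fourier_coeff \<dots> (int n) = (fourier_coeff (\<lambda>x. of_real (support t \<sigma> x)) (int n)
      + - (of_int (int n))\<^sup>2 * fourier_coeff (\<lambda>x. of_real (support t \<sigma> x)) (int n))
      + (if int n = 0 then - of_real (lam t) else 0)"
    unfolding fourier_coeff_second_deriv[OF support_facts(1,2), symmetric] fourier_coeff_const[symmetric]
    by (subst fourier_coeff_add, (intro continuous_intros c)+, subst fourier_coeff_add)
       (auto intro!: continuous_intros c)
  also have "\<dots> = of_real (- rate n) * fourier_coeff (\<lambda>x. of_real (support t \<sigma> x)) (int n)"
    by (auto simp: rate_def lam_eq_fourier_coeff algebra_simps)
  finally show ?thesis unfolding integral_density by (simp add: mult_ac)
qed

end

text \<open>At each time \<open>integral_dt_density\<close> is applied with a parametrization chosen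
  for that time alone. The resulting linear equation no longer mentions it and is solved by an
  integrating factor.\<close>

lemma integral_density_decay:
  assumes "t \<ge> 0"
  shows "integral {0..2*pi} (density n t) = of_real (exp (- rate n * t)) * integral {0..2*pi} (density n 0)"
proof -
  define H where "H t = integral {0..2*pi} (density n t)" for t
  have dH: "(H has_vector_derivative of_real (- rate n) * H t) (at t within {0..})" if t: "t \<ge> 0" for t
  proof -
    obtain \<sigma> where \<sigma>: "normal_param t \<sigma>" using normal_param_exists[OF t] by blast
    note hp = C_inf_dt_dx(1)[OF C_inf_density[of n]]
    have "((\<lambda>t. integral (cbox 0 (2*pi)) (density n t)) has_vector_derivative
        integral (cbox 0 (2*pi)) (dt (density n) t)) (at t within {0..})"
    proof (rule leibniz_rule_vector_derivative)
      show "((\<lambda>t. density n t u) has_vector_derivative dt (density n) t u) (at t within {0..})" if "t \<in> {0..}" for t u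
        using has_partialsD(2)[OF hp] that by simp
      show "density n t integrable_on cbox 0 (2*pi)" if "t \<in> {0..}" for t
        using that by (intro integrable_continuous smooth_imp_continuous C_inf_slice[OF C_inf_density]) simp
      show "continuous_on ({0..} \<times> cbox 0 (2 * pi)) (\<lambda>(t, u). dt (density n) t u)"
        by (rule continuous_on_subset[OF C_upto_continuous[OF C_infD[OF C_inf_dt_dx(2)[OF C_inf_density]]]]) auto
    qed (use t in auto)
    then show ?thesis
      using integral_dt_density[OF t \<sigma>, of n] by (simp add: H_def[abs_def])
  qed
  have "((\<lambda>t. of_real (exp (rate n * t)) * H t) has_vector_derivative 0) (at t within {0..})" if t: "t \<ge> 0" for t
  proof -
    have "((\<lambda>t. exp (rate n * t)) has_field_derivative rate n * exp (rate n * t)) (at t within {0..})"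
      by (auto intro!: derivative_eq_intros)
    from has_vector_derivative_mult[OF has_vector_derivative_of_real[OF this] dH[OF t]]
    show ?thesis by (simp add: algebra_simps)
  qed
  from constant_on_halfline[OF this assms]
  have "of_real (exp (rate n * t)) * H t = H 0" by simp
  then have "of_real (exp (- rate n * t)) * (of_real (exp (rate n * t)) * H t) = of_real (exp (- rate n * t)) * H 0" by simp
  then have "of_real (exp (- rate n * t) * exp (rate n * t)) * H t = of_real (exp (- rate n * t)) * H 0" by (simp only: of_real_mult mult.assoc)
  then show ?thesis by (simp add: H_def flip: exp_add)
qed

text \<open>Defined by integrals over labels at \<open>t = 0\<close>, hence independent of any
  normal parametrization; the prefactors match those of \<open>real_coeff\<close>.\<close>

definition coeff :: "nat \<Rightarrow> complex" where
  "coeff n = (if n = 0 then 1 else 2) * integral {0..2*pi} (density n 0) / (2 * pi)"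

lemma real_coeff_support:
  assumes "t \<ge> 0" "normal_param t \<sigma>"
  shows "real_coeff (support t \<sigma>) n = coeff n * of_real (exp (- rate n * t))"
proof -
  have "fourier_coeff (\<lambda>x. of_real (support t \<sigma> x)) (int n) = integral {0..2*pi} (density n t) / (2 * pi)"
    unfolding integral_density[OF assms] by simp
  then show ?thesis by (simp add: integral_density_decay[OF assms(1)] real_coeff_def coeff_def)
qed

lemma rapid_coeff: "rapid coeff"
proof -
  obtain \<sigma> where \<sigma>: "normal_param 0 \<sigma>" using normal_param_exists[of 0] by blast
  have "real_coeff (support 0 \<sigma>) = coeff" using real_coeff_support[OF _ \<sigma>] by (simp add: fun_eq_iff)
  then show ?thesis using rapid_real_coeff support_facts(1,2)[OF order_refl \<sigma>] by metis
qed

lemma support_eq_heat_series: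
  assumes "t \<ge> 0" "normal_param t \<sigma>"
  shows "support t \<sigma> = (\<lambda>x. Re (heat_series coeff t x))"
proof
  fix x
  show "support t \<sigma> x = Re (heat_series coeff t x)"
    using fourier_series_real[OF support_facts(1,2)[OF assms], of x]
    by (simp add: heat_series_def real_coeff_support[OF assms])
qed

lemma algebraic_length_flow:
  assumes "t \<ge> 0"
  shows "algebraic_length (\<gamma> t) (\<nu> t) = 2 * pi * Re (coeff 0)"
proof -
  obtain \<sigma> where \<sigma>: "normal_param t \<sigma>" using normal_param_exists[OF assms] by blast
  have "of_real (lam t) = real_coeff (support t \<sigma>) 0"
    using lam_eq_fourier_coeff[OF assms \<sigma>] by (simp add: real_coeff_def)
  then have "of_real (lam t) = coeff 0" by (simp add: real_coeff_support[OF assms \<sigma>] rate_def)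
  then have "lam t = Re (coeff 0)" by (metis Re_complex_of_real)
  then show ?thesis by (simp add: lam_def field_simps)
qed

end

section \<open>Convergence\<close>

text \<open>Uniform convergence of the derivatives up to order \<open>k\<close>, with derivatives as
  witnesses. Sums and products with \<open>cis\<close> can then be treated by induction on
  \<open>k\<close>, without formulas for iterated derivatives of products.\<close>

primrec conv_upto :: "nat \<Rightarrow> (real \<Rightarrow> real \<Rightarrow> 'a::real_normed_vector) \<Rightarrow> (real \<Rightarrow> 'a) \<Rightarrow> bool" where
  "conv_upto 0 f g \<longleftrightarrow> uniform_limit UNIV f g at_top"
| "conv_upto (Suc k) f g \<longleftrightarrow> uniform_limit UNIV f g at_top \<and>
     (\<exists>f' g'. (\<forall>t\<ge>0. \<forall>x. (f t has_vector_derivative f' t x) (at x)) \<and>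
        (\<forall>x. (g has_vector_derivative g' x) (at x)) \<and> conv_upto k f' g')"

declare conv_upto.simps(2) [simp del]

lemma conv_upto_uniform_limit: "conv_upto k f g \<Longrightarrow> uniform_limit UNIV f g at_top"
  by (cases k) (auto simp: conv_upto.simps(2))

lemma conv_upto_SucD: "conv_upto (Suc k) f g \<Longrightarrow> conv_upto k f g"
proof (induction k arbitrary: f g)
  case 0
  then show ?case using conv_upto_uniform_limit[of "Suc 0"] by simp
next
  case (Suc k)
  then show ?case unfolding conv_upto.simps(2)[of "Suc k"] conv_upto.simps(2)[of k] by blast
qed

lemma conv_upto_add:
  assumes "conv_upto k f g" "conv_upto k f2 g2"
  shows "conv_upto k (\<lambda>t x. f t x + f2 t x) (\<lambda>x. g x + g2 x)"
  using assms
proof (induction k arbitrary: f g f2 g2)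
  case 0
  then show ?case by (auto intro: uniform_limit_add)
next
  case (Suc k)
  from Suc.prems(1) obtain f' g' where 1: "uniform_limit UNIV f g at_top"
    "\<And>t x. t \<ge> 0 \<Longrightarrow> (f t has_vector_derivative f' t x) (at x)" "\<And>x. (g has_vector_derivative g' x) (at x)"
    "conv_upto k f' g'" unfolding conv_upto.simps(2) by blast
  from Suc.prems(2) obtain f2' g2' where 2: "uniform_limit UNIV f2 g2 at_top"
    "\<And>t x. t \<ge> 0 \<Longrightarrow> (f2 t has_vector_derivative f2' t x) (at x)" "\<And>x. (g2 has_vector_derivative g2' x) (at x)"
    "conv_upto k f2' g2'" unfolding conv_upto.simps(2) by blast
  show ?case
    unfolding conv_upto.simps(2)
  proof (intro conjI exI allI impI)
    show "uniform_limit UNIV (\<lambda>t x. f t x + f2 t x) (\<lambda>x. g x + g2 x) at_top"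
      by (rule uniform_limit_add[OF 1(1) 2(1)])
    show "conv_upto k (\<lambda>t x. f' t x + f2' t x) (\<lambda>x. g' x + g2' x)" by (rule Suc.IH[OF 1(4) 2(4)])
  qed (intro has_vector_derivative_add 1(2,3) 2(2,3); assumption)+
qed

lemma uniform_limit_scaleR_cis:
  fixes f :: "real \<Rightarrow> real \<Rightarrow> real"
  assumes "uniform_limit UNIV f g at_top"
  shows "uniform_limit UNIV (\<lambda>t x. f t x *\<^sub>R (a * cis x)) (\<lambda>x. g x *\<^sub>R (a * cis x)) at_top"
proof (rule uniform_limitI)
  fix e :: real assume "0 < e"
  \<comment> \<open>Adding 1 to the norm avoids a division by zero for \<open>a = 0\<close>.\<close>
  then have "0 < e / (norm a + 1)" by (simp add: add_nonneg_pos)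
  with assms have "\<forall>\<^sub>F t in at_top. \<forall>x\<in>UNIV. dist (f t x) (g x) < e / (norm a + 1)"
    unfolding uniform_limit_iff by blast
  then show "\<forall>\<^sub>F t in at_top. \<forall>x\<in>UNIV. dist (f t x *\<^sub>R (a * cis x)) (g x *\<^sub>R (a * cis x)) < e"
  proof eventually_elim
    case (elim t)
    show ?case
    proof
      fix x :: real
      have "dist (f t x *\<^sub>R (a * cis x)) (g x *\<^sub>R (a * cis x)) = dist (f t x) (g x) * norm a"
        by (simp add: dist_norm norm_mult flip: scaleR_diff_left)
      also have "\<dots> \<le> dist (f t x) (g x) * (norm a + 1)" by (intro mult_left_mono) auto
      also have "\<dots> < e"
        using elim by (simp add: pos_less_divide_eq add_nonneg_pos)
      finally show "dist (f t x *\<^sub>R (a * cis x)) (g x *\<^sub>R (a * cis x)) < e" .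
    qed
  qed
qed

lemma conv_upto_scaleR_cis:
  fixes f :: "real \<Rightarrow> real \<Rightarrow> real"
  assumes "conv_upto k f g"
  shows "conv_upto k (\<lambda>t x. f t x *\<^sub>R (a * cis x)) (\<lambda>x. g x *\<^sub>R (a * cis x))"
  using assms
\<comment> \<open>\<open>a\<close> is generalised because differentiating \<open>cis\<close>
  replaces it by \<open>a * \<i>\<close>.\<close>
proof (induction k arbitrary: f g a)
  case 0
  then show ?case using uniform_limit_scaleR_cis by simp
next
  case (Suc k)
  from Suc.prems obtain f' g' where f': "uniform_limit UNIV f g at_top"
    "\<And>t x. t \<ge> 0 \<Longrightarrow> (f t has_vector_derivative f' t x) (at x)" "\<And>x. (g has_vector_derivative g' x) (at x)"
    "conv_upto k f' g'" unfolding conv_upto.simps(2) by blast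
  have der: "((\<lambda>x. h x *\<^sub>R (a * cis x)) has_vector_derivative h x *\<^sub>R ((a * \<i>) * cis x) + h' *\<^sub>R (a * cis x)) (at x)"
    if "(h has_vector_derivative h') (at x)" for h h' x
    using has_vector_derivative_scaleR[OF that[folded has_real_derivative_iff_has_vector_derivative]
        has_vector_derivative_mult_right[OF cis_vderiv, of a]] by (simp add: mult.assoc)
  show ?case
    unfolding conv_upto.simps(2)
  proof (intro conjI exI allI impI)
    show "uniform_limit UNIV (\<lambda>t x. f t x *\<^sub>R (a * cis x)) (\<lambda>x. g x *\<^sub>R (a * cis x)) at_top" by (rule uniform_limit_scaleR_cis[OF f'(1)])
    show "conv_upto k (\<lambda>t x. f t x *\<^sub>R ((a * \<i>) * cis x) + f' t x *\<^sub>R (a * cis x))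
        (\<lambda>x. g x *\<^sub>R ((a * \<i>) * cis x) + g' x *\<^sub>R (a * cis x))"
      by (intro conv_upto_add Suc.IH conv_upto_SucD[OF Suc.prems] f'(4))
  qed (auto intro: der f'(2,3))
qed

lemma conv_upto_vderiv:
  assumes "conv_upto k f g"
  shows "uniform_limit UNIV (\<lambda>t. (vderiv ^^ k) (f t)) ((vderiv ^^ k) g) at_top"
  using assms
proof (induction k arbitrary: f g)
  case 0
  then show ?case by simp
next
  case (Suc k)
  from Suc.prems obtain f' g' where f': "\<And>t x. t \<ge> 0 \<Longrightarrow> (f t has_vector_derivative f' t x) (at x)"
    "\<And>x. (g has_vector_derivative g' x) (at x)" "conv_upto k f' g'" unfolding conv_upto.simps(2) by blast
  have "uniform_limit UNIV (\<lambda>t. (vderiv ^^ k) (f' t)) ((vderiv ^^ k) g') at_top" by (rule Suc.IH[OF f'(3)])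
  moreover have "\<forall>\<^sub>F t in at_top. (vderiv ^^ k) (f' t) = (vderiv ^^ Suc k) (f t)"
    using eventually_ge_at_top[of 0]
    by eventually_elim (simp add: funpow_Suc_right vderiv_eqI[OF f'(1)] del: funpow.simps)
  then have "\<forall>\<^sub>F t in at_top. \<forall>x\<in>UNIV. (vderiv ^^ k) (f' t) x = (vderiv ^^ Suc k) (f t) x"
    by eventually_elim simp
  moreover have "(vderiv ^^ k) g' = (vderiv ^^ Suc k) g"
    by (simp add: funpow_Suc_right vderiv_eqI[OF f'(2)] del: funpow.simps)
  ultimately show ?case
    using uniform_limit_cong[where h = "(vderiv ^^ k) g'" and i = "(vderiv ^^ Suc k) g"
        and f = "\<lambda>t. (vderiv ^^ k) (f' t)" and g = "\<lambda>t. (vderiv ^^ Suc k) (f t)" and X = UNIV and F = at_top]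
    by simp
qed

text \<open>The modes 0 and 1 have rate 0 and stay. All others have rate at least 3, so the rest of
  the series is bounded, uniformly in \<open>x\<close>, by a multiple of
  \<open>exp (- 3 * t)\<close>.\<close>

lemma heat_series_limit:
  assumes c: "rapid c"
  shows "uniform_limit UNIV (\<lambda>t x. Re (heat_series c t x)) (\<lambda>x. Re (c 0 + c 1 * cis x)) at_top"
proof (rule uniform_limitI)
  fix e :: real assume "0 < e"
  define M where "M = (\<Sum>n. norm (c n))"
  have "((\<lambda>t. M * exp (- 3 * t)) \<longlongrightarrow> 0) at_top" by real_asymp
  then have "\<forall>\<^sub>F t in at_top. M * exp (- 3 * t) < e" using \<open>0 < e\<close> by (auto dest: order_tendstoD)
  then show "\<forall>\<^sub>F t in at_top. \<forall>x\<in>UNIV. dist (Re (heat_series c t x)) (Re (c 0 + c 1 * cis x)) < e"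
    using eventually_ge_at_top[of 0]
  proof eventually_elim
    case (elim t)
    show ?case
    proof
      fix x :: real
      let ?a = "heat_term c t x"
      have s: "summable ?a" by (rule heat_series_summable[OF c elim(2)])
      have sn: "summable (\<lambda>n. norm (c n))" by (rule rapid_summable[OF c])
      have le: "norm (?a (n + 2)) \<le> norm (c (n + 2)) * exp (- 3 * t)" for n
      proof -
        have "3 * t \<le> rate (n + 2) * t" using rate_ge[of "n + 2"] elim(2) by (intro mult_right_mono) auto
        then show ?thesis by (auto simp: norm_mult intro!: mult_left_mono)
      qed
      have s2: "summable (\<lambda>n. norm (c (n + 2)) * exp (- 3 * t))"
        using sn by (intro summable_mult2 summable_ignore_initial_segment)
      have s1: "summable (\<lambda>n. norm (?a (n + 2)))"
        by (rule summable_comparison_test'[OF s2]) (use le in simp)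
      have "heat_series c t x = (\<Sum>n. ?a (n + 2)) + (\<Sum>n<2. ?a n)"
        unfolding heat_series_def by (rule suminf_split_initial_segment[OF s])
      also have "(\<Sum>n<2. ?a n) = c 0 + c 1 * cis x" by (simp add: numeral_2_eq_2 rate_def)
      finally have "dist (Re (heat_series c t x)) (Re (c 0 + c 1 * cis x)) \<le> norm (\<Sum>n. ?a (n + 2))"
        using abs_Re_le_cmod by (simp add: dist_real_def)
      also have "\<dots> \<le> (\<Sum>n. norm (?a (n + 2)))" by (rule summable_norm[OF s1])
      also have "\<dots> \<le> (\<Sum>n. norm (c (n + 2)) * exp (- 3 * t))" by (rule suminf_le[OF le s1 s2])
      also have "\<dots> = (\<Sum>n. norm (c (n + 2))) * exp (- 3 * t)"
        using summable_ignore_initial_segment[OF sn, of 2] by (simp add: suminf_mult2)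
      also have "\<dots> \<le> M * exp (- 3 * t)"
        using suminf_split_initial_segment[OF sn, of 2] by (intro mult_right_mono) (auto simp: M_def sum_nonneg)
      finally show "dist (Re (heat_series c t x)) (Re (c 0 + c 1 * cis x)) < e" using elim(1) by linarith
    qed
  qed
qed

lemma conv_upto_heat_series:
  assumes "rapid c"
  shows "conv_upto k (\<lambda>t x. Re (heat_series c t x)) (\<lambda>x. Re (c 0 + c 1 * cis x))"
  using assms
proof (induction k arbitrary: c)
  case 0
  then show ?case using heat_series_limit by simp
next
  case (Suc k)
  let ?d = "dx_coeff c"
  have d: "rapid ?d" by (rule heat_series_has_partials(3)[OF Suc.prems])
  have "conv_upto k (\<lambda>t x. Re (heat_series ?d t x)) (\<lambda>x. Re (?d 0 + ?d 1 * cis x))" by (rule Suc.IH[OF d])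
  moreover have "((\<lambda>x. Re (heat_series c t x)) has_vector_derivative Re (heat_series ?d t x)) (at x)" if "t \<ge> 0" for t x
    by (rule has_partialsD(3)[OF has_partials_Re[OF heat_series_has_partials(1)[OF Suc.prems]] that])
  moreover have "((\<lambda>x. Re (c 0 + c 1 * cis x)) has_vector_derivative Re (?d 0 + ?d 1 * cis x)) (at x)" for x
    using bounded_linear.has_vector_derivative[OF bounded_linear_Re
        has_vector_derivative_add[OF has_vector_derivative_const has_vector_derivative_mult_right[OF cis_vderiv, of "c 1"]]]
    by (simp add: mult_ac)
  ultimately show ?case
    unfolding conv_upto.simps(2) using heat_series_limit[OF Suc.prems]
    by (intro conjI exI[of _ "\<lambda>t x. Re (heat_series ?d t x)"] exI[of _ "\<lambda>x. Re (?d 0 + ?d 1 * cis x)"])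
      simp_all
qed

text \<open>The limiting support function \<open>Re (c 0 + c 1 * cis x)\<close> equals
  \<open>Re (c 0)\<close> plus the inner product of \<open>cnj (c 1)\<close> with
  \<open>cis x\<close>: a circle of radius \<open>Re (c 0)\<close> translated by
  \<open>cnj (c 1)\<close>.\<close>

lemma conv_upto_support_curve:
  assumes "rapid c"
  shows "conv_upto k (\<lambda>t x. Re (heat_series c t x) *\<^sub>R cis x
      + Re (heat_series (dx_coeff c) t x) *\<^sub>R (\<i> * cis x))
    (\<lambda>x. cnj (c 1) + Re (c 0) *\<^sub>R cis x)"
proof -
  let ?d = "dx_coeff c"
  have d: "rapid ?d" by (rule heat_series_has_partials(3)[OF assms])
  have eq: "Re (c 0 + c 1 * cis x) *\<^sub>R (1 * cis x) + Re (?d 0 + ?d 1 * cis x) *\<^sub>R (\<i> * cis x)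
      = cnj (c 1) + Re (c 0) *\<^sub>R cis x" for x
  proof -
    \<comment> \<open>Since \<open>?d 0 = 0\<close> and \<open>?d 1 = \<i> * c 1\<close>, the mode 1
      contributes \<open>Re ?z + \<i> * Re (\<i> * ?z) = cnj ?z\<close> as a factor of
      \<open>cis x\<close>; the dependence on \<open>x\<close> then cancels.\<close>
    let ?z = "c 1 * cis x"
    have "Re (c 0 + ?z) *\<^sub>R (1 * cis x) + Re (?d 0 + ?d 1 * cis x) *\<^sub>R (\<i> * cis x)
        = Re (c 0) *\<^sub>R cis x + cnj ?z * cis x"
      by (simp add: scaleR_conv_of_real complex_eq_iff algebra_simps)
    also have "cnj ?z * cis x = cnj (c 1)" by (simp add: cis_cnj mult.assoc cis_mult)
    finally show ?thesis by simp
  qed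
  from conv_upto_add[OF conv_upto_scaleR_cis[OF conv_upto_heat_series[OF assms], of k 1]
      conv_upto_scaleR_cis[OF conv_upto_heat_series[OF d], of k \<i>]]
  show ?thesis unfolding eq by simp
qed

lemma conv_upto_cong:
  assumes "conv_upto k f g" "\<And>t. t \<ge> 0 \<Longrightarrow> f2 t = f t"
  shows "conv_upto k f2 g"
proof -
  have "\<forall>\<^sub>F t in at_top. \<forall>x\<in>UNIV. f t x = f2 t x"
    using eventually_ge_at_top[of 0] by eventually_elim (simp add: assms(2))
  then have "uniform_limit UNIV f g at_top \<longleftrightarrow> uniform_limit UNIV f2 g at_top"
    by (rule uniform_limit_cong) simp
  then show ?thesis using assms by (cases k) (auto simp: conv_upto.simps(2))
qed

text \<open>In the normal angle the curve is determined by \<open>coeff\<close> and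
  \<open>t\<close>, so the parametrizations may be chosen independently for each time without
  affecting convergence.\<close>

lemma (in legendre_flow) flow_convergence:
  obtains \<sigma> where "\<And>t. t \<ge> 0 \<Longrightarrow> normal_param t (\<sigma> t)"
    and "\<And>k. conv_upto k (\<lambda>t. \<gamma> t \<circ> \<sigma> t) (\<lambda>\<theta>. cnj (coeff 1) + Re (coeff 0) *\<^sub>R cis \<theta>)"
proof -
  obtain \<sigma> where \<sigma>: "\<And>t. t \<ge> 0 \<Longrightarrow> normal_param t (\<sigma> t)" using normal_param_exists by metis
  have "\<gamma> t \<circ> \<sigma> t = (\<lambda>\<theta>. Re (heat_series coeff t \<theta>) *\<^sub>R cis \<theta>
      + Re (heat_series (dx_coeff coeff) t \<theta>) *\<^sub>R (\<i> * cis \<theta>))" if t: "t \<ge> 0" for t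
  proof -
    have "vderiv (\<lambda>\<theta>. Re (heat_series coeff t \<theta>)) = (\<lambda>\<theta>. Re (heat_series (dx_coeff coeff) t \<theta>))"
      by (rule vderiv_eqI[OF has_partialsD(3)[OF has_partials_Re[OF heat_series_has_partials(1)[OF rapid_coeff]] t]])
    then show ?thesis
      unfolding support_facts(3)[OF t \<sigma>[OF t]] support_eq_heat_series[OF t \<sigma>[OF t]] support_curve_def[abs_def] by simp
  qed
  from conv_upto_cong[OF conv_upto_support_curve[OF rapid_coeff] this] show ?thesis using that \<sigma> by blast
qed


theorem theorem1p3:
  fixes \<gamma>\<^sub>0 \<nu>\<^sub>0 :: "real \<Rightarrow> complex" and L\<^sub>0 :: real
  assumes "ell_convex \<gamma>\<^sub>0 \<nu>\<^sub>0"
    and "\<forall>\<theta>. ell \<nu>\<^sub>0 \<theta> = 1"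
    and "L\<^sub>0 = algebraic_length \<gamma>\<^sub>0 \<nu>\<^sub>0"
    and "L\<^sub>0 \<ge> 0"
  shows "(\<exists>\<gamma> \<nu>. flow_solution \<gamma>\<^sub>0 \<nu>\<^sub>0 \<gamma> \<nu>) \<and>
    (\<forall>\<gamma> \<nu>. flow_solution \<gamma>\<^sub>0 \<nu>\<^sub>0 \<gamma> \<nu> \<longrightarrow>
       (\<forall>t\<ge>0. ell_convex (\<gamma> t) (\<nu> t)) \<and>
       (\<forall>t\<ge>0. algebraic_length (\<gamma> t) (\<nu> t) = L\<^sub>0) \<and>
       (\<exists>c. converges_to_circle \<gamma> \<nu> c (L\<^sub>0 / (2 * pi))) \<and>
       (L\<^sub>0 = 0 \<longrightarrow> (\<exists>q. uniform_limit UNIV \<gamma> (\<lambda>_. q) at_top)))"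
proof -
  have L: "legendre_curve \<gamma>\<^sub>0 \<nu>\<^sub>0" using assms(1) by (simp add: ell_convex_def)
  then have lc: "periodic \<gamma>\<^sub>0" "smooth \<gamma>\<^sub>0" "smooth \<nu>\<^sub>0" "\<And>\<theta>. norm (\<nu>\<^sub>0 \<theta>) = 1"
      "\<And>\<theta>. vderiv \<gamma>\<^sub>0 \<theta> \<bullet> \<nu>\<^sub>0 \<theta> = 0"
    by (auto simp: legendre_curve_def)
  have existence: "\<exists>\<gamma> \<nu>. flow_solution \<gamma>\<^sub>0 \<nu>\<^sub>0 \<gamma> \<nu>"
  proof -
    obtain a where a: "\<And>\<theta>. \<nu>\<^sub>0 \<theta> = cis (\<theta> + a)"
      using normal_eq_cis[OF lc(3,4)] assms(2) by metis
    \<comment> \<open>The initial curve in its normal angle; translating back by \<open>a\<close> at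
      the end restores the given labels.\<close>
    define G where "G \<theta> = \<gamma>\<^sub>0 (\<theta> + (- a))" for \<theta>
    have smG: "smooth G" unfolding G_def by (rule smooth_shift[OF lc(2)])
    have "vderiv G \<theta> \<bullet> cis \<theta> = 0" for \<theta>
      using lc(5)[of "\<theta> + (- a)"] a[of "\<theta> + (- a)"] by (simp add: G_def[abs_def] vderiv_shift[of _ "- a", simplified])
    note rep = support_representation[OF smG this]
    have "G (\<theta> + 2 * pi) = G \<theta>" for \<theta>
    proof -
      have "\<theta> + 2 * pi + (- a) = (\<theta> + (- a)) + 2 * pi" by simp
      then show ?thesis using lc(1) unfolding G_def periodic_def by metis
    qed
    then have "periodic (\<lambda>\<theta>. G \<theta> \<bullet> cis \<theta>)"
      using periodic_cis_int[of 1] by (simp add: periodic_def)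
    from flow_exists[OF rep(1) this, of a]
    have "\<exists>\<gamma> \<nu>. flow_solution (\<lambda>u. G (u + a)) (\<lambda>u. cis (u + a)) \<gamma> \<nu>"
      unfolding rep(2)[symmetric] .
    moreover have "(\<lambda>u. G (u + a)) = \<gamma>\<^sub>0" "(\<lambda>u. cis (u + a)) = \<nu>\<^sub>0" using a by (auto simp: G_def)
    ultimately show ?thesis by simp
  qed
  have "(\<forall>t\<ge>0. ell_convex (\<gamma> t) (\<nu> t)) \<and>
       (\<forall>t\<ge>0. algebraic_length (\<gamma> t) (\<nu> t) = L\<^sub>0) \<and>
       (\<exists>c. converges_to_circle \<gamma> \<nu> c (L\<^sub>0 / (2 * pi))) \<and>
       (L\<^sub>0 = 0 \<longrightarrow> (\<exists>q. uniform_limit UNIV \<gamma> (\<lambda>_. q) at_top))"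
    if "flow_solution \<gamma>\<^sub>0 \<nu>\<^sub>0 \<gamma> \<nu>" for \<gamma> \<nu>
  proof -
    interpret legendre_flow \<gamma>\<^sub>0 \<nu>\<^sub>0 \<gamma> \<nu> by (unfold_locales) (rule L that)+
    have L0: "L\<^sub>0 = 2 * pi * Re (coeff 0)"
      using algebraic_length_flow[of 0] by (simp add: start assms(3))
    then have r: "Re (coeff 0) = L\<^sub>0 / (2 * pi)" by simp
    obtain \<sigma> where \<sigma>: "\<And>t. t \<ge> 0 \<Longrightarrow> normal_param t (\<sigma> t)"
      and conv: "\<And>k. conv_upto k (\<lambda>t. \<gamma> t \<circ> \<sigma> t) (\<lambda>\<theta>. cnj (coeff 1) + (L\<^sub>0 / (2 * pi)) *\<^sub>R cis \<theta>)"
      using flow_convergence unfolding r by metis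
    have "converges_to_circle \<gamma> \<nu> (cnj (coeff 1)) (L\<^sub>0 / (2 * pi))"
      unfolding converges_to_circle_def
      using \<sigma> conv_upto_vderiv[OF conv] by (intro exI[of _ \<sigma>]) (auto simp: normal_param_def)
    moreover have "uniform_limit UNIV \<gamma> (\<lambda>_. cnj (coeff 1)) at_top" if "L\<^sub>0 = 0"
    \<comment> \<open>For radius 0 the limit is constant in \<open>\<theta>\<close>, so uniformity
      in the normal angle becomes uniformity over the labels, because each \<open>\<sigma> t\<close>
      is surjective.\<close>
    proof (rule uniform_limitI)
      fix e :: real assume "0 < e"
      with conv_upto_uniform_limit[OF conv]
      have "\<forall>\<^sub>F t in at_top. \<forall>\<theta>\<in>UNIV. dist ((\<gamma> t \<circ> \<sigma> t) \<theta>) (cnj (coeff 1)) < e"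
        by (simp add: uniform_limit_iff that)
      then show "\<forall>\<^sub>F t in at_top. \<forall>u\<in>UNIV. dist (\<gamma> t u) (cnj (coeff 1)) < e"
        using eventually_ge_at_top[of 0]
      proof eventually_elim
        case (elim t)
        have "surj (\<sigma> t)" by (rule circle_reparamD(4)[OF normal_paramD(1)[OF elim(2) \<sigma>[OF elim(2)]]])
        then show ?case using elim(1) by (metis comp_apply surjD UNIV_I)
      qed
    qed
    ultimately show ?thesis
      using ell_convex_flow algebraic_length_flow L0 by auto
  qed
  with existence show ?thesis by blast
qed

end
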